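(* Fix $\epsilon\in\mathbb{R}$ and assume: (A1) the support $\mathcal{X}$ of $X$ is a compact subset of $\mathbb{R}^d$ and $\mathcal{X}_0$ is an inner closed subset of $\mathcal{X}$ with non-empty interior; (A2) the density $g$ of $X$ is strictly positive over $\mathcal{X}_0$ and has continuous second order partial derivatives over $\mathcal{X}$; (A3) the regression function $m$ has continuous second order partial derivatives over $\mathcal{X}$; (A4) the i.i.d. centered errors $\varepsilon,\varepsilon_i$ have finite 6th moments and are independent of the covariates $X,X_i$; (A5) the density $f$ of $\varepsilon$ has bounded continuous second order derivatives over $\mathbb{R}$ and, with $h_p(e)=e^pf(e)$, $\sup_{e\in\mathbb{R}}|h_p^{(k)}(e)|<\infty$ for all $p,k\in\{0,1,2\}$; (A7) $K_0$ is symmetric, continuous over $\mathbb{R}^d$ with support contained in $[-1/2,1/2]^d$, and $\int K_0(z)dz=1$; (A8) $K_1$ has compact support, is three times continuously differentiable over $\mathbb{R}$, $\int K_1(v)dv=1$ and $\int vK_1(v)dv=0$; (A9) $b_0$ decreases to $0$ and, with $d^*=\sup\{d+2,2d\}$, $nb_0^{d^*}/\ln n\to\infty$ and $\ln(1/b_0)/\ln(\ln n)\to\infty$ as $n\to\infty$; (A10) $b_1$ decreases to $0$ and $n^{d+8}b_1^{7(d+4)}\to\infty$ as $n\to\infty$. Then, when $b_0$ and $b_1$ go to $0$, $$\widehat f_{1n}(\epsilon)-f(\epsilon)=O_{\mathbb{P}}\Big(AMSE(b_1)+R_n(b_0,b_1)\Big)^{1/2},$$ where $$AMSE(b_1)=\mathbb{E}_n\Big[\big(\widetilde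 f_{1n}(\epsilon)-f(\epsilon)\big)^2\Big]=O_{\mathbb{P}}\Big(b_1^4+\frac{1}{nb_1}\Big)$$ and $$R_n(b_0,b_1)=b_0^4+\left[\frac{1}{(nb_1^5)^{1/2}}+\left(\frac{b_0^d}{b_1^3}\right)^{1/2}\right]^2\left(b_0^4+\frac{1}{nb_0^d}\right)^2+\left[\frac{1}{b_1}+\left(\frac{b_0^d}{b_1^7}\right)^{1/2}\right]^2\left(b_0^4+\frac{1}{nb_0^d}\right)^3.$$
   Context: $(X,Y),(X_1,Y_1),\dots,(X_n,Y_n)$ are i.i.d., with $X$ valued in $\mathbb{R}^d$ and $Y$ real. $m(x)=\mathbb{E}[Y\mid X=x]$, $\varepsilon=Y-m(X)$ and $Y_i=m(X_i)+\varepsilon_i$. $g$ is the density of $X$, $f$ the density of $\varepsilon$. "Inner subset" of $\mathcal{X}$ means contained in the interior of $\mathcal{X}$ (away from its boundary). $K_0:\mathbb{R}^d\to\mathbb{R}$ and $K_1:\mathbb{R}\to\mathbb{R}$ are kernel functions; $b_0=b_0(n)>0$, $b_1=b_1(n)>0$ are bandwidths. $\mathbb{E}_n[\cdot]$ is the conditional expectation given $X_1,\dots,X_n$. Leave-one-out regression estimator and estimated residuals: $$\widehat m_{in}=\frac{\sum_{j\ne i}Y_jK_0\left(\frac{X_j-X_i}{b_0}\right)}{\sum_{j\ne i}K_0\left(\frac{X_j-X_i}{b_0}\right)},\qquad \widehat\varepsilon_i=Y_i-\widehat m_{in}.$$ Feasible (two-steps) and unfeasible kernel estimators of $f(\epsilon)$: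 $$\widehat f_{1n}(\epsilon)=\frac{\sum_{i=1}^n\mathbf{1}(X_i\in\mathcal{X}_0)K_1\left(\frac{\widehat\varepsilon_i-\epsilon}{b_1}\right)}{b_1\sum_{i=1}^n\mathbf{1}(X_i\in\mathcal{X}_0)},\qquad \widetilde f_{1n}(\epsilon)=\frac{\sum_{i=1}^n\mathbf{1}(X_i\in\mathcal{X}_0)K_1\left(\frac{\varepsilon_i-\epsilon}{b_1}\right)}{b_1\sum_{i=1}^n\mathbf{1}(X_i\in\mathcal{X}_0)}.$$ $O_{\mathbb{P}}(a_n)^{1/2}$ means $O_{\mathbb{P}}(a_n^{1/2})$. *)

theory Defs
  imports "HOL-Probability.Probability"
begin

(* Topological support of the law of Z. *)
definition rv_support :: "'a measure \<Rightarrow> ('a \<Rightarrow> 'b::metric_space) \<Rightarrow> 'b set" where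
  "rv_support M Z = {x. \<forall>r>0. measure M {\<omega> \<in> space M. Z \<omega> \<in> ball x r} > 0}"

(* C^2 on a set S that need not be open, in the usual sense of C^2 up to the boundary: the partial
   derivatives D1 i = d_i u and D2 i j = d_j d_i u exist in the interior of S and, like u itself,
   extend continuously to S. Nothing is required of u outside S. *)
definition C2_over :: "(real^'d) set \<Rightarrow> (real^'d \<Rightarrow> real) \<Rightarrow> bool" where
  "C2_over S u \<longleftrightarrow>
    (\<exists>D1 D2. continuous_on S u \<and> (\<forall>i. continuous_on S (D1 i)) \<and> (\<forall>i j. continuous_on S (D2 i j)) \<and>
      (\<forall>x\<in>interior S. \<forall>i.
        ((\<lambda>t. u (x + t *\<^sub>R axis i 1)) has_real_derivative D1 i x) (at 0) \<and>
        (\<forall>j. ((\<lambda>t. D1 i (x + t *\<^sub>R axis j 1)) has_real_derivative D2 i j x) (at 0))))"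

definition Ck_real :: "nat \<Rightarrow> (real \<Rightarrow> real) \<Rightarrow> bool" where
  "Ck_real k u \<longleftrightarrow>
    (\<forall>j<k. (deriv ^^ j) u differentiable_on UNIV) \<and> continuous_on UNIV ((deriv ^^ k) u)"

(* m is a version of x \<mapsto> E[Y | X = x]. *)
definition regression_function ::
    "'a measure \<Rightarrow> ('a \<Rightarrow> real^'d) \<Rightarrow> ('a \<Rightarrow> real) \<Rightarrow> (real^'d \<Rightarrow> real) \<Rightarrow> bool" where
  "regression_function M X Y m \<longleftrightarrow>
    integrable M Y \<and> m \<in> borel_measurable borel \<and>
    (AE \<omega> in M. real_cond_exp M (vimage_algebra (space M) X borel) Y \<omega> = m (X \<omega>))"

definition reg_error ::
    "(real^'d \<Rightarrow> real) \<Rightarrow> (nat \<Rightarrow> 'a \<Rightarrow> real^'d) \<Rightarrow> (nat \<Rightarrow> 'a \<Rightarrow> real) \<Rightarrow> nat \<Rightarrow> 'a \<Rightarrow> real" where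
  "reg_error m X Y i \<omega> = Y i \<omega> - m (X i \<omega>)"

(* The library's indep_var needs both variables to have the same type. *)
definition indep_rv :: "'a measure \<Rightarrow> ('a \<Rightarrow> real^'d) \<Rightarrow> ('a \<Rightarrow> real) \<Rightarrow> bool" where
  "indep_rv M U V \<longleftrightarrow>
    U \<in> borel_measurable M \<and> V \<in> borel_measurable M \<and>
    prob_space.indep_set M {U -` A \<inter> space M | A. A \<in> sets borel} {V -` B \<inter> space M | B. B \<in> sets borel}"

(* Conditional expectation given X 1, ..., X n. *)
definition cond_exp_n ::
    "'a measure \<Rightarrow> (nat \<Rightarrow> 'a \<Rightarrow> real^'d) \<Rightarrow> nat \<Rightarrow> ('a \<Rightarrow> real) \<Rightarrow> 'a \<Rightarrow> real" where
  "cond_exp_n M X n Z =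
    real_cond_exp M
      (vimage_algebra (space M) (\<lambda>\<omega>. \<lambda>i\<in>{1..n}. X i \<omega>) (\<Pi>\<^sub>M i\<in>{1..n}. borel)) Z"

(* The quotients below take the value 0 where the denominator vanishes. *)
definition m_loo ::
    "(real^'d \<Rightarrow> real) \<Rightarrow> real \<Rightarrow> (nat \<Rightarrow> 'a \<Rightarrow> real^'d) \<Rightarrow> (nat \<Rightarrow> 'a \<Rightarrow> real) \<Rightarrow> nat \<Rightarrow> nat \<Rightarrow> 'a \<Rightarrow> real"
  where
  "m_loo K0 h0 X Y n i \<omega> =
    (\<Sum>j\<in>{1..n} - {i}. Y j \<omega> * K0 ((X j \<omega> - X i \<omega>) /\<^sub>R h0)) /
    (\<Sum>j\<in>{1..n} - {i}. K0 ((X j \<omega> - X i \<omega>) /\<^sub>R h0))"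

definition est_error ::
    "(real^'d \<Rightarrow> real) \<Rightarrow> real \<Rightarrow> (nat \<Rightarrow> 'a \<Rightarrow> real^'d) \<Rightarrow> (nat \<Rightarrow> 'a \<Rightarrow> real) \<Rightarrow> nat \<Rightarrow> nat \<Rightarrow> 'a \<Rightarrow> real"
  where
  "est_error K0 h0 X Y n i \<omega> = Y i \<omega> - m_loo K0 h0 X Y n i \<omega>"

(* Kernel density estimator at the point e built from the values r i \<omega> for which X i \<omega> \<in> X0;
   the residuals r are the estimated or the true errors. *)
definition kernel_density ::
    "(real \<Rightarrow> real) \<Rightarrow> real \<Rightarrow> (real^'d) set \<Rightarrow> (nat \<Rightarrow> 'a \<Rightarrow> real^'d) \<Rightarrow> (nat \<Rightarrow> 'a \<Rightarrow> real)
      \<Rightarrow> nat \<Rightarrow> real \<Rightarrow> 'a \<Rightarrow> real" where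
  "kernel_density K1 h1 X0 X r n e \<omega> =
    (\<Sum>i=1..n. indicator X0 (X i \<omega>) * K1 ((r i \<omega> - e) / h1)) /
    (h1 * (\<Sum>i=1..n. indicator X0 (X i \<omega>)))"

definition f_feasible ::
    "(real^'d \<Rightarrow> real) \<Rightarrow> (real \<Rightarrow> real) \<Rightarrow> real \<Rightarrow> real \<Rightarrow> (real^'d) set
      \<Rightarrow> (nat \<Rightarrow> 'a \<Rightarrow> real^'d) \<Rightarrow> (nat \<Rightarrow> 'a \<Rightarrow> real) \<Rightarrow> nat \<Rightarrow> real \<Rightarrow> 'a \<Rightarrow> real" where
  "f_feasible K0 K1 h0 h1 X0 X Y n e = kernel_density K1 h1 X0 X (est_error K0 h0 X Y n) n e"

definition f_unfeasible ::
    "(real \<Rightarrow> real) \<Rightarrow> real \<Rightarrow> (real^'d) set \<Rightarrow> (real^'d \<Rightarrow> real)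
      \<Rightarrow> (nat \<Rightarrow> 'a \<Rightarrow> real^'d) \<Rightarrow> (nat \<Rightarrow> 'a \<Rightarrow> real) \<Rightarrow> nat \<Rightarrow> real \<Rightarrow> 'a \<Rightarrow> real" where
  "f_unfeasible K1 h1 X0 m X Y n e = kernel_density K1 h1 X0 X (reg_error m X Y) n e"

definition AMSE ::
    "'a measure \<Rightarrow> (real \<Rightarrow> real) \<Rightarrow> real \<Rightarrow> (real^'d) set \<Rightarrow> (real^'d \<Rightarrow> real)
      \<Rightarrow> (nat \<Rightarrow> 'a \<Rightarrow> real^'d) \<Rightarrow> (nat \<Rightarrow> 'a \<Rightarrow> real) \<Rightarrow> (real \<Rightarrow> real) \<Rightarrow> nat \<Rightarrow> real \<Rightarrow> 'a \<Rightarrow> real" where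
  "AMSE M K1 h1 X0 m X Y f n e =
    cond_exp_n M X n (\<lambda>\<omega>. (f_unfeasible K1 h1 X0 m X Y n e \<omega> - f e)\<^sup>2)"

definition R_rate :: "nat \<Rightarrow> nat \<Rightarrow> real \<Rightarrow> real \<Rightarrow> real" where
  "R_rate d n h0 h1 =
    h0 ^ 4
    + (1 / sqrt (n * h1 ^ 5) + sqrt (h0 ^ d / h1 ^ 3))\<^sup>2 * (h0 ^ 4 + 1 / (n * h0 ^ d))\<^sup>2
    + (1 / h1 + sqrt (h0 ^ d / h1 ^ 7))\<^sup>2 * (h0 ^ 4 + 1 / (n * h0 ^ d)) ^ 3"

(* Z n = O_P(a n), where the rate a n may itself be random. Membership in sets M is required
   because measure M returns 0 on non-measurable sets. *)
definition big_O_prob :: "'a measure \<Rightarrow> (nat \<Rightarrow> 'a \<Rightarrow> real) \<Rightarrow> (nat \<Rightarrow> 'a \<Rightarrow> real) \<Rightarrow> bool" where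
  "big_O_prob M Z a \<longleftrightarrow>
    (\<forall>\<delta>>0. \<exists>C>0. \<forall>\<^sub>F n in sequentially.
      {\<omega> \<in> space M. \<bar>Z n \<omega>\<bar> > C * \<bar>a n \<omega>\<bar>} \<in> sets M \<and>
      measure M {\<omega> \<in> space M. \<bar>Z n \<omega>\<bar> > C * \<bar>a n \<omega>\<bar>} \<le> \<delta>)"

end

theory Submission
  imports Defs
begin

text \<open>
  The proof conditions on the design, that is, on the covariates. Let \<open>\<Delta> i\<close> denote the
  error of the leave-one-out regression estimator at \<open>X i\<close>. For a fixed design it is a bias
  plus a linear combination of the errors in which the \<open>i\<close>-th error has weight 0. The
  feasible estimator evaluates the kernel at \<open>\<epsilon> i - \<Delta> i\<close> and the oracle estimator at \<open>\<epsilon> i\<close>. The difference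
  of the two kernel values is split into its mean for a frozen argument \<open>\<Delta> i\<close> and a centred rest.

  The centred rests behave like uncorrelated variables although their arguments depend on all errors:
  a pair of them is correlated only through the weights with which each error enters the
  other argument (\<open>second_moment_decoupled\<close>). Together with the gain from the compact support of
  the kernel (\<open>kernel_shift_second_moment\<close>), their contribution to the mean-square error is of order
  \<open>v / (n * b1 ^ 3)\<close>, where \<open>v = b0 ^ 4 + 1 / (n * b0 ^ d)\<close> is the mean-square error of the regression
  estimator.

  The means are smooth functions of \<open>\<Delta> i\<close>, because a shift of the error can be moved onto
  the density (\<open>mean_kernel_shift\<close>): they consist of a linear term, whose coefficient is the derivative of
  the smoothed density, and of a remainder of order \<open>(\<Delta> i)\<^sup>2\<close>. The average of the \<open>\<Delta> i\<close> is of order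
  \<open>b0\<^sup>2 + 1 / sqrt n\<close>, since each error enters it with a bounded total weight. The stochastic part,
  of order \<open>1 / sqrt n\<close>, has to be compared with the actual conditional mean-square error of the oracle
  estimator, which may be far below its upper bound. This is possible because a nonnegative
  density with bounded second derivative satisfies \<open>f'\<^sup>2 \<le> C * f\<close>, so that the coefficient of the linear
  term is itself small wherever the variance is small (\<open>slope_square_le_oracle_mse\<close>).

  These bounds are collected in \<open>residual_density_error\<close> for every design whose leave-one-out weights
  and biases are of the expected order, and \<open>rate_terms_le\<close> compares them with the rate. Bernstein's inequality shows that the design
  has these properties with probability tending to 1 (\<open>good_design_probability\<close>). Finally, the design
  and the errors are independent, so the conditional mean-square error is an integral over the errors
  alone (\<open>law_of_independent_pairs\<close>, \<open>real_cond_exp_product_law\<close>), and Markov's inequality turns the bounds into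
  rates in probability (\<open>rates_in_probability\<close>).
\<close>

section \<open>Samples from a product law\<close>

lemma abs_mult_le_sum_squares: "\<bar>x * y\<bar> \<le> x\<^sup>2 + (y::real)\<^sup>2"
proof -
  have "2 * \<bar>x * y\<bar> \<le> x\<^sup>2 + y\<^sup>2"
    using sum_squares_bound[of "\<bar>x\<bar>" "\<bar>y\<bar>"] by (simp add: abs_mult mult.assoc)
  moreover have "0 \<le> \<bar>x * y\<bar>" by simp
  ultimately show ?thesis by linarith
qed

locale iid_sample = prob_space \<mu> for \<mu> :: "'b measure" +
  fixes I :: "'i set"
  assumes finite_index: "finite I"
begin

abbreviation sample_law :: "('i \<Rightarrow> 'b) measure" where
  "sample_law \<equiv> \<Pi>\<^sub>M i\<in>I. \<mu>"

sublocale sample: prob_space sample_law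
  by (rule prob_space_PiM) (rule prob_space_axioms)

sublocale prod: product_prob_space "\<lambda>_. \<mu>" I ..

lemma measurable_resample:
  "i \<in> I \<Longrightarrow> (\<lambda>(y, a). y(i := a)) \<in> measurable (sample_law \<Otimes>\<^sub>M \<mu>) sample_law"
  using measurable_add_dim[of i I "\<lambda>_. \<mu>"] by (simp add: insert_absorb)

text \<open>
  Replacing one coordinate of an i.i.d. sample by an independent copy does not change its law.
  This is the only form of Fubini's theorem on product spaces used below: it lets one integrate a
  single coordinate first while all other coordinates keep their joint law.
\<close>

lemma distr_resample:
  assumes i: "i \<in> I"
  shows "distr (sample_law \<Otimes>\<^sub>M \<mu>) sample_law (\<lambda>(y, a). y(i := a)) = sample_law"
proof -
  note [measurable] = measurable_resample[OF i]
  interpret pp: pair_prob_space sample_law \<mu> ..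
  show ?thesis
  proof (rule prod.PiM_eqI[OF finite_index])
    fix A assume A: "\<And>k. k \<in> I \<Longrightarrow> A k \<in> sets \<mu>"
    have [measurable]: "Pi\<^sub>E I A \<in> sets sample_law"
      using A finite_index by (intro sets_PiM_I_finite) auto
    define A' where "A' = A(i := space \<mu>)"
    have A': "\<And>k. k \<in> I \<Longrightarrow> A' k \<in> sets \<mu>"
      using A by (auto simp: A'_def)
    have "(\<lambda>(y, a). y(i := a)) -` (Pi\<^sub>E I A) \<inter> space (sample_law \<Otimes>\<^sub>M \<mu>) = Pi\<^sub>E I A' \<times> A i"
      (is "?V = _")
    proof (rule set_eqI, clarify)
      fix y :: "'i \<Rightarrow> 'b" and a
      have sub: "A k \<subseteq> space \<mu>" if "k \<in> I" for k
        using A[OF that] by (rule sets.sets_into_space)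
      have ext: "y(i := a) \<in> extensional I \<longleftrightarrow> y \<in> extensional I"
        using i by (auto simp: extensional_def)
      have "y(i := a) \<in> Pi I A \<longleftrightarrow> a \<in> A i \<and> (\<forall>k\<in>I - {i}. y k \<in> A k)"
        using i by (auto simp: Pi_iff)
      moreover have "y \<in> Pi I A' \<longleftrightarrow> y i \<in> space \<mu> \<and> (\<forall>k\<in>I - {i}. y k \<in> A k)"
        using i by (auto simp: Pi_iff A'_def)
      ultimately show "(y, a) \<in> ?V \<longleftrightarrow> (y, a) \<in> Pi\<^sub>E I A' \<times> A i"
        using sub i ext by (auto simp: space_pair_measure space_PiM PiE_def Pi_iff)
    qed
    then have "emeasure (distr (sample_law \<Otimes>\<^sub>M \<mu>) sample_law (\<lambda>(y, a). y(i := a))) (Pi\<^sub>E I A)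
      = emeasure (sample_law \<Otimes>\<^sub>M \<mu>) (Pi\<^sub>E I A' \<times> A i)"
      by (subst emeasure_distr) auto
    also have "\<dots> = emeasure sample_law (Pi\<^sub>E I A') * emeasure \<mu> (A i)"
      using A A' i finite_index by (subst emeasure_pair_measure_Times) (auto intro!: sets_PiM_I_finite)
    also have "emeasure sample_law (Pi\<^sub>E I A') = (\<Prod>k\<in>I. emeasure \<mu> (A' k))"
      using A' by (intro prod.emeasure_PiM[OF finite_index])
    also have "\<dots> = emeasure \<mu> (A' i) * (\<Prod>k\<in>I-{i}. emeasure \<mu> (A' k))"
      using i finite_index by (simp add: prod.remove)
    also have "\<dots> = (\<Prod>k\<in>I-{i}. emeasure \<mu> (A k))"
      by (auto simp: A'_def emeasure_space_1 intro!: prod.cong)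
    also have "\<dots> * emeasure \<mu> (A i) = (\<Prod>k\<in>I. emeasure \<mu> (A k))"
      using i finite_index by (simp add: prod.remove mult.commute)
    finally show "emeasure (distr (sample_law \<Otimes>\<^sub>M \<mu>) sample_law (\<lambda>(y, a). y(i := a))) (Pi\<^sub>E I A)
      = (\<Prod>k\<in>I. emeasure \<mu> (A k))" .
  qed auto
qed

lemma integral_resample:
  fixes F :: "('i \<Rightarrow> 'b) \<Rightarrow> real"
  assumes i: "i \<in> I" and F: "integrable sample_law F"
  shows "(\<integral>y. F y \<partial>sample_law) = (\<integral>y. (\<integral>a. F (y(i := a)) \<partial>\<mu>) \<partial>sample_law)"
    and "integrable sample_law (\<lambda>y. \<integral>a. F (y(i := a)) \<partial>\<mu>)"
proof -
  note [measurable] = measurable_resample[OF i] borel_measurable_integrable[OF F]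
  interpret pp: pair_prob_space sample_law \<mu> ..
  have int: "integrable (sample_law \<Otimes>\<^sub>M \<mu>) (\<lambda>(y, a). F (y(i := a)))"
  proof -
    have "integrable (distr (sample_law \<Otimes>\<^sub>M \<mu>) sample_law (\<lambda>(y, a). y(i := a))) F"
      unfolding distr_resample[OF i] by (rule F)
    then show ?thesis by (subst (asm) integrable_distr_eq) (auto simp: split_beta')
  qed
  have "(\<integral>y. F y \<partial>sample_law) = (\<integral>y. F y \<partial>distr (sample_law \<Otimes>\<^sub>M \<mu>) sample_law (\<lambda>(y, a). y(i := a)))"
    unfolding distr_resample[OF i] ..
  also have "\<dots> = (\<integral>p. (\<lambda>(y, a). F (y(i := a))) p \<partial>(sample_law \<Otimes>\<^sub>M \<mu>))"
    by (subst integral_distr) (auto simp: split_beta')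
  also have "\<dots> = (\<integral>y. (\<integral>a. F (y(i := a)) \<partial>\<mu>) \<partial>sample_law)"
    using pp.integral_fst'[OF int] by simp
  finally show "(\<integral>y. F y \<partial>sample_law) = (\<integral>y. (\<integral>a. F (y(i := a)) \<partial>\<mu>) \<partial>sample_law)" .
  show "integrable sample_law (\<lambda>y. \<integral>a. F (y(i := a)) \<partial>\<mu>)"
    using pp.integrable_fst'[OF int] by simp
qed

text \<open>
  A bound for an event that holds uniformly over the value of one coordinate is a bound for the
  event itself. It is used with the observation at which a local sum is centred.
\<close>

lemma prob_resample_le:
  assumes i: "i \<in> I" and B: "B \<in> sets sample_law"
    and le: "\<And>a. a \<in> space \<mu> \<Longrightarrow>
      measure sample_law {y \<in> space sample_law. y(i := a) \<in> B} \<le> q"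
  shows "measure sample_law B \<le> q"
proof -
  note [measurable] = measurable_resample[OF i] B
  interpret pp: pair_prob_space sample_law \<mu> ..
  have q: "0 \<le> q"
    using le not_empty measure_nonneg order_trans by blast
  let ?S = "(\<lambda>(y, a). y(i := a)) -` B \<inter> space (sample_law \<Otimes>\<^sub>M \<mu>)"
  have S: "?S \<in> sets (sample_law \<Otimes>\<^sub>M \<mu>)"
    by measurable
  have "emeasure sample_law B = emeasure (sample_law \<Otimes>\<^sub>M \<mu>) ?S"
    by (subst distr_resample[OF i, symmetric]) (simp add: emeasure_distr)
  also have "\<dots> = (\<integral>\<^sup>+a. emeasure sample_law ((\<lambda>y. (y, a)) -` ?S) \<partial>\<mu>)"
    by (rule pp.emeasure_pair_measure_alt2[OF S])
  also have "\<dots> \<le> (\<integral>\<^sup>+a. ennreal q \<partial>\<mu>)"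
  proof (rule nn_integral_mono)
    fix a assume a: "a \<in> space \<mu>"
    have "(\<lambda>y. (y, a)) -` ?S = {y \<in> space sample_law. y(i := a) \<in> B}"
      using a by (auto simp: space_pair_measure)
    then show "emeasure sample_law ((\<lambda>y. (y, a)) -` ?S) \<le> ennreal q"
      using le[OF a] by (simp add: sample.emeasure_eq_measure ennreal_leI)
  qed
  also have "\<dots> = ennreal q" by (simp add: emeasure_space_1)
  finally show ?thesis using q by (simp add: sample.emeasure_eq_measure)
qed

lemma integral_mult_resample_zero:
  fixes G H :: "('i \<Rightarrow> 'b) \<Rightarrow> real"
  assumes i: "i \<in> I" and GH: "integrable sample_law (\<lambda>y. G y * H y)"
    and G: "\<And>y a. G (y(i := a)) = G y"
    and H: "\<And>y. (\<integral>a. H (y(i := a)) \<partial>\<mu>) = 0"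
  shows "(\<integral>y. G y * H y \<partial>sample_law) = 0"
  by (subst integral_resample(1)[OF i GH]) (simp add: G H)

lemma integral_coordinate:
  fixes h :: "'b \<Rightarrow> real"
  assumes i: "i \<in> I" and [measurable]: "h \<in> borel_measurable \<mu>"
  shows "(\<integral>y. h (y i) \<partial>sample_law) = (\<integral>a. h a \<partial>\<mu>)"
    and "integrable sample_law (\<lambda>y. h (y i)) \<longleftrightarrow> integrable \<mu> h"
proof -
  have d: "distr sample_law \<mu> (\<lambda>y. y i) = \<mu>"
    using distr_PiM_component[OF prob_space_axioms i] by simp
  show "(\<integral>y. h (y i) \<partial>sample_law) = (\<integral>a. h a \<partial>\<mu>)"
    by (subst (2) d[symmetric], subst integral_distr) (use i in auto)
  show "integrable sample_law (\<lambda>y. h (y i)) \<longleftrightarrow> integrable \<mu> h"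
    by (subst (2) d[symmetric], subst integrable_distr_eq) (use i in auto)
qed

lemma second_moment_centred_sum:
  fixes h :: "'b \<Rightarrow> real" and a :: "'i \<Rightarrow> real"
  assumes [measurable]: "h \<in> borel_measurable \<mu>"
    and h2: "integrable \<mu> (\<lambda>u. (h u)\<^sup>2)" and h0: "(\<integral>u. h u \<partial>\<mu>) = 0" and KI: "K \<subseteq> I"
  shows "(\<integral>y. (c + (\<Sum>k\<in>K. a k * h (y k)))\<^sup>2 \<partial>sample_law)
      = c\<^sup>2 + (\<Sum>k\<in>K. (a k)\<^sup>2) * (\<integral>u. (h u)\<^sup>2 \<partial>\<mu>)" (is ?eq)
    and "integrable sample_law (\<lambda>y. (c + (\<Sum>k\<in>K. a k * h (y k)))\<^sup>2)" (is ?int)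
proof -
  have "finite K" using KI finite_index by (rule finite_subset)
  then have "?eq \<and> ?int \<and> integrable sample_law (\<lambda>y. c + (\<Sum>k\<in>K. a k * h (y k)))" using KI
  proof (induction K)
    case empty
    then show ?case by (simp add: sample.prob_space)
  next
    case (insert k K)
    let ?s = "\<lambda>y. c + (\<Sum>k\<in>K. a k * h (y k))"
    have k: "k \<in> I" using insert by auto
    have s2: "integrable sample_law (\<lambda>y. (?s y)\<^sup>2)" and s1: "integrable sample_law ?s"
      and sI: "(\<integral>y. (?s y)\<^sup>2 \<partial>sample_law) = c\<^sup>2 + (\<Sum>k\<in>K. (a k)\<^sup>2) * (\<integral>u. (h u)\<^sup>2 \<partial>\<mu>)"
      using insert by auto
    have [measurable]: "?s \<in> borel_measurable sample_law" using s1 by auto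
    have [measurable]: "(\<lambda>y. h (y k)) \<in> borel_measurable sample_law" using k by measurable
    have k2: "integrable sample_law (\<lambda>y. (h (y k))\<^sup>2)"
      using integral_coordinate(2)[OF k, of "\<lambda>u. (h u)\<^sup>2"] h2 by simp
    have h1: "integrable \<mu> h"
      by (rule square_integrable_imp_integrable) (use h2 in auto)
    have k1: "integrable sample_law (\<lambda>y. h (y k))"
      using integral_coordinate(2)[OF k, of h] h1 by simp
    have sk: "integrable sample_law (\<lambda>y. ?s y * h (y k))"
      by (rule Bochner_Integration.integrable_bound[OF Bochner_Integration.integrable_add[OF s2 k2]])
         (auto intro!: AE_I2 abs_mult_le_sum_squares)
    have z: "(\<integral>y. ?s y * h (y k) \<partial>sample_law) = 0"
    proof (rule integral_mult_resample_zero[OF k sk])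
      fix y b
      show "c + (\<Sum>j\<in>K. a j * h ((y(k := b)) j)) = ?s y"
        using insert.hyps by (auto intro!: sum.cong)
    qed (simp add: h0)
    have e: "(c + (\<Sum>j\<in>insert k K. a j * h (y j))) = ?s y + a k * h (y k)" for y
      using insert.hyps by simp
    have e2: "(c + (\<Sum>j\<in>insert k K. a j * h (y j)))\<^sup>2
        = (?s y)\<^sup>2 + 2 * a k * (?s y * h (y k)) + (a k)\<^sup>2 * (h (y k))\<^sup>2" for y
      unfolding e by (simp add: power2_eq_square algebra_simps)
    have kI: "(\<integral>y. (h (y k))\<^sup>2 \<partial>sample_law) = (\<integral>u. (h u)\<^sup>2 \<partial>\<mu>)"
      using integral_coordinate(1)[OF k, of "\<lambda>u. (h u)\<^sup>2"] by simp
    have "(\<integral>y. (c + (\<Sum>j\<in>insert k K. a j * h (y j)))\<^sup>2 \<partial>sample_law)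
        = (\<integral>y. (?s y)\<^sup>2 \<partial>sample_law) + 2 * a k * (\<integral>y. ?s y * h (y k) \<partial>sample_law)
          + (a k)\<^sup>2 * (\<integral>y. (h (y k))\<^sup>2 \<partial>sample_law)"
      unfolding e2 using s2 sk k2 by simp
    also have "\<dots> = c\<^sup>2 + (\<Sum>k\<in>insert k K. (a k)\<^sup>2) * (\<integral>u. (h u)\<^sup>2 \<partial>\<mu>)"
      unfolding sI z kI using insert.hyps by (simp add: ring_distribs)
    finally have 1: "(\<integral>y. (c + (\<Sum>j\<in>insert k K. a j * h (y j)))\<^sup>2 \<partial>sample_law) = \<dots>" .
    have 2: "integrable sample_law (\<lambda>y. (c + (\<Sum>j\<in>insert k K. a j * h (y j)))\<^sup>2)"
      unfolding e2 using s2 sk k2 by simp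
    have 3: "integrable sample_law (\<lambda>y. c + (\<Sum>j\<in>insert k K. a j * h (y j)))"
      unfolding e by (intro Bochner_Integration.integrable_add[OF s1] integrable_mult_right k1)
    show ?case using 1 2 3 by blast
  qed
  then show ?eq ?int by auto
qed

end

section \<open>Decoupling a sum from its leave-one-out arguments\<close>

locale iid_errors = iid_sample \<mu> I for \<mu> :: "real measure" and I :: "'i set" +
  assumes sets_errors [measurable_cong]: "sets \<mu> = sets borel"
    and centred: "(\<integral>u. u \<partial>\<mu>) = 0"
    and square_integrable: "integrable \<mu> (\<lambda>u. u\<^sup>2)"
begin

lemma space_errors [simp]: "space \<mu> = UNIV"
  using sets_eq_imp_space_eq[OF sets_errors] by simp

definition variance_errors :: real where
  "variance_errors = (\<integral>u. u\<^sup>2 \<partial>\<mu>)"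

text \<open>
  For a fixed design, the leave-one-out regression error at a design point has this form:
  \<open>c\<close> is its bias and \<open>a\<close> are the kernel weights of the other observations.
\<close>

definition lin_comb :: "real \<Rightarrow> ('i \<Rightarrow> real) \<Rightarrow> ('i \<Rightarrow> real) \<Rightarrow> real" where
  "lin_comb c a y = c + (\<Sum>k\<in>I. a k * y k)"

lemma lin_comb_measurable [measurable]: "lin_comb c a \<in> borel_measurable sample_law"
  unfolding lin_comb_def by measurable

lemma second_moment_lin_comb:
  "(\<integral>y. (lin_comb c a y)\<^sup>2 \<partial>sample_law) = c\<^sup>2 + (\<Sum>k\<in>I. (a k)\<^sup>2) * variance_errors"
  "integrable sample_law (\<lambda>y. (lin_comb c a y)\<^sup>2)"
  using second_moment_centred_sum[of "\<lambda>u. u" I c a] square_integrable centred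
  by (simp_all add: lin_comb_def variance_errors_def)

lemma lin_comb_upd:
  assumes "j \<in> I"
  shows "lin_comb c a (y(j := b)) = lin_comb c a y + a j * (b - y j)"
proof -
  have "(\<Sum>k\<in>I. a k * (y(j := b)) k) = a j * b + (\<Sum>k\<in>I-{j}. a k * y k)"
    using assms finite_index by (subst sum.remove[of _ j]) (auto intro!: sum.cong)
  moreover have "(\<Sum>k\<in>I. a k * y k) = a j * y j + (\<Sum>k\<in>I-{j}. a k * y k)"
    using assms finite_index by (subst sum.remove[of _ j]) auto
  ultimately show ?thesis by (simp add: lin_comb_def algebra_simps)
qed

text \<open>
  The key estimate. If the arguments \<open>\<Delta> i\<close> were constants, the summands would be independent and centred,
  and the second moment of the sum would be the sum of the second moments. Here \<open>\<Delta> i\<close> depends on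
  the other errors, but not on \<open>y i\<close>. Let \<open>V i j\<close> be the \<open>i\<close>-th summand \<open>U i\<close> with \<open>y j\<close> set to 0.
  Since \<open>V i j\<close> is free of \<open>y j\<close> and \<open>U j\<close> is centred in \<open>y j\<close>, the product \<open>V i j * U j\<close> has mean zero;
  likewise for \<open>U i * V j i\<close> and \<open>V i j * V j i\<close>. Hence
  \<open>E (U i * U j) = E ((U i - V i j) * (U j - V j i))\<close>, and each factor is as small in mean square
  as the weight \<open>w i j\<close> (respectively \<open>w j i\<close>) with which one error enters the other argument. The sum of all these squared
  weights is again controlled by the second moments of the \<open>\<Delta> i\<close>, so that dependence costs only
  a factor 2.
\<close>

lemma second_moment_decoupled:
  fixes \<phi> :: "real \<Rightarrow> real \<Rightarrow> real" and w :: "'i \<Rightarrow> 'i \<Rightarrow> real" and \<beta> :: "'i \<Rightarrow> real"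
  assumes J: "J \<subseteq> I" and w: "\<And>i. i \<in> J \<Longrightarrow> w i i = 0"
    and [measurable]: "case_prod \<phi> \<in> borel_measurable (borel \<Otimes>\<^sub>M borel)"
    and bdd: "\<And>a \<delta>. \<bar>\<phi> a \<delta>\<bar> \<le> B"
    and null: "\<And>a. \<phi> a 0 = 0"
    and zero: "\<And>\<delta>. (\<integral>a. \<phi> a \<delta> \<partial>\<mu>) = 0"
    and lip: "\<And>\<delta> \<delta>'. (\<integral>a. (\<phi> a \<delta> - \<phi> a \<delta>')\<^sup>2 \<partial>\<mu>) \<le> L * (\<delta> - \<delta>')\<^sup>2"
  shows "(\<integral>y. (\<Sum>i\<in>J. \<phi> (y i) (lin_comb (\<beta> i) (w i) y))\<^sup>2 \<partial>sample_law)
    \<le> 2 * L * (\<Sum>i\<in>J. \<integral>y. (lin_comb (\<beta> i) (w i) y)\<^sup>2 \<partial>sample_law)"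
proof -
  define U where "U i y = \<phi> (y i) (lin_comb (\<beta> i) (w i) y)" for i y
  define V where "V i j y = U i (y(j := 0))" for i j y
  have fJ: "finite J" using J finite_index by (rule finite_subset)
  have L0: "0 \<le> L"
    using order_trans[OF integral_nonneg_AE lip[of 1 0]] by (simp add: AE_I2)
  have U_meas [measurable]: "U i \<in> borel_measurable sample_law" if "i \<in> I" for i
    unfolding U_def using that by measurable
  have upd_meas [measurable]: "(\<lambda>y. y(j := 0)) \<in> measurable sample_law sample_law"
    if "j \<in> I" for j
    by (rule measurable_fun_upd[where J=I]) (use that in auto)
  have V_meas [measurable]: "V i j \<in> borel_measurable sample_law" if "i \<in> I" "j \<in> I" for i j
    unfolding V_def by (rule measurable_compose[OF upd_meas U_meas]) (use that in auto)
  have U_b: "\<bar>U i y\<bar> \<le> B" for i y unfolding U_def by (rule bdd)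
  have V_b: "\<bar>V i j y\<bar> \<le> B" for i j y unfolding V_def by (rule U_b)
  have B0: "0 \<le> B" using bdd[of 0 0] by linarith
  have int_mult: "integrable sample_law (\<lambda>y. f y * g y)"
    if "f \<in> borel_measurable sample_law" "g \<in> borel_measurable sample_law"
      "\<And>y. \<bar>f y\<bar> \<le> b" "\<And>y. \<bar>g y\<bar> \<le> c" for f g :: "('i \<Rightarrow> real) \<Rightarrow> real" and b c
    by (rule sample.integrable_const_bound[where B="b * c"])
       (use that in \<open>auto simp: abs_mult intro!: AE_I2 mult_mono order_trans[OF abs_ge_zero]\<close>)
  have bD: "\<bar>U i y - V i j y\<bar> \<le> 2 * B" for i j y
    using U_b[of i y] V_b[of i j y] by linarith
  have int_sq: "(\<integral>y. (U i y - V i j y)\<^sup>2 \<partial>sample_law) \<le> L * (w i j)\<^sup>2 * variance_errors"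
    if i: "i \<in> J" and j: "j \<in> I" "i \<noteq> j" for i j
  proof -
    have iI: "i \<in> I" using i J by auto
    note m = U_meas[OF iI] V_meas[OF iI j(1)]
    have D: "integrable sample_law (\<lambda>y. (U i y - V i j y)\<^sup>2)" unfolding power2_eq_square
      by (rule int_mult[OF _ _ bD bD]) (use m in measurable)
    have sqj: "integrable sample_law (\<lambda>y. (y j)\<^sup>2)"
      using integral_coordinate(2)[OF j(1), of "\<lambda>u. u\<^sup>2"] square_integrable by simp
    have "(\<integral>y. (U i y - V i j y)\<^sup>2 \<partial>sample_law)
        = (\<integral>y. (\<integral>a. (U i (y(i := a)) - V i j (y(i := a)))\<^sup>2 \<partial>\<mu>) \<partial>sample_law)"
      by (rule integral_resample(1)[OF iI D])
    also have "\<dots> \<le> (\<integral>y. L * (w i j)\<^sup>2 * (y j)\<^sup>2 \<partial>sample_law)"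
    proof (rule integral_mono[OF integral_resample(2)[OF iI D]])
      show "integrable sample_law (\<lambda>y. L * (w i j)\<^sup>2 * (y j)\<^sup>2)" using sqj by simp
      fix y :: "'i \<Rightarrow> real"
      let ?\<delta> = "lin_comb (\<beta> i) (w i) y"
      have 1: "U i (y(i := a)) = \<phi> a ?\<delta>" for a
        unfolding U_def using lin_comb_upd[OF iI] w[OF i] by simp
      have 2: "V i j (y(i := a)) = \<phi> a (?\<delta> - w i j * y j)" for a
        unfolding U_def V_def using lin_comb_upd[OF iI] lin_comb_upd[OF j(1)] w[OF i] j(2) by simp
      show "(\<integral>a. (U i (y(i := a)) - V i j (y(i := a)))\<^sup>2 \<partial>\<mu>) \<le> L * (w i j)\<^sup>2 * (y j)\<^sup>2"
        unfolding 1 2 using lip[of ?\<delta> "?\<delta> - w i j * y j"] by (simp add: power_mult_distrib mult.assoc)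
    qed
    also have "\<dots> = L * (w i j)\<^sup>2 * variance_errors"
      using integral_coordinate(1)[OF j(1), of "\<lambda>u. u\<^sup>2"] by (simp add: variance_errors_def)
    finally show ?thesis .
  qed
  have U_int0: "(\<integral>a. U i (y(i := a)) \<partial>\<mu>) = 0" if "i \<in> J" for i y
    unfolding U_def using lin_comb_upd[of i] w[OF that] that J zero by (auto simp: subset_eq)
  have V_int0: "(\<integral>a. V i j (y(i := a)) \<partial>\<mu>) = 0" if "i \<in> J" "i \<noteq> j" for i j y
    using U_int0[OF that(1), of "y(j := 0)"] that(2) by (simp add: V_def fun_upd_twist)
  have V_upd: "V i j (y(j := a)) = V i j y" for i j y a by (simp add: V_def)
  have offdiag: "(\<integral>y. U i y * U j y \<partial>sample_law) \<le> L * variance_errors * ((w i j)\<^sup>2 + (w j i)\<^sup>2) / 2"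
    if i: "i \<in> J" and j: "j \<in> J" and ij: "i \<noteq> j" for i j
  proof -
    have I: "i \<in> I" "j \<in> I" using i j J by auto
    note m = U_meas[OF I(1)] U_meas[OF I(2)] V_meas[OF I] V_meas[OF I(2) I(1)]
    note ints = int_mult[OF m(1,2) U_b U_b] int_mult[OF m(3,2) V_b U_b]
      int_mult[OF m(4,1) V_b U_b] int_mult[OF m(4,3) V_b V_b]
    have z1: "(\<integral>y. V i j y * U j y \<partial>sample_law) = 0"
      by (rule integral_mult_resample_zero[OF I(2) ints(2) V_upd U_int0[OF j]])
    have z2: "(\<integral>y. V j i y * U i y \<partial>sample_law) = 0"
      by (rule integral_mult_resample_zero[OF I(1) ints(3) V_upd U_int0[OF i]])
    have z3: "(\<integral>y. V j i y * V i j y \<partial>sample_law) = 0"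
      by (rule integral_mult_resample_zero[OF I(1) ints(4) V_upd V_int0[OF i ij]])
    have mD: "(\<lambda>y. U i y - V i j y) \<in> borel_measurable sample_law"
      "(\<lambda>y. U j y - V j i y) \<in> borel_measurable sample_law" using m by measurable
    note intD = int_mult[OF mD(1) mD(1) bD bD, folded power2_eq_square]
      int_mult[OF mD(2) mD(2) bD bD, folded power2_eq_square] int_mult[OF mD bD bD]
    have "(\<integral>y. U i y * U j y \<partial>sample_law)
        = (\<integral>y. (U i y - V i j y) * (U j y - V j i y) + V i j y * U j y + V j i y * U i y
            - V j i y * V i j y \<partial>sample_law)"
      by (simp add: algebra_simps)
    also have "\<dots> = (\<integral>y. (U i y - V i j y) * (U j y - V j i y) \<partial>sample_law)"
      using ints intD z1 z2 z3 by simp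
    also have "\<dots> \<le> (\<integral>y. (U i y - V i j y)\<^sup>2 / 2 + (U j y - V j i y)\<^sup>2 / 2 \<partial>sample_law)"
    proof (rule integral_mono)
      fix y
      show "(U i y - V i j y) * (U j y - V j i y) \<le> (U i y - V i j y)\<^sup>2 / 2 + (U j y - V j i y)\<^sup>2 / 2"
        using sum_squares_bound[of "U i y - V i j y" "U j y - V j i y"]
        unfolding mult.assoc by linarith
    qed (use intD in auto)
    also have "\<dots> = (\<integral>y. (U i y - V i j y)\<^sup>2 \<partial>sample_law) / 2 + (\<integral>y. (U j y - V j i y)\<^sup>2 \<partial>sample_law) / 2"
      using intD by simp
    also have "\<dots> \<le> L * (w i j)\<^sup>2 * variance_errors / 2 + L * (w j i)\<^sup>2 * variance_errors / 2"
      using int_sq[OF i I(2) ij] int_sq[OF j I(1)] ij by (intro add_mono divide_right_mono) auto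
    finally show ?thesis by (simp add: algebra_simps)
  qed
  let ?E = "\<lambda>i. \<integral>y. (lin_comb (\<beta> i) (w i) y)\<^sup>2 \<partial>sample_law"
  have v0: "0 \<le> variance_errors" unfolding variance_errors_def by simp
  have diag: "(\<integral>y. U i y * U i y \<partial>sample_law) \<le> L * ?E i" if i: "i \<in> J" for i
  proof -
    have iI: "i \<in> I" using i J by auto
    note D = int_mult[OF U_meas[OF iI] U_meas[OF iI] U_b U_b]
    have "(\<integral>y. U i y * U i y \<partial>sample_law) = (\<integral>y. (\<integral>a. U i (y(i := a)) * U i (y(i := a)) \<partial>\<mu>) \<partial>sample_law)"
      by (rule integral_resample(1)[OF iI D])
    also have "\<dots> \<le> (\<integral>y. L * (lin_comb (\<beta> i) (w i) y)\<^sup>2 \<partial>sample_law)"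
    proof (rule integral_mono[OF integral_resample(2)[OF iI D]])
      show "integrable sample_law (\<lambda>y. L * (lin_comb (\<beta> i) (w i) y)\<^sup>2)"
        using second_moment_lin_comb(2) by simp
      fix y :: "'i \<Rightarrow> real"
      let ?\<delta> = "lin_comb (\<beta> i) (w i) y"
      have 1: "U i (y(i := a)) = \<phi> a ?\<delta>" for a
        unfolding U_def using lin_comb_upd[OF iI] w[OF i] by simp
      show "(\<integral>a. U i (y(i := a)) * U i (y(i := a)) \<partial>\<mu>) \<le> L * (lin_comb (\<beta> i) (w i) y)\<^sup>2"
        unfolding 1 using lip[of ?\<delta> 0] by (simp add: null power2_eq_square)
    qed
    finally show ?thesis by simp
  qed
  have pair: "(\<integral>y. U i y * U j y \<partial>sample_law)
      \<le> (if i = j then L * ?E i else 0) + L * variance_errors * ((w i j)\<^sup>2 + (w j i)\<^sup>2) / 2"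
    if "i \<in> J" "j \<in> J" for i j
    using offdiag[OF that] diag[OF that(1)] L0 v0 by (auto intro!: add_increasing2)
  have UU: "integrable sample_law (\<lambda>y. U i y * U j y)" if "i \<in> J" "j \<in> J" for i j
    by (rule int_mult[OF U_meas U_meas U_b U_b]) (use that J in auto)
  have "(\<integral>y. (\<Sum>i\<in>J. U i y)\<^sup>2 \<partial>sample_law) = (\<integral>y. (\<Sum>i\<in>J. \<Sum>j\<in>J. U i y * U j y) \<partial>sample_law)"
    by (simp add: power2_eq_square sum_product)
  also have "\<dots> = (\<Sum>i\<in>J. \<Sum>j\<in>J. \<integral>y. U i y * U j y \<partial>sample_law)"
    using UU by (simp add: Bochner_Integration.integral_sum)
  also have "\<dots> \<le> (\<Sum>i\<in>J. \<Sum>j\<in>J. (if i = j then L * ?E i else 0)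
      + L * variance_errors * ((w i j)\<^sup>2 + (w j i)\<^sup>2) / 2)"
    by (intro sum_mono pair)
  also have "\<dots> = L * (\<Sum>i\<in>J. ?E i) + L * variance_errors / 2 *
      ((\<Sum>i\<in>J. \<Sum>j\<in>J. (w i j)\<^sup>2) + (\<Sum>i\<in>J. \<Sum>j\<in>J. (w j i)\<^sup>2))"
    using fJ by (simp add: sum.distrib sum_distrib_left sum_divide_distrib algebra_simps add_divide_distrib)
  also have "(\<Sum>i\<in>J. \<Sum>j\<in>J. (w j i)\<^sup>2) = (\<Sum>i\<in>J. \<Sum>j\<in>J. (w i j)\<^sup>2)"
    by (rule sum.swap)
  also have "L * (\<Sum>i\<in>J. ?E i) + L * variance_errors / 2 *
      ((\<Sum>i\<in>J. \<Sum>j\<in>J. (w i j)\<^sup>2) + (\<Sum>i\<in>J. \<Sum>j\<in>J. (w i j)\<^sup>2))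
      = L * ((\<Sum>i\<in>J. ?E i) + (\<Sum>i\<in>J. (\<Sum>j\<in>J. (w i j)\<^sup>2) * variance_errors))"
  proof -
    have "(\<Sum>i\<in>J. (\<Sum>j\<in>J. (w i j)\<^sup>2) * variance_errors) = (\<Sum>i\<in>J. \<Sum>j\<in>J. (w i j)\<^sup>2) * variance_errors"
      by (rule sum_distrib_right[symmetric])
    then show ?thesis by (simp only:) (simp add: algebra_simps)
  qed
  also have "\<dots> \<le> L * ((\<Sum>i\<in>J. ?E i) + (\<Sum>i\<in>J. ?E i))"
  proof (intro mult_left_mono add_left_mono sum_mono L0)
    fix i assume "i \<in> J"
    have "(\<Sum>j\<in>J. (w i j)\<^sup>2) \<le> (\<Sum>j\<in>I. (w i j)\<^sup>2)"
      using J finite_index by (intro sum_mono2) auto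
    then show "(\<Sum>j\<in>J. (w i j)\<^sup>2) * variance_errors \<le> ?E i"
      unfolding second_moment_lin_comb using v0
      by (simp add: mult_right_mono add_increasing)
  qed
  finally show ?thesis by (simp add: U_def)
qed

end

section \<open>Exponential tails of local sums\<close>

lemma exp_le_quadratic:
  fixes u :: real
  assumes "\<bar>u\<bar> \<le> 1"
  shows "exp u \<le> 1 + u + u\<^sup>2"
proof (cases "u \<ge> 0")
  case True
  then show ?thesis using assms by (intro exp_bound) auto
next
  case False
  define y where "y = - u"
  have y: "0 \<le> y" "y \<le> 1" using False assms by (auto simp: y_def)
  have "exp u = 1 / exp y" by (simp add: y_def exp_minus inverse_eq_divide)
  also have "\<dots> \<le> 1 / (1 + y)"
    using y by (intro divide_left_mono exp_ge_add_one_self) auto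
  also have "\<dots> \<le> 1 - y + y\<^sup>2"
  proof -
    have "(1 - y + y\<^sup>2) * (1 + y) = 1 + y ^ 3"
      by (simp add: power2_eq_square power3_eq_cube algebra_simps)
    then show ?thesis using y by (simp add: pos_divide_le_eq)
  qed
  finally show ?thesis by (simp add: y_def)
qed

text \<open>
  For a threshold \<open>t * a\<close> and a variance \<open>s * a\<close> that scale with the same window size \<open>a\<close>, one
  choice of the exponential parameter serves all \<open>a\<close>; this is the resulting rate.
\<close>

definition tail_rate :: "real \<Rightarrow> real \<Rightarrow> real \<Rightarrow> real" where
  "tail_rate B s t = min (1 / B) (t / (2 * s)) * t / 2"

lemma tail_rate_pos: "0 < B \<Longrightarrow> 0 < s \<Longrightarrow> 0 < t \<Longrightarrow> 0 < tail_rate B s t"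
  by (simp add: tail_rate_def)

lemma exponent_le_tail_rate:
  assumes pos: "0 < B" "0 < s" "0 < t" "0 \<le> a"
  defines "lam \<equiv> min (1 / B) (t / (2 * s))"
  shows "0 < lam" "lam * B \<le> 1" "- lam * (t * a) + lam\<^sup>2 * (a * s) \<le> - tail_rate B s t * a"
proof -
  show lam: "0 < lam" using pos by (simp add: lam_def)
  have "lam * B \<le> 1 / B * B" unfolding lam_def using pos by (intro mult_right_mono) auto
  then show "lam * B \<le> 1" using pos by simp
  have "lam * s \<le> t / (2 * s) * s" unfolding lam_def using pos by (intro mult_right_mono) auto
  then have "lam * s \<le> t / 2" using pos by simp
  then have "(lam * a) * (lam * s) \<le> (lam * a) * (t / 2)" using lam pos by (intro mult_left_mono) auto
  then show "- lam * (t * a) + lam\<^sup>2 * (a * s) \<le> - tail_rate B s t * a"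
    unfolding tail_rate_def lam_def[symmetric] by (simp add: power2_eq_square algebra_simps)
qed

context iid_sample
begin

text \<open>
  Bernstein's inequality in Chernoff form. Using \<open>exp t \<le> 1 + t + t\<^sup>2\<close> on the uncentred variable
  keeps the second moment \<open>s\<close> in the exponent instead of the square of the bound \<open>B\<close>. For kernel
  averages \<open>s\<close> has the order \<open>b ^ d\<close> of the volume of the window while \<open>B\<close> is constant, and this
  gain is what makes windows with \<open>n * b ^ (d + 2)\<close> only slightly larger than \<open>ln n\<close> admissible.
\<close>

lemma exponential_tail_bound:
  fixes h :: "'b \<Rightarrow> real"
  assumes [measurable]: "h \<in> borel_measurable \<mu>"
    and hB: "\<And>u. u \<in> space \<mu> \<Longrightarrow> \<bar>h u\<bar> \<le> B" and s: "(\<integral>u. (h u)\<^sup>2 \<partial>\<mu>) \<le> s"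
    and lam: "0 < lam" "lam * B \<le> 1" and K: "K \<subseteq> I"
  shows "measure sample_law {y \<in> space sample_law. (\<Sum>k\<in>K. h (y k) - (\<integral>u. h u \<partial>\<mu>)) \<ge> t}
    \<le> exp (- lam * t + lam\<^sup>2 * card K * s)"
proof -
  let ?e = "\<integral>u. h u \<partial>\<mu>"
  have fK: "finite K" using K finite_index by (rule finite_subset)
  have int_h: "integrable \<mu> h"
    by (rule integrable_const_bound[where B=B]) (use hB in \<open>auto intro!: AE_I2\<close>)
  have int_h2: "integrable \<mu> (\<lambda>u. (h u)\<^sup>2)"
    by (rule integrable_const_bound[where B="B\<^sup>2"])
       (use hB in \<open>auto intro!: AE_I2 power2_le_iff_abs_le[THEN iffD2] intro: order_trans[OF abs_ge_zero]\<close>)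
  have int_exp: "integrable \<mu> (\<lambda>u. exp (lam * (h u - ?e)))"
  proof (rule integrable_const_bound[where B="exp (lam * (B - ?e))"])
    show "AE u in \<mu>. norm (exp (lam * (h u - ?e))) \<le> exp (lam * (B - ?e))"
      using hB lam by (auto intro!: AE_I2 simp: abs_le_iff)
  qed measurable
  have s0: "0 \<le> s" using order_trans[OF _ s] by simp
  have one: "(\<integral>u. exp (lam * (h u - ?e)) \<partial>\<mu>) \<le> exp (lam\<^sup>2 * s)"
  proof -
    have "(\<integral>u. exp (lam * (h u - ?e)) \<partial>\<mu>)
      \<le> (\<integral>u. exp (- lam * ?e) * (1 + lam * h u + lam\<^sup>2 * (h u)\<^sup>2) \<partial>\<mu>)"
    proof (rule integral_mono[OF int_exp])
      show "integrable \<mu> (\<lambda>u. exp (- lam * ?e) * (1 + lam * h u + lam\<^sup>2 * (h u)\<^sup>2))"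
        using int_h int_h2 by simp
      fix u assume u: "u \<in> space \<mu>"
      have "\<bar>lam * h u\<bar> \<le> lam * B"
        using lam hB[OF u] by (simp add: abs_mult mult_left_mono)
      then have "exp (lam * h u) \<le> 1 + lam * h u + (lam * h u)\<^sup>2"
        using lam by (intro exp_le_quadratic) auto
      then have "exp (- lam * ?e) * exp (lam * h u) \<le> exp (- lam * ?e) * (1 + lam * h u + (lam * h u)\<^sup>2)"
        by simp
      moreover have "exp (lam * (h u - ?e)) = exp (- lam * ?e) * exp (lam * h u)"
        by (simp add: exp_add[symmetric] right_diff_distrib)
      ultimately show "exp (lam * (h u - ?e)) \<le> exp (- lam * ?e) * (1 + lam * h u + lam\<^sup>2 * (h u)\<^sup>2)"
        by (simp only: power_mult_distrib)
    qed
    also have "\<dots> = exp (- lam * ?e) * (1 + lam * ?e + lam\<^sup>2 * (\<integral>u. (h u)\<^sup>2 \<partial>\<mu>))"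
      using int_h int_h2 by (simp add: prob_space)
    also have "\<dots> \<le> exp (- lam * ?e) * (1 + (lam * ?e + lam\<^sup>2 * s))"
      using s by (simp add: mult_left_mono)
    also have "\<dots> \<le> exp (- lam * ?e) * exp (lam * ?e + lam\<^sup>2 * s)"
      by (intro mult_left_mono exp_ge_add_one_self) auto
    also have "\<dots> = exp (lam\<^sup>2 * s)" by (simp add: exp_add[symmetric])
    finally show ?thesis .
  qed
  define F where "F k u = (if k \<in> K then exp (lam * (h u - ?e)) else 1)" for k u
  let ?S = "\<lambda>y. \<Sum>k\<in>K. h (y k) - ?e"
  have expS: "exp (lam * ?S y) = (\<Prod>k\<in>I. F k (y k))" for y
  proof -
    have "(\<Prod>k\<in>I. F k (y k)) = (\<Prod>k\<in>K. F k (y k))"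
      using K finite_index by (intro prod.mono_neutral_right) (auto simp: F_def)
    also have "\<dots> = (\<Prod>k\<in>K. exp (lam * (h (y k) - ?e)))" by (simp add: F_def)
    also have "\<dots> = exp (lam * ?S y)" by (simp add: exp_sum[OF fK] sum_distrib_left)
    finally show ?thesis ..
  qed
  have F_int: "integrable \<mu> (F k)" for k
    unfolding F_def[abs_def] using int_exp by (cases "k \<in> K") simp_all
  have iS: "integrable sample_law (\<lambda>y. exp (lam * ?S y))"
    unfolding expS by (rule prod.product_integrable_prod[OF finite_index F_int])
  have ES: "(\<integral>y. exp (lam * ?S y) \<partial>sample_law) \<le> exp (lam\<^sup>2 * card K * s)"
  proof -
    have "(\<integral>y. exp (lam * ?S y) \<partial>sample_law) = (\<Prod>k\<in>I. \<integral>u. F k u \<partial>\<mu>)"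
      unfolding expS by (rule prod.product_integral_prod[OF finite_index F_int])
    also have "\<dots> = (\<Prod>k\<in>K. \<integral>u. F k u \<partial>\<mu>)"
      using K finite_index by (intro prod.mono_neutral_right) (auto simp: F_def[abs_def] prob_space)
    also have "\<dots> = (\<Prod>k\<in>K. \<integral>u. exp (lam * (h u - ?e)) \<partial>\<mu>)" by (simp add: F_def)
    also have "\<dots> \<le> (\<Prod>k\<in>K. exp (lam\<^sup>2 * s))"
      by (intro prod_mono) (use one in auto)
    also have "\<dots> = exp (lam\<^sup>2 * card K * s)" by (simp add: exp_of_nat_mult[symmetric] mult_ac)
    finally show ?thesis .
  qed
  have "measure sample_law {y \<in> space sample_law. ?S y \<ge> t}
      = measure sample_law {y \<in> space sample_law. exp (lam * ?S y) \<ge> exp (lam * t)}"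
    using lam by simp
  also have "\<dots> \<le> (\<integral>y. exp (lam * ?S y) \<partial>sample_law) / exp (lam * t)"
    by (rule integral_Markov_inequality_measure[OF iS, where A="{}"]) auto
  also have "\<dots> \<le> exp (lam\<^sup>2 * card K * s) / exp (lam * t)"
    using ES by (intro divide_right_mono) auto
  also have "\<dots> = exp (- lam * t + lam\<^sup>2 * card K * s)"
    by (subst exp_add) (simp add: exp_minus divide_inverse mult.commute)
  finally show ?thesis .
qed

text \<open>
  A union bound over the sample points at which the sum is centred. The sum centred at \<open>y i\<close>
  omits the index \<open>i\<close>, so that after fixing \<open>y i\<close> it is a sum of i.i.d. variables.
\<close>

lemma uniform_local_sum_tail:
  fixes h :: "'b \<Rightarrow> 'b \<Rightarrow> real" and t m s lam B :: real
  assumes h: "case_prod h \<in> borel_measurable (\<mu> \<Otimes>\<^sub>M \<mu>)" and A: "A \<in> sets \<mu>"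
    and hB: "\<And>a u. a \<in> A \<Longrightarrow> u \<in> space \<mu> \<Longrightarrow> \<bar>h a u\<bar> \<le> B"
    and s: "\<And>a. a \<in> A \<Longrightarrow> (\<integral>u. (h a u)\<^sup>2 \<partial>\<mu>) \<le> s"
    and mean: "\<And>a. a \<in> A \<Longrightarrow> (\<integral>u. h a u \<partial>\<mu>) \<le> m"
    and lam: "0 < lam" "lam * B \<le> 1"
  shows "measure sample_law {y \<in> space sample_law.
      \<exists>i\<in>I. y i \<in> A \<and> (\<Sum>k\<in>I-{i}. h (y i) (y k)) \<ge> (real (card I) - 1) * m + t}
    \<le> card I * exp (- lam * t + lam\<^sup>2 * card I * s)"
    and "{y \<in> space sample_law.
      \<exists>i\<in>I. y i \<in> A \<and> (\<Sum>k\<in>I-{i}. h (y i) (y k)) \<ge> (real (card I) - 1) * m + t} \<in> sets sample_law"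
proof -
  define Q where "Q i = {y \<in> space sample_law. y i \<in> A \<and>
     (\<Sum>k\<in>I-{i}. h (y i) (y k)) \<ge> (real (card I) - 1) * m + t}" for i
  have h_meas: "(\<lambda>y. h (y i) (y k)) \<in> borel_measurable sample_law"
    if "i \<in> I" "k \<in> I" for i k
  proof -
    have "(\<lambda>y. (y i, y k)) \<in> measurable sample_law (\<mu> \<Otimes>\<^sub>M \<mu>)"
      using that by (intro measurable_Pair measurable_component_singleton)
    from measurable_compose[OF this h] show ?thesis by simp
  qed
  have Q_sets: "Q i \<in> sets sample_law" if i: "i \<in> I" for i
  proof -
    have 1: "(\<lambda>y. \<Sum>k\<in>I-{i}. h (y i) (y k)) \<in> borel_measurable sample_law"
      using i by (intro borel_measurable_sum h_meas) auto
    have 2: "{y \<in> space sample_law. y i \<in> A} \<in> sets sample_law"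
    proof -
      have "{u \<in> space \<mu>. u \<in> A} = A" using sets.sets_into_space[OF A] by auto
      then show ?thesis
        using measurable_sets_Collect[OF measurable_component_singleton[OF i], where P="\<lambda>u. u \<in> A"] A by simp
    qed
    have 3: "{y \<in> space sample_law. (\<Sum>k\<in>I-{i}. h (y i) (y k)) \<ge> (real (card I) - 1) * m + t} \<in> sets sample_law"
      using 1 by (intro borel_measurable_le) auto
    show ?thesis unfolding Q_def by (rule sets.sets_Collect_conj[OF 3 2])
  qed
  let ?q = "exp (- lam * t + lam\<^sup>2 * card I * s)"
  have Qi: "measure sample_law (Q i) \<le> ?q" if i: "i \<in> I" for i
  proof (rule prob_resample_le[OF i Q_sets[OF i]])
    fix a assume a: "a \<in> space \<mu>"
    let ?W = "{y \<in> space sample_law. y(i := a) \<in> Q i}"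
    show "measure sample_law ?W \<le> ?q"
    proof (cases "a \<in> A")
      case False
      then have W: "?W = {}" by (auto simp: Q_def)
      show ?thesis unfolding W by simp
    next
      case True
      have [measurable]: "h a \<in> borel_measurable \<mu>" using measurable_compose[OF measurable_Pair1'[OF a] h] by simp
      let ?T = "{y \<in> space sample_law. (\<Sum>k\<in>I-{i}. h a (y k) - (\<integral>u. h a u \<partial>\<mu>)) \<ge> t}"
      have c: "real (card (I - {i})) = real (card I) - 1"
      proof -
        have "card I = Suc (card (I - {i}))" using i finite_index by (metis card_Suc_Diff1)
        then show ?thesis by linarith
      qed
      have c0: "0 \<le> real (card I) - 1" using c by (metis of_nat_0_le_iff)
      have "?W \<subseteq> ?T"
      proof clarify
        fix y assume y: "y \<in> space sample_law" "y(i := a) \<in> Q i"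
        have "(\<Sum>k\<in>I-{i}. h ((y(i := a)) i) ((y(i := a)) k)) = (\<Sum>k\<in>I-{i}. h a (y k))"
          by (intro sum.cong) auto
        then have "(real (card I) - 1) * m + t \<le> (\<Sum>k\<in>I-{i}. h a (y k))"
          using y(2) by (simp add: Q_def)
        moreover have "(real (card I) - 1) * (\<integral>u. h a u \<partial>\<mu>) \<le> (real (card I) - 1) * m"
          using mean[OF True] c0 by (intro mult_left_mono)
        ultimately show "t \<le> (\<Sum>k\<in>I-{i}. h a (y k) - (\<integral>u. h a u \<partial>\<mu>))"
          by (simp add: sum_subtractf c del: card_Diff_insert card_Diff_singleton)
      qed
      moreover have "?T \<in> sets sample_law" by measurable
      ultimately have "measure sample_law ?W \<le> measure sample_law ?T"
        by (intro sample.finite_measure_mono)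
      also have "\<dots> \<le> exp (- lam * t + lam\<^sup>2 * card (I - {i}) * s)"
        by (rule exponential_tail_bound[OF _ hB[OF True] s[OF True] lam]) auto
      also have "\<dots> \<le> ?q"
      proof -
        have "0 \<le> s" using order_trans[OF _ s[OF True]] by simp
        moreover have "card (I - {i}) \<le> card I" using finite_index by (intro card_mono) auto
        ultimately show ?thesis by (auto intro!: mult_right_mono mult_left_mono)
      qed
      finally show ?thesis .
    qed
  qed
  have U: "{y \<in> space sample_law. \<exists>i\<in>I. y i \<in> A \<and>
      (\<Sum>k\<in>I-{i}. h (y i) (y k)) \<ge> (real (card I) - 1) * m + t} = (\<Union>i\<in>I. Q i)"
    by (auto simp: Q_def)
  show "{y \<in> space sample_law. \<exists>i\<in>I. y i \<in> A \<and>
      (\<Sum>k\<in>I-{i}. h (y i) (y k)) \<ge> (real (card I) - 1) * m + t} \<in> sets sample_law"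
    unfolding U using Q_sets finite_index by (intro sets.finite_UN) auto
  have "measure sample_law (\<Union>i\<in>I. Q i) \<le> (\<Sum>i\<in>I. measure sample_law (Q i))"
    using Q_sets finite_index by (intro sample.finite_measure_subadditive_finite) auto
  also have "\<dots> \<le> (\<Sum>i\<in>I. ?q)" by (intro sum_mono Qi)
  finally show "measure sample_law {y \<in> space sample_law.
      \<exists>i\<in>I. y i \<in> A \<and> (\<Sum>k\<in>I-{i}. h (y i) (y k)) \<ge> (real (card I) - 1) * m + t}
    \<le> card I * exp (- lam * t + lam\<^sup>2 * card I * s)"
    unfolding U by simp
qed

lemma uniform_local_sum_tail_rate:
  fixes h :: "'b \<Rightarrow> 'b \<Rightarrow> real" and t m s a B :: real
  assumes h: "case_prod h \<in> borel_measurable (\<mu> \<Otimes>\<^sub>M \<mu>)" and A: "A \<in> sets \<mu>"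
    and hB: "\<And>a u. a \<in> A \<Longrightarrow> u \<in> space \<mu> \<Longrightarrow> \<bar>h a u\<bar> \<le> B"
    and s: "\<And>z. z \<in> A \<Longrightarrow> (\<integral>u. (h z u)\<^sup>2 \<partial>\<mu>) \<le> s * a"
    and mean: "\<And>a. a \<in> A \<Longrightarrow> (\<integral>u. h a u \<partial>\<mu>) \<le> m"
    and pos: "0 < B" "0 < s" "0 < t" "0 \<le> a"
  defines "E \<equiv> {y \<in> space sample_law. \<exists>i\<in>I. y i \<in> A \<and>
      (\<Sum>k\<in>I-{i}. h (y i) (y k)) \<ge> (real (card I) - 1) * m + t * (card I * a)}"
  shows "E \<in> sets sample_law" "measure sample_law E \<le> card I * exp (- tail_rate B s t * (card I * a))"
proof -
  let ?lam = "min (1 / B) (t / (2 * s))"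
  have a: "0 \<le> card I * a" using pos by simp
  note lam = exponent_le_tail_rate[OF pos(1,2,3) a]
  note * = uniform_local_sum_tail[OF h A hB s mean lam(1,2), of "t * (card I * a)"]
  show "E \<in> sets sample_law" unfolding E_def using *(2) by simp
  have "measure sample_law E \<le> card I * exp (- ?lam * (t * (card I * a)) + ?lam\<^sup>2 * card I * (s * a))"
    unfolding E_def using *(1) by simp
  also have "\<dots> \<le> card I * exp (- tail_rate B s t * (card I * a))"
    using lam(3) by (intro mult_left_mono) (auto simp: mult_ac)
  finally show "measure sample_law E \<le> card I * exp (- tail_rate B s t * (card I * a))" .
qed

end

section \<open>Increments of twice differentiable functions\<close>

text \<open>
  Keeps the coordinates of \<open>h\<close> in \<open>A\<close> and sets the others to 0. Switching the coordinates on one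
  at a time leads from \<open>x\<close> to \<open>x + h\<close> along the axes without leaving the ball of radius \<open>norm h\<close>.
\<close>

definition coords :: "'d set \<Rightarrow> real^'d \<Rightarrow> real^'d" where
  "coords A h = (\<chi> i. if i \<in> A then h $ i else 0)"

lemma coords_empty [simp]: "coords {} h = 0"
  by (simp add: coords_def vec_eq_iff)

lemma coords_UNIV [simp]: "coords UNIV h = h"
  by (simp add: coords_def vec_eq_iff)

lemma coords_insert: "i \<notin> A \<Longrightarrow> coords (insert i A) h = coords A h + (h $ i) *\<^sub>R axis i 1"
  by (auto simp: coords_def vec_eq_iff axis_def)

lemma norm_coords_axis_le:
  assumes "i \<notin> A" "\<bar>s\<bar> \<le> \<bar>h $ i\<bar>"
  shows "norm (coords A h + s *\<^sub>R axis i 1) \<le> norm h"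
proof (rule norm_le_componentwise_cart)
  fix j
  show "norm ((coords A h + s *\<^sub>R axis i 1) $ j) \<le> norm (h $ j)"
    using assms by (auto simp: coords_def axis_def)
qed

text \<open>
  The mean value theorem is applied along each axis in turn, so that only partial derivatives
  are needed. With \<open>a = 0\<close> this is a Lipschitz bound; with \<open>a i\<close> the partial derivatives at \<open>x\<close> it
  is a first-order Taylor bound.
\<close>

lemma axis_increment_bound:
  fixes u :: "real^'d \<Rightarrow> real"
  assumes der: "\<And>z i. norm (z - x) \<le> norm h \<Longrightarrow>
      ((\<lambda>t. u (z + t *\<^sub>R axis i 1)) has_real_derivative D i z) (at 0)"
    and bnd: "\<And>z i. norm (z - x) \<le> norm h \<Longrightarrow> \<bar>D i z - a i\<bar> \<le> B"
  shows "\<bar>u (x + h) - u x - (\<Sum>i\<in>UNIV. a i * h $ i)\<bar> \<le> B * (\<Sum>i\<in>UNIV. \<bar>h $ i\<bar>)"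
proof -
  have "\<bar>u (x + coords A h) - u x - (\<Sum>i\<in>A. a i * h $ i)\<bar> \<le> B * (\<Sum>i\<in>A. \<bar>h $ i\<bar>)" for A :: "'d set"
  proof (induction A rule: finite_induct[OF finite])
    case 1
    then show ?case by simp
  next
    case (2 i A)
    define v where "v s = u (x + coords A h + (s * h $ i) *\<^sub>R axis i 1) - s * (a i * h $ i)" for s
    have near: "norm (x + coords A h + (s * h $ i) *\<^sub>R axis i 1 - x) \<le> norm h" if "0 \<le> s" "s \<le> 1" for s
      using norm_coords_axis_le[of i A "s * h $ i" h] 2(2) that
      by (simp add: abs_mult mult_left_le_one_le add.assoc)
    have dv: "(v has_real_derivative (D i (x + coords A h + (s * h $ i) *\<^sub>R axis i 1) - a i) * h $ i) (at s)"
      if "0 \<le> s" "s \<le> 1" for s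
    proof -
      let ?z = "x + coords A h + (s * h $ i) *\<^sub>R axis i 1"
      have "((\<lambda>t. u (?z + t *\<^sub>R axis i 1)) has_real_derivative D i ?z) (at ((s - s) * h $ i))"
        using der[OF near[OF that], of i] by simp
      then have "((\<lambda>r. u (?z + ((r - s) * h $ i) *\<^sub>R axis i 1)) has_real_derivative D i ?z * h $ i) (at s)"
        by (rule DERIV_chain2[where g="\<lambda>r. (r - s) * h $ i"]) (auto intro!: derivative_eq_intros)
      moreover have "?z + ((r - s) * h $ i) *\<^sub>R axis i 1 = x + coords A h + (r * h $ i) *\<^sub>R axis i 1" for r
        by (simp add: algebra_simps)
      ultimately have "((\<lambda>r. u (x + coords A h + (r * h $ i) *\<^sub>R axis i 1)) has_real_derivative D i ?z * h $ i) (at s)"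
        by simp
      then show ?thesis unfolding v_def
        by (auto intro!: derivative_eq_intros simp: algebra_simps)
    qed
    obtain s where s: "0 < s" "s < 1"
      "v 1 - v 0 = (1 - 0) * ((D i (x + coords A h + (s * h $ i) *\<^sub>R axis i 1) - a i) * h $ i)"
      using MVT2[of 0 1 v "\<lambda>s. (D i (x + coords A h + (s * h $ i) *\<^sub>R axis i 1) - a i) * h $ i"] dv by auto
    have "\<bar>v 1 - v 0\<bar> \<le> B * \<bar>h $ i\<bar>"
      unfolding s(3) using bnd[OF near, of s i] s by (simp add: abs_mult mult_right_mono)
    moreover have "v 1 - v 0 = u (x + coords (insert i A) h) - u (x + coords A h) - a i * h $ i"
      using coords_insert[OF 2(2), of h] by (simp add: v_def add.assoc)
    ultimately show ?case using 2 by (simp add: distrib_left)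
  qed
  from this[of UNIV] show ?thesis by simp
qed

lemma sum_abs_components_le: "(\<Sum>i\<in>UNIV. \<bar>h $ i\<bar>) \<le> real CARD('d) * norm (h :: real^'d)"
  using sum_mono[of UNIV "\<lambda>i. \<bar>h $ i\<bar>" "\<lambda>_. norm h"] component_le_norm_cart[of h] by simp

text \<open>
  In the second difference the first-order Taylor terms at \<open>h\<close> and \<open>- h\<close> cancel; this is what
  makes the bias of a symmetric kernel of second order in the bandwidth.
\<close>

lemma C2_over_increments:
  fixes u :: "real^'d \<Rightarrow> real"
  assumes C2: "C2_over S u" and S: "compact S"
  obtains L where "0 \<le> L"
    "\<And>x h. cball x (norm h) \<subseteq> interior S \<Longrightarrow> \<bar>u (x + h) - u x\<bar> \<le> L * norm h"
    "\<And>x h. cball x (norm h) \<subseteq> interior S \<Longrightarrow> \<bar>u (x + h) + u (x - h) - 2 * u x\<bar> \<le> L * (norm h)\<^sup>2"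
proof -
  obtain D1 D2 where c: "\<And>i. continuous_on S (D1 i)" "\<And>i j. continuous_on S (D2 i j)"
    and d1: "\<And>x i. x \<in> interior S \<Longrightarrow> ((\<lambda>t. u (x + t *\<^sub>R axis i 1)) has_real_derivative D1 i x) (at 0)"
    and d2: "\<And>x i j. x \<in> interior S \<Longrightarrow> ((\<lambda>t. D1 i (x + t *\<^sub>R axis j 1)) has_real_derivative D2 i j x) (at 0)"
    using C2 unfolding C2_over_def by metis
  have "\<exists>B. \<forall>x\<in>S. \<bar>D1 i x\<bar> \<le> B" for i
    using compact_imp_bounded[OF compact_continuous_image[OF c(1) S]] by (auto simp: bounded_iff)
  then obtain B1' where B1': "\<And>i x. x \<in> S \<Longrightarrow> \<bar>D1 i x\<bar> \<le> B1' i" by metis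
  have "\<exists>B. \<forall>x\<in>S. \<bar>D2 i j x\<bar> \<le> B" for i j
    using compact_imp_bounded[OF compact_continuous_image[OF c(2) S]] by (auto simp: bounded_iff)
  then obtain B2' where B2': "\<And>i j x. x \<in> S \<Longrightarrow> \<bar>D2 i j x\<bar> \<le> B2' i j" by metis
  define B1 where "B1 = (\<Sum>i\<in>UNIV. \<bar>B1' i\<bar>)"
  define B2 where "B2 = (\<Sum>i\<in>UNIV. \<Sum>j\<in>UNIV. \<bar>B2' i j\<bar>)"
  have B1: "\<bar>D1 i x\<bar> \<le> B1" if "x \<in> S" for i x
    using B1'[OF that, of i] member_le_sum[of i UNIV "\<lambda>i. \<bar>B1' i\<bar>"] by (simp add: B1_def)
  have B2: "\<bar>D2 i j x\<bar> \<le> B2" if "x \<in> S" for i j x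
    using B2'[OF that, of i j] member_le_sum[of j UNIV "\<lambda>j. \<bar>B2' i j\<bar>"]
      member_le_sum[of i UNIV "\<lambda>i. \<Sum>j\<in>UNIV. \<bar>B2' i j\<bar>"] by (simp add: B2_def sum_nonneg)
  have B0: "0 \<le> B1" "0 \<le> B2" by (simp_all add: B1_def B2_def sum_nonneg)
  define d where "d = real CARD('d)"
  define L where "L = B1 * d + 2 * (B2 * d * d)"
  have d0: "0 \<le> d" by (simp add: d_def)
  have mem: "z \<in> interior S" if "cball x (norm h) \<subseteq> interior S" "norm (z - x) \<le> norm h" for x z h
    using that by (auto simp: dist_norm norm_minus_commute subset_eq)
  have memS: "z \<in> S" if "z \<in> interior S" for z using that interior_subset by auto
  have lip: "\<bar>u (x + h) - u x\<bar> \<le> B1 * d * norm h" if x: "cball x (norm h) \<subseteq> interior S" for x h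
  proof -
    have "\<bar>u (x + h) - u x - (\<Sum>i\<in>UNIV. 0 * h $ i)\<bar> \<le> B1 * (\<Sum>i\<in>UNIV. \<bar>h $ i\<bar>)"
      by (rule axis_increment_bound[where D=D1]) (use mem[OF x] memS d1 B1 in auto)
    also have "\<dots> \<le> B1 * (d * norm h)"
      unfolding d_def by (intro mult_left_mono sum_abs_components_le B0)
    finally show ?thesis by (simp add: mult.assoc)
  qed
  have lip1: "\<bar>D1 i z - D1 i x\<bar> \<le> B2 * d * norm h"
    if x: "cball x (norm h) \<subseteq> interior S" and z: "norm (z - x) \<le> norm h" for x z h i
  proof -
    have x': "cball x (norm (z - x)) \<subseteq> interior S" using x z by (auto simp: subset_eq)
    have "\<bar>D1 i (x + (z - x)) - D1 i x - (\<Sum>j\<in>UNIV. 0 * (z - x) $ j)\<bar> \<le> B2 * (\<Sum>j\<in>UNIV. \<bar>(z - x) $ j\<bar>)"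
      by (rule axis_increment_bound[where D="D2 i"]) (use mem[OF x'] memS d2 B2 in auto)
    also have "\<dots> \<le> B2 * (d * norm (z - x))"
      unfolding d_def by (intro mult_left_mono sum_abs_components_le B0)
    also have "\<dots> \<le> B2 * (d * norm h)"
      using z by (intro mult_left_mono B0 d0)
    finally show ?thesis by (simp add: mult.assoc)
  qed
  have tay: "\<bar>u (x + h) - u x - (\<Sum>i\<in>UNIV. D1 i x * h $ i)\<bar> \<le> B2 * d * d * (norm h)\<^sup>2"
    if x: "cball x (norm h) \<subseteq> interior S" for x h
  proof -
    have "\<bar>u (x + h) - u x - (\<Sum>i\<in>UNIV. D1 i x * h $ i)\<bar> \<le> B2 * d * norm h * (\<Sum>i\<in>UNIV. \<bar>h $ i\<bar>)"
      by (rule axis_increment_bound[where D=D1]) (use mem[OF x] d1 lip1[OF x] in auto)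
    also have "\<dots> \<le> B2 * d * norm h * (d * norm h)"
      unfolding d_def by (intro mult_left_mono sum_abs_components_le mult_nonneg_nonneg B0) auto
    finally show ?thesis by (simp add: power2_eq_square mult_ac)
  qed
  show ?thesis
  proof
    show "0 \<le> L" using B0 d0 by (simp add: L_def)
    fix x h :: "real^'d" assume x: "cball x (norm h) \<subseteq> interior S"
    have "B1 * d * norm h \<le> L * norm h"
      using B0 d0 by (intro mult_right_mono) (auto simp: L_def)
    then show "\<bar>u (x + h) - u x\<bar> \<le> L * norm h" using lip[OF x] by linarith
    have "\<bar>u (x + - h) - u x - (\<Sum>i\<in>UNIV. D1 i x * (- h) $ i)\<bar> \<le> B2 * d * d * (norm (- h))\<^sup>2"
      by (rule tay) (use x in simp)
    then have "\<bar>u (x + h) + u (x - h) - 2 * u x\<bar> \<le> 2 * (B2 * d * d) * (norm h)\<^sup>2"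
      using tay[OF x] by (simp add: sum_negf abs_if split: if_splits)
    also have "\<dots> \<le> L * (norm h)\<^sup>2"
      using B0 d0 by (intro mult_right_mono) (auto simp: L_def)
    finally show "\<bar>u (x + h) + u (x - h) - 2 * u x\<bar> \<le> L * (norm h)\<^sup>2" .
  qed
qed

lemma lborel_integral_affine:
  fixes F :: "real^'d \<Rightarrow> real"
  assumes b: "b > 0" and [measurable]: "F \<in> borel_measurable borel"
  shows "(LINT u|lborel. F u) = b ^ CARD('d) * (LINT z|lborel. F (x + b *\<^sub>R z))"
proof -
  have "(LINT u|lborel. F u) = (LINT u|density (distr lborel borel (\<lambda>z. x + b *\<^sub>R z)) (\<lambda>_. ennreal (\<bar>b\<bar> ^ DIM(real^'d))). F u)"
    by (subst lborel_affine[of b x]) (use b in \<open>simp_all add: ennreal_power\<close>)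
  also have "\<dots> = (LINT u|distr lborel borel (\<lambda>z. x + b *\<^sub>R z). \<bar>b\<bar> ^ DIM(real^'d) *\<^sub>R F u)"
    by (rule integral_density) auto
  also have "\<dots> = (LINT z|lborel. \<bar>b\<bar> ^ DIM(real^'d) *\<^sub>R F (x + b *\<^sub>R z))"
    by (rule integral_distr) auto
  finally show ?thesis using b by simp
qed

lemma lborel_integral_reflect:
  fixes F :: "real^'d \<Rightarrow> real"
  assumes [measurable]: "F \<in> borel_measurable borel"
  shows "(LINT u|lborel. F (- u)) = (LINT u|lborel. F u)"
proof -
  have "(LINT u|lborel. F u) = (LINT u|density (distr lborel borel (\<lambda>z. 0 + (-1) *\<^sub>R z)) (\<lambda>_. ennreal (\<bar>-1\<bar> ^ DIM(real^'d))). F u)"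
    by (subst lborel_affine[of "-1" "0::real^'d"]) simp_all
  also have "\<dots> = (LINT z|lborel. F (- z))"
    by (simp add: density_1 integral_distr)
  finally show ?thesis by simp
qed

section \<open>Smoothing the error density\<close>

lemma integrable_bounded_support:
  fixes G :: "real \<Rightarrow> real"
  assumes [measurable]: "G \<in> borel_measurable borel"
    and bnd: "\<And>v. \<bar>G v\<bar> \<le> C" and supp: "\<And>v. v \<notin> {l..r} \<Longrightarrow> G v = 0" and lr: "l \<le> r"
  shows "integrable lborel G" and "\<bar>LINT v|lborel. G v\<bar> \<le> C * (r - l)"
proof -
  have C0: "0 \<le> C" using bnd[of 0] by linarith
  have iI: "integrable lborel (\<lambda>v. C * indicator {l..r} v)"
    by (intro integrable_mult_right) (simp add: lr)
  have le: "\<bar>G v\<bar> \<le> C * indicator {l..r} v" for v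
    using bnd[of v] supp[of v] C0 by (auto simp: indicator_def)
  show *: "integrable lborel G"
  proof (rule Bochner_Integration.integrable_bound[OF iI _ AE_I2])
    show "norm (G v) \<le> norm (C * indicator {l..r} v :: real)" for v
      using le[of v] C0 by (simp only: real_norm_def abs_mult abs_of_nonneg abs_indicator)
  qed measurable
  have "\<bar>LINT v|lborel. G v\<bar> \<le> (LINT v|lborel. \<bar>G v\<bar>)" by (rule integral_abs_bound)
  also have "\<dots> \<le> (LINT v|lborel. C * indicator {l..r} v)"
    by (rule integral_mono) (use * iI le in auto)
  also have "\<dots> = C * (r - l)" using lr by simp
  finally show "\<bar>LINT v|lborel. G v\<bar> \<le> C * (r - l)" .
qed

text \<open>
  The Cauchy-Schwarz inequality against the indicator of the support, obtained from the
  nonnegativity of \<open>\<integral> (G - t * indicator S)\<^sup>2\<close> as a quadratic in \<open>t\<close>.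
\<close>

lemma square_integral_le_of_support:
  fixes G :: "'a \<Rightarrow> real"
  assumes G: "integrable M G" and G2: "integrable M (\<lambda>x. (G x)\<^sup>2)"
    and S: "S \<in> sets M" "emeasure M S < \<infinity>" and supp: "\<And>x. x \<notin> S \<Longrightarrow> G x = 0"
  shows "(\<integral>x. G x \<partial>M)\<^sup>2 \<le> measure M S * (\<integral>x. (G x)\<^sup>2 \<partial>M)"
proof -
  let ?I = "\<integral>x. G x \<partial>M" and ?J = "\<integral>x. (G x)\<^sup>2 \<partial>M" and ?s = "measure M S"
  have iS: "integrable M (indicator S :: 'a \<Rightarrow> real)" using S by simp
  have key: "0 \<le> ?J - 2 * t * ?I + t\<^sup>2 * ?s" for t
  proof -
    have e: "(G x - t * indicator S x)\<^sup>2 = (G x)\<^sup>2 - 2 * t * G x + t\<^sup>2 * indicator S x" for x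
      using supp[of x] by (cases "x \<in> S") (auto simp: power2_eq_square algebra_simps)
    have "0 \<le> (\<integral>x. (G x - t * indicator S x)\<^sup>2 \<partial>M)" by simp
    also have "\<dots> = ?J - 2 * t * ?I + t\<^sup>2 * ?s"
      unfolding e using G G2 iS sets.sets_into_space[OF S(1)] by (simp add: Int_absorb2)
    finally show ?thesis .
  qed
  show ?thesis
  proof (cases "?s = 0")
    case True
    have "?I = 0"
    proof (rule ccontr)
      assume "?I \<noteq> 0"
      then show False using key[of "(?J + 1) / (2 * ?I)"] True by (simp add: field_simps)
    qed
    then show ?thesis using True by simp
  next
    case False
    then have s: "0 < ?s" by (simp add: zero_less_measure_iff)
    have "0 \<le> ?J - ?I\<^sup>2 / ?s" using key[of "?I / ?s"] s by (simp add: power2_eq_square field_simps)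
    then show ?thesis using s by (simp add: field_simps)
  qed
qed

lemma taylor2_bound:
  fixes f f' f'' :: "real \<Rightarrow> real"
  assumes "\<And>x. (f has_real_derivative f' x) (at x)" "\<And>x. (f' has_real_derivative f'' x) (at x)"
    and "\<And>x. \<bar>f'' x\<bar> \<le> C"
  shows "\<bar>f (x + t) - f x - t * f' x\<bar> \<le> C * t\<^sup>2"
proof -
  have lip: "\<bar>f' z - f' x\<bar> \<le> C * \<bar>z - x\<bar>" for z
    using field_differentiable_bound[of UNIV f' f'' C z x] assms(2,3) by simp
  define v where "v s = f (x + s * t) - s * t * f' x" for s
  have dv: "(v has_real_derivative (f' (x + s * t) - f' x) * t) (at s)" for s
  proof -
    have "((\<lambda>s. f (x + s * t)) has_real_derivative f' (x + s * t) * t) (at s)"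
      by (rule DERIV_chain2[OF assms(1), where g="\<lambda>s. x + s * t"]) (auto intro!: derivative_eq_intros)
    then show ?thesis unfolding v_def
      by (auto intro!: derivative_eq_intros simp: algebra_simps)
  qed
  obtain s where s: "0 < s" "s < 1" "v 1 - v 0 = (1 - 0) * ((f' (x + s * t) - f' x) * t)"
    using MVT2[of 0 1 v "\<lambda>s. (f' (x + s * t) - f' x) * t"] dv by auto
  have C0: "0 \<le> C" using assms(3)[of 0] by linarith
  have "\<bar>v 1 - v 0\<bar> \<le> C * \<bar>s * t\<bar> * \<bar>t\<bar>"
    using lip[of "x + s * t"] by (simp add: s(3) abs_mult mult_right_mono)
  also have "\<dots> = s * (C * t\<^sup>2)" using s by (simp add: abs_mult power2_eq_square)
  also have "\<dots> \<le> C * t\<^sup>2" using s C0 by (intro mult_left_le_one_le) auto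
  finally show ?thesis by (simp add: v_def algebra_simps)
qed

text \<open>
  A density \<open>f\<close> with bounded first and second derivatives, and a Lipschitz kernel \<open>K\<close> of order two
  supported in \<open>[- A, A]\<close>.
\<close>

locale kernel_smoothing =
  fixes f f' f'' K :: "real \<Rightarrow> real" and A B L F F1 F2 :: real
  assumes f_nonneg: "0 \<le> f u" and f_le: "f u \<le> F"
    and f_deriv: "(f has_real_derivative f' u) (at u)" and f'_le: "\<bar>f' u\<bar> \<le> F1"
    and f'_deriv: "(f' has_real_derivative f'' u) (at u)" and f''_le: "\<bar>f'' u\<bar> \<le> F2"
    and f_prob: "prob_space (density lborel (\<lambda>u. ennreal (f u)))"
    and K_support: "A < \<bar>v\<bar> \<Longrightarrow> K v = 0" and K_le: "\<bar>K v\<bar> \<le> B" and K_lip: "\<bar>K v - K v'\<bar> \<le> L * \<bar>v - v'\<bar>"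
    and K_mass: "(LINT v|lborel. K v) = 1" and K_mean: "(LINT v|lborel. v * K v) = 0"
    and pos: "0 < A" "0 < L" "0 < F2"
begin

abbreviation error_law :: "real measure" where
  "error_law \<equiv> density lborel (\<lambda>u. ennreal (f u))"

sublocale error: prob_space error_law by (rule f_prob)

lemma continuous_f: "continuous_on UNIV f" and continuous_f': "continuous_on UNIV f'"
  using DERIV_continuous_on[of UNIV f f'] DERIV_continuous_on[of UNIV f' f''] f_deriv f'_deriv
  by simp_all

lemma f_measurable [measurable]: "f \<in> borel_measurable borel"
  and f'_measurable [measurable]: "f' \<in> borel_measurable borel"
  using continuous_f continuous_f' by (auto intro: borel_measurable_continuous_onI)

lemma continuous_K: "continuous_on UNIV K"
proof -
  have "L-lipschitz_on UNIV K"
    using K_lip pos by (intro lipschitz_onI) (auto simp: dist_real_def)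
  then show ?thesis by (rule lipschitz_on_continuous_on)
qed

lemma K_measurable [measurable]: "K \<in> borel_measurable borel"
  using continuous_K by (rule borel_measurable_continuous_onI)

lemma constants_nonneg: "0 \<le> B" "0 \<le> F" "0 \<le> F1"
  using K_le[of 0] f_le[of 0] f_nonneg[of 0] f'_le[of 0] by linarith+

lemma integral_error_law:
  "h \<in> borel_measurable borel \<Longrightarrow> (\<integral>u. h u \<partial>error_law) = (LINT u|lborel. f u * h u)" for h :: "real \<Rightarrow> real"
  by (subst integral_real_density) (auto simp: f_nonneg)

lemma integrable_K_mult:
  assumes [measurable]: "h \<in> borel_measurable borel" and h: "\<And>v. \<bar>v\<bar> \<le> A \<Longrightarrow> \<bar>h v\<bar> \<le> C"
  shows "integrable lborel (\<lambda>v. K v * h v)" "\<bar>LINT v|lborel. K v * h v\<bar> \<le> 2 * A * B * C"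
proof -
  have C0: "0 \<le> C" using h[of 0] pos by auto
  have b: "\<bar>K v * h v\<bar> \<le> B * C" for v
    using K_support[of v] K_le[of v] h[of v] constants_nonneg C0
    by (cases "\<bar>v\<bar> \<le> A") (auto simp: abs_mult intro!: mult_mono)
  have s: "K v * h v = 0" if "v \<notin> {-A..A}" for v
    using that K_support[of v] by auto
  show "integrable lborel (\<lambda>v. K v * h v)" "\<bar>LINT v|lborel. K v * h v\<bar> \<le> 2 * A * B * C"
    using integrable_bounded_support[of "\<lambda>v. K v * h v" "B * C" "-A" A, OF _ b s] pos by (auto simp: mult_ac)
qed

lemma expectation_rescaled_kernel:
  fixes h :: "real \<Rightarrow> real"
  assumes b: "0 < b" and [measurable]: "h \<in> borel_measurable borel"
  shows "(\<integral>u. h ((u - x) / b) \<partial>error_law) = b * (LINT v|lborel. h v * f (x + b * v))"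
proof -
  have "(\<integral>u. h ((u - x) / b) \<partial>error_law) = (LINT u|lborel. f u * h ((u - x) / b))"
    by (rule integral_error_law) measurable
  also have "\<dots> = \<bar>b\<bar> *\<^sub>R (LINT v|lborel. f (x + b * v) * h ((x + b * v - x) / b))"
    using b by (intro lborel_integral_real_affine) auto
  finally show ?thesis using b by (simp add: mult.commute)
qed

text \<open>
  The Lipschitz bound alone would give \<open>((\<delta> - \<delta>') / b)\<^sup>2\<close>; a power of \<open>b\<close> is gained because the
  increment vanishes outside two intervals of length \<open>2 * A * b\<close>.
\<close>

lemma kernel_shift_second_moment:
  assumes b: "0 < b"
  shows "(\<integral>u. (K ((u - \<delta> - x) / b) - K ((u - \<delta>' - x) / b))\<^sup>2 \<partial>error_law)
    \<le> 4 * A * F * L\<^sup>2 / b * (\<delta> - \<delta>')\<^sup>2"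
proof -
  define S where "S \<delta> = {x + \<delta> - A * b .. x + \<delta> + A * b}" for \<delta>
  have K0: "K ((u - \<delta> - x) / b) = 0" if "u \<notin> S \<delta>" for u \<delta>
  proof (rule K_support)
    have "A * b < \<bar>u - \<delta> - x\<bar>" using that by (auto simp: S_def)
    then show "A < \<bar>(u - \<delta> - x) / b\<bar>" using b by (simp add: abs_divide pos_less_divide_eq)
  qed
  let ?c = "(L * ((\<delta> - \<delta>') / b))\<^sup>2"
  have le: "(K ((u - \<delta> - x) / b) - K ((u - \<delta>' - x) / b))\<^sup>2 \<le> ?c * (indicator (S \<delta>) u + indicator (S \<delta>') u)" for u
  proof -
    have "\<bar>K ((u - \<delta> - x) / b) - K ((u - \<delta>' - x) / b)\<bar> \<le> L * \<bar>(u - \<delta> - x) / b - (u - \<delta>' - x) / b\<bar>"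
      by (rule K_lip)
    also have "\<dots> = \<bar>L * ((\<delta> - \<delta>') / b)\<bar>"
      using b pos by (simp add: abs_mult diff_divide_distrib[symmetric] abs_minus_commute)
    finally have 1: "(K ((u - \<delta> - x) / b) - K ((u - \<delta>' - x) / b))\<^sup>2 \<le> ?c"
      by (simp only: abs_le_square_iff)
    show ?thesis
    proof (cases "u \<in> S \<delta> \<or> u \<in> S \<delta>'")
      case True
      have "?c * 1 \<le> ?c * (indicator (S \<delta>) u + indicator (S \<delta>') u)"
        using True by (intro mult_left_mono) (auto simp: indicator_def)
      then show ?thesis using 1 by linarith
    next
      case False
      then show ?thesis using K0 by simp
    qed
  qed
  have S: "S \<delta> \<in> sets borel" "measure lborel (S \<delta>) = 2 * A * b" "emeasure lborel (S \<delta>) < \<infinity>" for \<delta>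
    using pos b by (auto simp: S_def)
  have iS: "integrable lborel (indicator (S \<delta>) :: real \<Rightarrow> real)" for \<delta>
    using S by simp
  have "(\<integral>u. (K ((u - \<delta> - x) / b) - K ((u - \<delta>' - x) / b))\<^sup>2 \<partial>error_law)
      = (LINT u|lborel. f u * (K ((u - \<delta> - x) / b) - K ((u - \<delta>' - x) / b))\<^sup>2)"
    by (rule integral_error_law) measurable
  also have "\<dots> \<le> (LINT u|lborel. F * (?c * (indicator (S \<delta>) u + indicator (S \<delta>') u)))"
  proof (rule integral_mono')
    show "integrable lborel (\<lambda>u. F * (?c * (indicator (S \<delta>) u + indicator (S \<delta>') u)))"
      using iS by (intro integrable_mult_right Bochner_Integration.integrable_add)
    show "f u * (K ((u - \<delta> - x) / b) - K ((u - \<delta>' - x) / b))\<^sup>2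
        \<le> F * (?c * (indicator (S \<delta>) u + indicator (S \<delta>') u))" for u
      using le f_le f_nonneg constants_nonneg by (intro mult_mono) auto
  qed (use f_nonneg constants_nonneg in \<open>auto intro!: mult_nonneg_nonneg\<close>)
  also have "\<dots> = F * (?c * (4 * A * b))"
    using iS S by simp
  also have "\<dots> = 4 * A * F * L\<^sup>2 / b * (\<delta> - \<delta>')\<^sup>2"
    using b by (simp add: power2_eq_square field_simps)
  finally show ?thesis .
qed

text \<open>
  The derivative at \<open>x\<close> of the density smoothed by \<open>K\<close> at bandwidth \<open>b\<close>.
\<close>

definition slope :: "real \<Rightarrow> real \<Rightarrow> real" where
  "slope b x = (LINT v|lborel. K v * f' (x + b * v))"

lemma slope_le: "\<bar>slope b x\<bar> \<le> 2 * A * B * F1"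
  unfolding slope_def by (rule integrable_K_mult(2)) (use f'_le in auto)

text \<open>
  A shift of the error by \<open>\<delta>\<close> acts, on average, as a shift of the density, which is smooth:
  after the change of variables the increment falls on \<open>f\<close> and Taylor's formula applies to \<open>f\<close>
  rather than to the rapidly varying \<open>K ((u - x) / b)\<close>.
\<close>

lemma mean_kernel_shift:
  assumes b: "0 < b"
  shows "\<bar>(\<integral>u. K ((u - \<delta> - x) / b) - K ((u - x) / b) \<partial>error_law) - b * \<delta> * slope b x\<bar>
    \<le> b * (2 * A * B * F2) * \<delta>\<^sup>2"
proof -
  have iK: "integrable error_law (\<lambda>u. K ((u - z) / b))" for z
    by (rule error.integrable_const_bound[where B=B]) (use K_le in auto)
  have i1: "integrable lborel (\<lambda>v. K v * f (z + b * v))" for z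
    by (rule integrable_K_mult(1)[where C=F]) (use f_le f_nonneg in auto)
  have i2: "integrable lborel (\<lambda>v. K v * f' (x + b * v))"
    by (rule integrable_K_mult(1)[where C=F1]) (use f'_le in auto)
  have "(\<integral>u. K ((u - \<delta> - x) / b) - K ((u - x) / b) \<partial>error_law)
      = (\<integral>u. K ((u - (x + \<delta>)) / b) \<partial>error_law) - (\<integral>u. K ((u - x) / b) \<partial>error_law)"
    using iK[of "x + \<delta>"] iK[of x] by (simp add: algebra_simps)
  also have "\<dots> = b * (LINT v|lborel. K v * f (x + \<delta> + b * v)) - b * (LINT v|lborel. K v * f (x + b * v))"
    by (simp add: expectation_rescaled_kernel[OF b K_measurable])
  finally have "(\<integral>u. K ((u - \<delta> - x) / b) - K ((u - x) / b) \<partial>error_law) - b * \<delta> * slope b x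
      = b * (LINT v|lborel. K v * (f (x + b * v + \<delta>) - f (x + b * v) - \<delta> * f' (x + b * v)))"
    using i1[of "x + \<delta>"] i1[of x] i2 by (simp add: slope_def algebra_simps)
  moreover have "\<bar>LINT v|lborel. K v * (f (x + b * v + \<delta>) - f (x + b * v) - \<delta> * f' (x + b * v))\<bar>
      \<le> 2 * A * B * (F2 * \<delta>\<^sup>2)"
    by (rule integrable_K_mult(2)) (auto intro: taylor2_bound[OF f_deriv f'_deriv f''_le])
  ultimately show ?thesis using b by (simp add: abs_mult mult_ac)
qed

text \<open>
  The Taylor bound \<open>0 \<le> f x + t * f' x + F2 * t\<^sup>2\<close> holds for every \<open>t\<close>, as \<open>f\<close> is nonnegative;
  it is used at the minimising \<open>t\<close>.
\<close>

lemma f'_square_le: "(f' x)\<^sup>2 \<le> 4 * F2 * f x"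
proof -
  let ?t = "- f' x / (2 * F2)"
  have "0 \<le> f x + ?t * f' x + F2 * ?t\<^sup>2"
    using taylor2_bound[OF f_deriv f'_deriv f''_le, of x ?t] f_nonneg[of "x + ?t"] by linarith
  also have "\<dots> = f x - (f' x)\<^sup>2 / (4 * F2)"
    using pos by (simp add: power2_eq_square field_simps)
  finally show ?thesis using pos by (simp add: field_simps)
qed

definition kernel_second_moment :: "real \<Rightarrow> real \<Rightarrow> real" where
  "kernel_second_moment b x = (\<integral>u. (K ((u - x) / b))\<^sup>2 \<partial>error_law)"

lemma kernel_second_moment_eq:
  "0 < b \<Longrightarrow> kernel_second_moment b x = b * (LINT v|lborel. (K v)\<^sup>2 * f (x + b * v))"
  unfolding kernel_second_moment_def
  by (rule expectation_rescaled_kernel[where h="\<lambda>v. (K v)\<^sup>2"]) auto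

lemma kernel_second_moment_nonneg: "0 \<le> kernel_second_moment b x"
  unfolding kernel_second_moment_def by simp

lemma kernel_second_moment_le:
  assumes "0 < b" shows "kernel_second_moment b x \<le> b * (2 * A * B * (B * F))"
proof -
  have "\<bar>LINT v|lborel. K v * (K v * f (x + b * v))\<bar> \<le> 2 * A * B * (B * F)"
    by (rule integrable_K_mult(2))
       (use K_le f_le f_nonneg constants_nonneg in \<open>auto simp: abs_mult intro!: mult_mono\<close>)
  then show ?thesis using assms
    by (auto simp: kernel_second_moment_eq power2_eq_square mult.assoc intro!: mult_left_mono)
qed

text \<open>
  Because \<open>f'\<^sup>2\<close> is dominated by \<open>f\<close>, the slope is small wherever the variance of the kernel
  estimator is small, even where the density vanishes.
\<close>

lemma slope_square_le:
  assumes b: "0 < b"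
  shows "b * (slope b x)\<^sup>2 \<le> 8 * A * F2 * kernel_second_moment b x"
proof -
  have i1: "integrable lborel (\<lambda>v. K v * f' (x + b * v))"
    by (rule integrable_K_mult(1)[where C=F1]) (use f'_le in auto)
  have i2: "integrable lborel (\<lambda>v. (K v * f' (x + b * v))\<^sup>2)"
  proof -
    have "integrable lborel (\<lambda>v. K v * (K v * (f' (x + b * v))\<^sup>2))"
      by (rule integrable_K_mult(1)[where C="B * F1\<^sup>2"])
         (use K_le f'_le constants_nonneg in \<open>auto simp: abs_mult intro!: mult_mono power2_le_iff_abs_le[THEN iffD2]\<close>)
    then show ?thesis by (simp add: power2_eq_square mult_ac)
  qed
  have i3: "integrable lborel (\<lambda>v. (K v)\<^sup>2 * f (x + b * v))"
  proof -
    have "integrable lborel (\<lambda>v. K v * (K v * f (x + b * v)))"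
      by (rule integrable_K_mult(1)[where C="B * F"])
         (use K_le f_le f_nonneg constants_nonneg in \<open>auto simp: abs_mult intro!: mult_mono\<close>)
    then show ?thesis by (simp add: power2_eq_square mult.assoc)
  qed
  have "(slope b x)\<^sup>2 \<le> measure lborel {-A..A} * (LINT v|lborel. (K v * f' (x + b * v))\<^sup>2)"
    unfolding slope_def by (rule square_integral_le_of_support[OF i1 i2]) (use K_support pos in auto)
  also have "\<dots> \<le> 2 * A * (LINT v|lborel. 4 * F2 * ((K v)\<^sup>2 * f (x + b * v)))"
  proof -
    have "(K v * f' (x + b * v))\<^sup>2 \<le> 4 * F2 * ((K v)\<^sup>2 * f (x + b * v))" for v
      using mult_left_mono[OF f'_square_le, of "(K v)\<^sup>2" "x + b * v"] by (simp add: power_mult_distrib mult_ac)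
    then have "(LINT v|lborel. (K v * f' (x + b * v))\<^sup>2) \<le> (LINT v|lborel. 4 * F2 * ((K v)\<^sup>2 * f (x + b * v)))"
      by (intro integral_mono i2 integrable_mult_right i3)
    then show ?thesis using pos by (simp add: mult_left_mono)
  qed
  finally have "(slope b x)\<^sup>2 \<le> 8 * A * F2 * (LINT v|lborel. (K v)\<^sup>2 * f (x + b * v))" by simp
  from mult_left_mono[OF this, of b] show ?thesis using b by (simp add: kernel_second_moment_eq mult_ac)
qed

definition kernel_mean :: "real \<Rightarrow> real \<Rightarrow> real" where
  "kernel_mean b x = (\<integral>u. K ((u - x) / b) \<partial>error_law)"

lemma kernel_mean_square_le:
  assumes b: "0 < b"
  shows "(kernel_mean b x)\<^sup>2 \<le> 2 * A * F * b * kernel_second_moment b x"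
proof -
  let ?S = "{x - A * b .. x + A * b}"
  have i1: "integrable error_law (\<lambda>u. K ((u - x) / b))"
    by (rule error.integrable_const_bound[where B=B]) (use K_le in auto)
  have i2: "integrable error_law (\<lambda>u. (K ((u - x) / b))\<^sup>2)"
    by (rule error.integrable_const_bound[where B="B\<^sup>2"])
       (use K_le constants_nonneg in \<open>auto intro!: power2_le_iff_abs_le[THEN iffD2]\<close>)
  have K0: "K ((u - x) / b) = 0" if "u \<notin> ?S" for u
  proof (rule K_support)
    have "A * b < \<bar>u - x\<bar>" using that by auto
    then show "A < \<bar>(u - x) / b\<bar>" using b by (simp add: abs_divide pos_less_divide_eq)
  qed
  have "(kernel_mean b x)\<^sup>2 \<le> measure error_law ?S * kernel_second_moment b x"
    unfolding kernel_mean_def kernel_second_moment_def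
  proof (rule square_integral_le_of_support[OF i1 i2 _ _ K0])
    show "emeasure error_law ?S < \<infinity>"
      unfolding error.emeasure_eq_measure infinity_ennreal_def by (rule ennreal_less_top)
  qed auto
  also have "\<dots> \<le> 2 * A * F * b * kernel_second_moment b x"
  proof (intro mult_right_mono kernel_second_moment_nonneg)
    have "measure error_law ?S = (\<integral>u. indicator ?S u \<partial>error_law)" by simp
    also have "\<dots> = (LINT u|lborel. f u * indicator ?S u)" by (rule integral_error_law) measurable
    also have "\<dots> \<le> F * (x + A * b - (x - A * b))"
    proof -
      have "\<bar>f u * indicator ?S u\<bar> \<le> F" for u
        using f_le[of u] f_nonneg[of u] constants_nonneg by (cases "u \<in> ?S") auto
      moreover have "f u * indicator ?S u = 0" if "u \<notin> ?S" for u using that by simp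
      ultimately have "\<bar>LINT u|lborel. f u * indicator ?S u\<bar> \<le> F * (x + A * b - (x - A * b))"
        by (rule integrable_bounded_support(2)[rotated]) (use pos b in auto)
      then show ?thesis by linarith
    qed
    finally show "measure error_law ?S \<le> 2 * A * F * b" by (simp add: mult_ac)
  qed
  finally show ?thesis .
qed

lemma kernel_bias:
  assumes b: "0 < b"
  shows "\<bar>kernel_mean b x / b - f x\<bar> \<le> 2 * A * B * (F2 * A\<^sup>2) * b\<^sup>2"
proof -
  have i1: "integrable lborel (\<lambda>v. K v * f (x + b * v))"
    by (rule integrable_K_mult(1)[where C=F]) (use f_le f_nonneg in auto)
  have i2: "integrable lborel (\<lambda>v. K v * 1)"
    by (rule integrable_K_mult(1)[where C=1]) auto
  have i3: "integrable lborel (\<lambda>v. K v * v)"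
    by (rule integrable_K_mult(1)[where C=A]) auto
  have "kernel_mean b x / b = (LINT v|lborel. K v * f (x + b * v))"
    unfolding kernel_mean_def using b by (subst expectation_rescaled_kernel) auto
  then have "kernel_mean b x / b - f x
      = (LINT v|lborel. K v * f (x + b * v)) - f x * (LINT v|lborel. K v * 1) - b * f' x * (LINT v|lborel. K v * v)"
    using K_mass K_mean by (simp add: mult.commute)
  also have "\<dots> = (LINT v|lborel. K v * (f (x + b * v) - f x - b * v * f' x))"
  proof -
    have "K v * (f (x + b * v) - f x - b * v * f' x)
        = K v * f (x + b * v) - f x * (K v * 1) - b * f' x * (K v * v)" for v
      by (simp add: algebra_simps)
    then show ?thesis using i1 i2 i3 by (simp only:) simp
  qed
  also have "\<bar>\<dots>\<bar> \<le> 2 * A * B * (F2 * (b * A)\<^sup>2)"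
  proof (rule integrable_K_mult(2))
    fix v assume v: "\<bar>v\<bar> \<le> A"
    have "\<bar>f (x + b * v) - f x - b * v * f' x\<bar> \<le> F2 * (b * v)\<^sup>2"
      by (rule taylor2_bound[OF f_deriv f'_deriv f''_le])
    also have "\<dots> \<le> F2 * (b * A)\<^sup>2"
      using v b pos by (intro mult_left_mono) (auto simp: power_mult_distrib intro!: mult_left_mono power2_le_iff_abs_le[THEN iffD2])
    finally show "\<bar>f (x + b * v) - f x - b * v * f' x\<bar> \<le> F2 * (b * A)\<^sup>2" .
  qed measurable
  finally show ?thesis by (simp add: power_mult_distrib mult_ac)
qed

end

section \<open>Centred kernel increments and the oracle estimator\<close>

lemma (in prob_space) expectation_abs_le_sqrt:
  fixes g :: "'a \<Rightarrow> real"
  assumes [measurable]: "g \<in> borel_measurable M" and g2: "integrable M (\<lambda>x. (g x)\<^sup>2)"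
  shows "integrable M g" "expectation (\<lambda>x. \<bar>g x\<bar>) \<le> sqrt (expectation (\<lambda>x. (g x)\<^sup>2))"
proof -
  show g1: "integrable M g" by (rule square_integrable_imp_integrable) (use g2 in auto)
  have "0 \<le> variance (\<lambda>x. \<bar>g x\<bar>)" by (rule variance_positive)
  also have "\<dots> = expectation (\<lambda>x. (g x)\<^sup>2) - (expectation (\<lambda>x. \<bar>g x\<bar>))\<^sup>2"
    using variance_eq[of "\<lambda>x. \<bar>g x\<bar>"] g1 g2 by simp
  finally show "expectation (\<lambda>x. \<bar>g x\<bar>) \<le> sqrt (expectation (\<lambda>x. (g x)\<^sup>2))"
    by (intro real_le_rsqrt) simp
qed

locale kernel_regression = kernel_smoothing +
  assumes error_mean: "(\<integral>u. u \<partial>error_law) = 0"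
    and error_square_integrable: "integrable error_law (\<lambda>u. u\<^sup>2)"
begin

lemma iid_errors: "finite I \<Longrightarrow> iid_errors error_law I"
  by unfold_locales (auto simp: error_mean error_square_integrable)

lemma error_prob_UNIV [simp]: "measure error_law UNIV = 1"
  using error.prob_space by simp

text \<open>
  Mean effect on \<open>K ((u - x) / b)\<close> of shifting the error by a deterministic \<open>\<delta>\<close>;
  subtracting it below leaves an increment that is centred for every fixed shift.
\<close>

definition shift_mean :: "real \<Rightarrow> real \<Rightarrow> real \<Rightarrow> real" where
  "shift_mean b x \<delta> = (\<integral>u. K ((u - \<delta> - x) / b) - K ((u - x) / b) \<partial>error_law)"

definition centred_shift :: "real \<Rightarrow> real \<Rightarrow> real \<Rightarrow> real \<Rightarrow> real" where
  "centred_shift b x a \<delta> = K ((a - \<delta> - x) / b) - K ((a - x) / b) - shift_mean b x \<delta>"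

lemma shift_mean_measurable [measurable]: "shift_mean b x \<in> borel_measurable borel"
  unfolding shift_mean_def[abs_def] by measurable

lemma centred_shift_measurable: "case_prod (centred_shift b x) \<in> borel_measurable (borel \<Otimes>\<^sub>M borel)"
  unfolding centred_shift_def[abs_def] by measurable

lemma integrable_K_bounded: "integrable error_law (\<lambda>u. K ((u - \<delta> - x) / b))"
    "integrable error_law (\<lambda>u. K ((u - x) / b))"
  by (rule error.integrable_const_bound[where B=B]; use K_le in simp)+

lemma shift_mean_le: "\<bar>shift_mean b x \<delta>\<bar> \<le> 2 * B"
proof -
  have "\<bar>shift_mean b x \<delta>\<bar> \<le> (\<integral>u. \<bar>K ((u - \<delta> - x) / b) - K ((u - x) / b)\<bar> \<partial>error_law)"
    unfolding shift_mean_def by (rule integral_abs_bound)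
  also have "\<dots> \<le> (\<integral>u. 2 * B \<partial>error_law)"
  proof (rule integral_mono)
    fix u show "\<bar>K ((u - \<delta> - x) / b) - K ((u - x) / b)\<bar> \<le> 2 * B"
      using K_le[of "(u - \<delta> - x) / b"] K_le[of "(u - x) / b"] by linarith
  qed (use integrable_K_bounded in auto)
  finally show ?thesis by (simp add: error.prob_space)
qed

lemma centred_shift_le: "\<bar>centred_shift b x a \<delta>\<bar> \<le> 4 * B"
  using K_le[of "(a - \<delta> - x) / b"] K_le[of "(a - x) / b"] shift_mean_le[of b x \<delta>]
  unfolding centred_shift_def by linarith

lemma centred_shift_0: "centred_shift b x a 0 = 0"
  by (simp add: centred_shift_def shift_mean_def)

lemma expectation_centred_shift: "(\<integral>a. centred_shift b x a \<delta> \<partial>error_law) = 0"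
  unfolding centred_shift_def using integrable_K_bounded
  by (simp add: error.prob_space shift_mean_def)

lemma centred_shift_second_moment:
  assumes b: "0 < b"
  shows "(\<integral>a. (centred_shift b x a \<delta> - centred_shift b x a \<delta>')\<^sup>2 \<partial>error_law)
    \<le> 4 * A * F * L\<^sup>2 / b * (\<delta> - \<delta>')\<^sup>2"
proof -
  let ?g = "\<lambda>u. K ((u - \<delta> - x) / b) - K ((u - \<delta>' - x) / b)"
  have ig: "integrable error_law ?g" using integrable_K_bounded by auto
  have ig2: "integrable error_law (\<lambda>u. (?g u)\<^sup>2)"
  proof (rule error.integrable_const_bound[where B="(2 * B)\<^sup>2"])
    have "\<bar>?g u\<bar> \<le> 2 * B" for u
      using K_le[of "(u - \<delta> - x) / b"] K_le[of "(u - \<delta>' - x) / b"] by linarith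
    then have "(?g u)\<^sup>2 \<le> (2 * B)\<^sup>2" for u
      using constants_nonneg by (subst abs_le_square_iff[symmetric]) auto
    then show "AE u in error_law. norm ((?g u)\<^sup>2) \<le> (2 * B)\<^sup>2" by simp
  qed measurable
  have "(\<integral>u. ?g u \<partial>error_law) = shift_mean b x \<delta> - shift_mean b x \<delta>'"
    unfolding shift_mean_def using integrable_K_bounded by simp
  then have e: "centred_shift b x a \<delta> - centred_shift b x a \<delta>' = ?g a - (\<integral>u. ?g u \<partial>error_law)" for a
    by (simp add: centred_shift_def)
  have "(\<integral>a. (centred_shift b x a \<delta> - centred_shift b x a \<delta>')\<^sup>2 \<partial>error_law)
      = error.variance ?g"
    unfolding e ..
  also have "\<dots> \<le> (\<integral>u. (?g u)\<^sup>2 \<partial>error_law)"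
    using error.variance_eq[OF ig ig2] by simp
  also have "\<dots> \<le> 4 * A * F * L\<^sup>2 / b * (\<delta> - \<delta>')\<^sup>2"
    by (rule kernel_shift_second_moment[OF b])
  finally show ?thesis .
qed

definition oracle_density :: "real \<Rightarrow> real \<Rightarrow> 'i set \<Rightarrow> ('i \<Rightarrow> real) \<Rightarrow> real" where
  "oracle_density b x J y = (\<Sum>i\<in>J. K ((y i - x) / b)) / (b * real (card J))"

definition residual_density ::
    "real \<Rightarrow> real \<Rightarrow> 'i set \<Rightarrow> ('i \<Rightarrow> real) \<Rightarrow> ('i \<Rightarrow> real) \<Rightarrow> real" where
  "residual_density b x J \<Delta> y = (\<Sum>i\<in>J. K ((y i - \<Delta> i - x) / b)) / (b * real (card J))"

text \<open>
  Squared bias plus variance of the kernel estimator built from \<open>N\<close> true errors.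
\<close>

definition oracle_mse :: "real \<Rightarrow> real \<Rightarrow> real \<Rightarrow> real" where
  "oracle_mse b x N = (kernel_mean b x / b - f x)\<^sup>2
     + (kernel_second_moment b x - (kernel_mean b x)\<^sup>2) / (b\<^sup>2 * N)"

lemma kernel_variance_nonneg: "0 \<le> kernel_second_moment b x - (kernel_mean b x)\<^sup>2"
proof -
  have "integrable error_law (\<lambda>u. (K ((u - x) / b))\<^sup>2)"
    by (rule error.integrable_const_bound[where B="B\<^sup>2"])
       (use K_le constants_nonneg in \<open>auto intro!: power2_le_iff_abs_le[THEN iffD2]\<close>)
  then have "error.variance (\<lambda>u. K ((u - x) / b)) = kernel_second_moment b x - (kernel_mean b x)\<^sup>2"
    unfolding kernel_second_moment_def kernel_mean_def using integrable_K_bounded(2)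
    by (intro error.variance_eq) auto
  then show ?thesis using error.variance_positive[of "\<lambda>u. K ((u - x) / b)"] by simp
qed

lemma oracle_mse_nonneg: "0 \<le> N \<Longrightarrow> 0 \<le> oracle_mse b x N"
  unfolding oracle_mse_def using kernel_variance_nonneg by auto

lemma oracle_mse_eq:
  assumes I: "finite I" and J: "J \<subseteq> I" "J \<noteq> {}" and b: "0 < b"
  shows "(\<integral>y. (oracle_density b x J y - f x)\<^sup>2 \<partial>(\<Pi>\<^sub>M i\<in>I. error_law)) = oracle_mse b x (card J)"
    and "integrable (\<Pi>\<^sub>M i\<in>I. error_law) (\<lambda>y. (oracle_density b x J y - f x)\<^sup>2)"
proof -
  interpret iid_errors error_law I by (rule iid_errors[OF I])
  let ?m = "kernel_mean b x" and ?N = "real (card J)"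
  have fJ: "finite J" using I J finite_subset by blast
  have N: "0 < ?N" using fJ J by (simp add: card_gt_0_iff)
  define h where "h u = K ((u - x) / b) - ?m" for u
  have [measurable]: "h \<in> borel_measurable error_law" unfolding h_def[abs_def] by measurable
  have i2: "integrable error_law (\<lambda>u. (K ((u - x) / b))\<^sup>2)"
    by (rule error.integrable_const_bound[where B="B\<^sup>2"])
       (use K_le constants_nonneg in \<open>auto intro!: power2_le_iff_abs_le[THEN iffD2]\<close>)
  have h0: "(\<integral>u. h u \<partial>error_law) = 0"
    unfolding h_def using integrable_K_bounded(2) by (simp add: kernel_mean_def error.prob_space)
  have ih2: "integrable error_law (\<lambda>u. (h u)\<^sup>2)"
    unfolding h_def power2_diff using i2 integrable_K_bounded(2) by simp
  have h2: "(\<integral>u. (h u)\<^sup>2 \<partial>error_law) = kernel_second_moment b x - ?m\<^sup>2"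
    unfolding h_def kernel_mean_def kernel_second_moment_def
    by (rule error.variance_eq[OF integrable_K_bounded(2) i2])
  have e: "oracle_density b x J y - f x = (?m / b - f x) + (\<Sum>k\<in>J. 1 / (b * ?N) * h (y k))" for y
  proof -
    have "(\<Sum>k\<in>J. 1 / (b * ?N) * h (y k)) = (\<Sum>k\<in>J. h (y k)) / (b * ?N)"
      by (simp add: sum_divide_distrib)
    also have "(\<Sum>k\<in>J. h (y k)) = (\<Sum>k\<in>J. K ((y k - x) / b)) - ?N * ?m"
      by (simp add: h_def sum_subtractf)
    finally show ?thesis using b N by (simp add: oracle_density_def diff_divide_distrib)
  qed
  have s: "(\<Sum>k\<in>J. (1 / (b * ?N))\<^sup>2) = 1 / (b\<^sup>2 * ?N)"
    using b N by (simp add: power2_eq_square field_simps)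
  note sm = second_moment_centred_sum[OF _ ih2 h0 J(1), of "?m / b - f x" "\<lambda>_. 1 / (b * ?N)"]
  show "(\<integral>y. (oracle_density b x J y - f x)\<^sup>2 \<partial>(\<Pi>\<^sub>M i\<in>I. error_law)) = oracle_mse b x (card J)"
    unfolding e using sm(1) unfolding s h2 by (simp add: oracle_mse_def)
  show "integrable (\<Pi>\<^sub>M i\<in>I. error_law) (\<lambda>y. (oracle_density b x J y - f x)\<^sup>2)"
    unfolding e by (rule sm(2)) measurable
qed

text \<open>
  The mean-square error of the oracle estimator enters the rate as it is and not through its
  upper bound \<open>b ^ 4 + 1 / (n * b)\<close>; it can be much smaller, for instance where \<open>f\<close> vanishes. The
  drift caused by estimating the regression function contributes \<open>slope\<^sup>2 / n\<close>, and this lemma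
  shows that it is nevertheless dominated. The smallness of \<open>b\<close> guarantees that the variance of
  the kernel is at least half of its second moment.
\<close>

lemma slope_square_le_oracle_mse:
  assumes b: "0 < b" "4 * A * F * b \<le> 1" and N: "0 < N"
  shows "(slope b x)\<^sup>2 \<le> 16 * A * F2 * b * N * oracle_mse b x N"
proof -
  let ?Q = "kernel_second_moment b x"
  have "(kernel_mean b x)\<^sup>2 \<le> (4 * A * F * b) * ?Q / 2"
    using kernel_mean_square_le[OF b(1), of x] by simp
  also have "\<dots> \<le> 1 * ?Q / 2"
    using b by (intro divide_right_mono mult_right_mono kernel_second_moment_nonneg) auto
  finally have "?Q \<le> 2 * (?Q - (kernel_mean b x)\<^sup>2)" by simp
  also have "\<dots> \<le> 2 * (b\<^sup>2 * N * oracle_mse b x N)"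
  proof -
    have eq: "b\<^sup>2 * N * oracle_mse b x N = b\<^sup>2 * N * (kernel_mean b x / b - f x)\<^sup>2 + (?Q - (kernel_mean b x)\<^sup>2)"
      unfolding oracle_mse_def using b N by (simp add: distrib_left)
    have "0 \<le> b\<^sup>2 * N * (kernel_mean b x / b - f x)\<^sup>2" using N by simp
    then show ?thesis unfolding eq by simp
  qed
  finally have "8 * A * F2 * ?Q \<le> 8 * A * F2 * (2 * (b\<^sup>2 * N * oracle_mse b x N))"
    using pos by (intro mult_left_mono) auto
  then have "b * (slope b x)\<^sup>2 \<le> b * (16 * A * F2 * b * N * oracle_mse b x N)"
    using slope_square_le[OF b(1), of x] by (simp add: power2_eq_square mult_ac)
  then show ?thesis using b(1) by simp
qed

lemma oracle_mse_le:
  assumes b: "0 < b" and N: "0 < N"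
  shows "oracle_mse b x N \<le> (2 * A * B * (F2 * A\<^sup>2))\<^sup>2 * b ^ 4 + 2 * A * B * (B * F) / (b * N)"
proof -
  have "(kernel_mean b x / b - f x)\<^sup>2 \<le> (2 * A * B * (F2 * A\<^sup>2) * b\<^sup>2)\<^sup>2"
    using kernel_bias[OF b, of x] constants_nonneg pos by (subst abs_le_square_iff[symmetric]) simp
  then have 1: "(kernel_mean b x / b - f x)\<^sup>2 \<le> (2 * A * B * (F2 * A\<^sup>2))\<^sup>2 * b ^ 4"
    by (simp add: power_mult_distrib power_mult[symmetric])
  have "(kernel_second_moment b x - (kernel_mean b x)\<^sup>2) / (b\<^sup>2 * N)
      \<le> b * (2 * A * B * (B * F)) / (b\<^sup>2 * N)"
    using kernel_second_moment_le[OF b, of x] b N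
    by (intro divide_right_mono order_trans[OF _ kernel_second_moment_le[OF b, of x]]) auto
  also have "\<dots> = 2 * A * B * (B * F) / (b * N)"
    using b by (simp add: power2_eq_square field_simps)
  finally show ?thesis using 1 unfolding oracle_mse_def by linarith
qed

end

section \<open>The estimation error for a fixed design\<close>

context kernel_regression
begin

definition error_bound_const :: "real \<Rightarrow> real \<Rightarrow> real" where
  "error_bound_const D p = (let V = (\<integral>u. u\<^sup>2 \<partial>error_law); E = D\<^sup>2 + D * V in
     1 + sqrt (8 * A * F * L\<^sup>2 * E / p) + 2 * A * B * F1 * D + D * sqrt (16 * A * F2 * V / p)
       + 2 * A * B * F2 * E)"

lemma error_bound_const_nonneg:
  assumes "0 \<le> D" "0 < p" shows "0 \<le> error_bound_const D p"
proof -
  have "0 \<le> (\<integral>u. u\<^sup>2 \<partial>error_law)" by simp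
  then show ?thesis using assms constants_nonneg pos unfolding error_bound_const_def Let_def
    by (intro add_nonneg_nonneg mult_nonneg_nonneg real_sqrt_ge_zero divide_nonneg_nonneg) auto
qed

text \<open>
  The error is split into four parts: the error \<open>T\<close> of the oracle estimator; the sum \<open>S1\<close> of centred
  increments, bounded by \<open>second_moment_decoupled\<close>; and the mean increments, which by
  \<open>mean_kernel_shift\<close> consist of a linear part, proportional to the sum \<open>S2\<close> of the regression
  errors, and of a quadratic remainder \<open>S3\<close>. In \<open>S2\<close> the stochastic parts average out: each error
  enters with the column sum of the weights, which is bounded, so that \<open>S2\<close> has standard deviation
  of order \<open>sqrt n\<close>. Here \<open>r\<close> stands for the order of the bias of the regression estimator and \<open>q\<close> for
  that of its variance.
\<close>

lemma residual_density_error: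
  fixes I :: "'i set" and w :: "'i \<Rightarrow> 'i \<Rightarrow> real" and \<beta> :: "'i \<Rightarrow> real"
  defines "\<Delta> \<equiv> \<lambda>y i. \<beta> i + (\<Sum>k\<in>I. w i k * y k)"
  assumes I: "finite I" and J: "J \<subseteq> I" "J \<noteq> {}" and b: "0 < b" "4 * A * F * b \<le> 1" "b \<le> 1"
    and w0: "\<And>i. i \<in> J \<Longrightarrow> w i i = 0"
    and \<beta>: "\<And>i. i \<in> J \<Longrightarrow> \<bar>\<beta> i\<bar> \<le> D * r"
    and rows: "\<And>i. i \<in> J \<Longrightarrow> (\<Sum>k\<in>I. (w i k)\<^sup>2) \<le> D * q"
    and columns: "\<And>k. k \<in> I \<Longrightarrow> (\<Sum>i\<in>J. \<bar>w i k\<bar>) \<le> D"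
    and p: "0 < p" "p * real (card I) \<le> real (card J)" and nn: "0 \<le> D" "0 \<le> r" "0 \<le> q"
  shows "(\<integral>y. \<bar>residual_density b x J (\<Delta> y) y - f x\<bar> \<partial>(\<Pi>\<^sub>M i\<in>I. error_law))
    \<le> error_bound_const D p * (sqrt (oracle_mse b x (card J))
        + sqrt ((r\<^sup>2 + q) / (b ^ 3 * card I)) + r + (r\<^sup>2 + q))" (is "?lhs \<le> ?rhs")
    and "integrable (\<Pi>\<^sub>M i\<in>I. error_law) (\<lambda>y. \<bar>residual_density b x J (\<Delta> y) y - f x\<bar>)"
proof -
  interpret iid_errors error_law I by (rule iid_errors[OF I])
  have \<Delta>_eq: "\<Delta> y i = lin_comb (\<beta> i) (w i) y" for y i
    by (simp add: \<Delta>_def lin_comb_def)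
  have [measurable]: "(\<lambda>y. \<Delta> y i) \<in> borel_measurable sample_law" for i
    unfolding \<Delta>_eq by measurable
  have comp: "(\<lambda>y. y i) \<in> borel_measurable sample_law" if "i \<in> J" for i
    using measurable_component_singleton[of i I "\<lambda>_. error_law"] that J(1)
      measurable_cong_sets[OF refl sets_errors, of sample_law] by auto
  define n where "n = real (card I)"
  define N where "N = real (card J)"
  define V where "V = variance_errors"
  define E where "E = D\<^sup>2 + D * V"
  define v where "v = r\<^sup>2 + q"
  define \<psi> where "\<psi> = oracle_mse b x (card J)"
  have fJ: "finite J" using I J finite_subset by blast
  have N0: "0 < N" using fJ J by (simp add: card_gt_0_iff N_def)
  have Nn: "N \<le> n" unfolding N_def n_def using card_mono[OF I J(1)] by simp
  have n0: "0 < n" using N0 Nn by linarith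
  have pn: "p * n \<le> N" using p by (simp add: n_def N_def)
  have V0: "0 \<le> V" unfolding V_def variance_errors_def by simp
  have E0: "0 \<le> E" using nn V0 by (simp add: E_def)
  have v0: "0 \<le> v" using nn by (simp add: v_def)
  have \<psi>0: "0 \<le> \<psi>" unfolding \<psi>_def by (rule oracle_mse_nonneg) simp
  note nonneg = constants_nonneg pos
  have sqrt_div: "sqrt u / c = sqrt (u / c\<^sup>2)" if "0 < c" for u c :: real
    using that by (simp add: real_sqrt_divide)

  have E\<Delta>: "(\<integral>y. (\<Delta> y i)\<^sup>2 \<partial>sample_law) \<le> E * v" if i: "i \<in> J" for i
  proof -
    have "(\<integral>y. (\<Delta> y i)\<^sup>2 \<partial>sample_law) = (\<beta> i)\<^sup>2 + (\<Sum>k\<in>I. (w i k)\<^sup>2) * V"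
      unfolding \<Delta>_eq V_def by (rule second_moment_lin_comb(1))
    also have "\<dots> \<le> (D * r)\<^sup>2 + (D * q) * V"
      using \<beta>[OF i] rows[OF i] V0 nn by (intro add_mono mult_right_mono) (auto intro!: power2_le_iff_abs_le[THEN iffD2])
    also have "\<dots> \<le> (D * r)\<^sup>2 + (D * q) * V + (D\<^sup>2 * q + D * V * r\<^sup>2)" using nn V0 by simp
    also have "\<dots> = E * v" by (simp add: E_def v_def power_mult_distrib algebra_simps)
    finally show ?thesis .
  qed
  have i\<Delta>2: "integrable sample_law (\<lambda>y. (\<Delta> y i)\<^sup>2)" for i
    unfolding \<Delta>_eq by (rule second_moment_lin_comb(2))

  define S1 where "S1 y = (\<Sum>i\<in>J. centred_shift b x (y i) (\<Delta> y i))" for y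
  define S2 where "S2 y = (\<Sum>i\<in>J. \<Delta> y i)" for y
  define S3 where "S3 y = (\<Sum>i\<in>J. (\<Delta> y i)\<^sup>2)" for y

  have mS1: "S1 \<in> borel_measurable sample_law"
    unfolding S1_def[abs_def] centred_shift_def
  proof (intro borel_measurable_sum)
    fix i assume "i \<in> J"
    note [measurable] = comp[OF this]
    show "(\<lambda>y. K ((y i - \<Delta> y i - x) / b) - K ((y i - x) / b) - shift_mean b x (\<Delta> y i)) \<in> borel_measurable sample_law"
      by measurable
  qed
  have iS1: "integrable sample_law (\<lambda>y. (S1 y)\<^sup>2)"
  proof (rule sample.integrable_const_bound[where B="(N * (4 * B))\<^sup>2"])
    have "\<bar>S1 y\<bar> \<le> N * (4 * B)" for y
    proof -
      have "\<bar>S1 y\<bar> \<le> (\<Sum>i\<in>J. \<bar>centred_shift b x (y i) (\<Delta> y i)\<bar>)" unfolding S1_def by (rule sum_abs)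
      also have "\<dots> \<le> (\<Sum>i\<in>J. 4 * B)" by (intro sum_mono centred_shift_le)
      finally show ?thesis by (simp add: N_def)
    qed
    then show "AE y in sample_law. norm ((S1 y)\<^sup>2) \<le> (N * (4 * B))\<^sup>2"
      using N0 nonneg by (auto intro!: AE_I2 power2_le_iff_abs_le[THEN iffD2])
  qed (use mS1 in measurable)
  have ES1: "(\<integral>y. (S1 y)\<^sup>2 \<partial>sample_law) \<le> 8 * A * F * L\<^sup>2 / b * (N * (E * v))"
  proof -
    have "(\<integral>y. (S1 y)\<^sup>2 \<partial>sample_law)
        \<le> 2 * (4 * A * F * L\<^sup>2 / b) * (\<Sum>i\<in>J. \<integral>y. (lin_comb (\<beta> i) (w i) y)\<^sup>2 \<partial>sample_law)"
      unfolding S1_def \<Delta>_eq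
      by (rule second_moment_decoupled[where B="4 * B", OF J(1) w0 centred_shift_measurable
            centred_shift_le centred_shift_0 expectation_centred_shift centred_shift_second_moment[OF b(1)]])
    also have "\<dots> \<le> 2 * (4 * A * F * L\<^sup>2 / b) * (\<Sum>i\<in>J. E * v)"
      using E\<Delta> b nonneg unfolding \<Delta>_eq by (intro mult_left_mono sum_mono) auto
    finally show ?thesis by (simp add: N_def)
  qed
  \<comment> \<open>Exchanging the two sums exhibits the column sums of the weights as coefficients.\<close>
  have S2_eq: "S2 y = lin_comb (\<Sum>i\<in>J. \<beta> i) (\<lambda>k. \<Sum>i\<in>J. w i k) y" for y
    unfolding S2_def \<Delta>_def lin_comb_def
    by (simp add: sum.distrib sum_distrib_right sum.swap[of _ I])
  have iS2: "integrable sample_law (\<lambda>y. (S2 y)\<^sup>2)"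
    unfolding S2_eq by (rule second_moment_lin_comb(2))
  have mS2: "S2 \<in> borel_measurable sample_law" unfolding S2_eq[abs_def] by (rule lin_comb_measurable)
  have ES2: "(\<integral>y. (S2 y)\<^sup>2 \<partial>sample_law) \<le> (N * (D * r))\<^sup>2 + n * D\<^sup>2 * V"
  proof -
    have "\<bar>\<Sum>i\<in>J. \<beta> i\<bar> \<le> (\<Sum>i\<in>J. D * r)"
      by (rule order_trans[OF sum_abs sum_mono[OF \<beta>]])
    then have 1: "(\<Sum>i\<in>J. \<beta> i)\<^sup>2 \<le> (N * (D * r))\<^sup>2"
      using N0 nn by (intro power2_le_iff_abs_le[THEN iffD2]) (auto simp: N_def)
    have "(\<Sum>k\<in>I. (\<Sum>i\<in>J. w i k)\<^sup>2) \<le> (\<Sum>k\<in>I. D\<^sup>2)"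
      using order_trans[OF sum_abs columns] nn by (intro sum_mono power2_le_iff_abs_le[THEN iffD2]) auto
    then have "(\<Sum>k\<in>I. (\<Sum>i\<in>J. w i k)\<^sup>2) * V \<le> n * D\<^sup>2 * V"
      using V0 by (intro mult_right_mono) (auto simp: n_def)
    then show ?thesis using 1 unfolding S2_eq second_moment_lin_comb V_def by linarith
  qed
  have iS3: "integrable sample_law S3" unfolding S3_def[abs_def] using i\<Delta>2 by (intro Bochner_Integration.integrable_sum)
  have ES3: "(\<integral>y. S3 y \<partial>sample_law) \<le> N * (E * v)"
  proof -
    have "(\<integral>y. S3 y \<partial>sample_law) = (\<Sum>i\<in>J. \<integral>y. (\<Delta> y i)\<^sup>2 \<partial>sample_law)"
      unfolding S3_def using i\<Delta>2 by (simp add: Bochner_Integration.integral_sum)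
    also have "\<dots> \<le> (\<Sum>i\<in>J. E * v)" by (intro sum_mono E\<Delta>)
    finally show ?thesis by (simp add: N_def)
  qed

  define T where "T y = oracle_density b x J y - f x" for y
  have iT: "integrable sample_law (\<lambda>y. (T y)\<^sup>2)"
    unfolding T_def by (rule oracle_mse_eq(2)[OF I J b(1)])
  have ET: "(\<integral>y. (T y)\<^sup>2 \<partial>sample_law) = \<psi>"
    unfolding T_def \<psi>_def by (rule oracle_mse_eq(1)[OF I J b(1)])
  have mT: "T \<in> borel_measurable sample_law"
    unfolding T_def[abs_def] oracle_density_def
  proof (intro borel_measurable_diff borel_measurable_divide borel_measurable_sum)
    fix i assume "i \<in> J"
    note [measurable] = comp[OF this]
    show "(\<lambda>y. K ((y i - x) / b)) \<in> borel_measurable sample_law" by measurable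
  qed auto
  let ?s = "slope b x"
  define G where "G y = \<bar>T y\<bar> + \<bar>S1 y\<bar> / (b * N) + \<bar>?s\<bar> / N * \<bar>S2 y\<bar> + 2 * A * B * F2 / N * S3 y" for y
  have point: "\<bar>residual_density b x J (\<Delta> y) y - f x\<bar> \<le> G y" for y
  proof -
    have "(\<Sum>i\<in>J. K ((y i - \<Delta> y i - x) / b)) = (\<Sum>i\<in>J. K ((y i - x) / b)) + S1 y
        + (\<Sum>i\<in>J. shift_mean b x (\<Delta> y i))"
      by (simp add: S1_def centred_shift_def sum.distrib sum_subtractf)
    then have eq: "residual_density b x J (\<Delta> y) y - f x
        = T y + S1 y / (b * N) + (\<Sum>i\<in>J. shift_mean b x (\<Delta> y i)) / (b * N)"
      by (simp add: residual_density_def T_def oracle_density_def N_def add_divide_distrib)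
    have "\<bar>\<Sum>i\<in>J. shift_mean b x (\<Delta> y i)\<bar> \<le> b * \<bar>?s\<bar> * \<bar>S2 y\<bar> + b * (2 * A * B * F2) * S3 y"
    proof -
      have "\<bar>(\<Sum>i\<in>J. shift_mean b x (\<Delta> y i)) - (\<Sum>i\<in>J. b * \<Delta> y i * ?s)\<bar>
          \<le> (\<Sum>i\<in>J. \<bar>shift_mean b x (\<Delta> y i) - b * \<Delta> y i * ?s\<bar>)"
        unfolding sum_subtractf[symmetric] by (rule sum_abs)
      also have "\<dots> \<le> (\<Sum>i\<in>J. b * (2 * A * B * F2) * (\<Delta> y i)\<^sup>2)"
        unfolding shift_mean_def by (intro sum_mono mean_kernel_shift b)
      also have "\<dots> = b * (2 * A * B * F2) * S3 y" by (simp add: S3_def sum_distrib_left)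
      also have "(\<Sum>i\<in>J. b * \<Delta> y i * ?s) = b * ?s * S2 y"
        unfolding S2_def sum_distrib_left by (intro sum.cong) auto
      finally have "\<bar>(\<Sum>i\<in>J. shift_mean b x (\<Delta> y i)) - b * ?s * S2 y\<bar> \<le> b * (2 * A * B * F2) * S3 y" .
      moreover have "\<bar>b * ?s * S2 y\<bar> = b * \<bar>?s\<bar> * \<bar>S2 y\<bar>" using b by (simp add: abs_mult)
      ultimately show ?thesis by linarith
    qed
    then have "\<bar>(\<Sum>i\<in>J. shift_mean b x (\<Delta> y i)) / (b * N)\<bar>
        \<le> (b * \<bar>?s\<bar> * \<bar>S2 y\<bar> + b * (2 * A * B * F2) * S3 y) / (b * N)"
      using b N0 by (simp add: abs_divide divide_right_mono)
    also have "\<dots> = \<bar>?s\<bar> / N * \<bar>S2 y\<bar> + 2 * A * B * F2 / N * S3 y"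
      using b N0 by (simp add: field_simps)
    finally have 1: "\<bar>(\<Sum>i\<in>J. shift_mean b x (\<Delta> y i)) / (b * N)\<bar> \<le> \<dots>" .
    have 2: "\<bar>S1 y / (b * N)\<bar> = \<bar>S1 y\<bar> / (b * N)" using b N0 by (simp add: abs_divide)
    have tri: "\<bar>t1 + t2 + t3\<bar> \<le> \<bar>t1\<bar> + \<bar>t2\<bar> + k1 + k2" if "\<bar>t3\<bar> \<le> k1 + k2" for t1 t2 t3 k1 k2 :: real
      using that by linarith
    show ?thesis unfolding eq G_def 2[symmetric] by (rule tri[OF 1])
  qed
  note T' = sample.expectation_abs_le_sqrt[OF mT iT]
  note S1' = sample.expectation_abs_le_sqrt[OF mS1 iS1]
  note S2' = sample.expectation_abs_le_sqrt[OF mS2 iS2]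
  have iG: "integrable sample_law G"
    unfolding G_def[abs_def] using T'(1) S1'(1) S2'(1) iS3 by auto
  have mres: "(\<lambda>y. residual_density b x J (\<Delta> y) y) \<in> borel_measurable sample_law"
    unfolding residual_density_def
  proof (intro borel_measurable_divide borel_measurable_sum)
    fix i assume "i \<in> J"
    note [measurable] = comp[OF this]
    show "(\<lambda>y. K ((y i - \<Delta> y i - x) / b)) \<in> borel_measurable sample_law" by measurable
  qed auto
  show ires: "integrable sample_law (\<lambda>y. \<bar>residual_density b x J (\<Delta> y) y - f x\<bar>)"
    by (rule Bochner_Integration.integrable_bound[OF iG])
       (use mres in measurable, auto intro!: AE_I2 order_trans[OF point])
  have "?lhs \<le> (\<integral>y. G y \<partial>sample_law)"
    by (rule integral_mono[OF ires iG point])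
  also have "\<dots> = (\<integral>y. \<bar>T y\<bar> \<partial>sample_law) + (\<integral>y. \<bar>S1 y\<bar> \<partial>sample_law) / (b * N)
      + \<bar>?s\<bar> / N * (\<integral>y. \<bar>S2 y\<bar> \<partial>sample_law) + 2 * A * B * F2 / N * (\<integral>y. S3 y \<partial>sample_law)"
    unfolding G_def using T'(1) S1'(1) S2'(1) iS3 by simp
  also have "\<dots> \<le> sqrt \<psi> + sqrt (8 * A * F * L\<^sup>2 * E / p) * sqrt (v / (b ^ 3 * n))
      + (2 * A * B * F1 * D * r + D * sqrt (16 * A * F2 * V / p) * sqrt \<psi>) + 2 * A * B * F2 * E * v"
  proof (intro add_mono)
    show "(\<integral>y. \<bar>T y\<bar> \<partial>sample_law) \<le> sqrt \<psi>" using T'(2) unfolding ET .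
    have "(\<integral>y. \<bar>S1 y\<bar> \<partial>sample_law) / (b * N) \<le> sqrt (8 * A * F * L\<^sup>2 / b * (N * (E * v))) / (b * N)"
      using b N0 by (intro divide_right_mono order_trans[OF S1'(2) real_sqrt_le_mono[OF ES1]]) auto
    also have "\<dots> = sqrt (8 * A * F * L\<^sup>2 / b * (N * (E * v)) / (b * N)\<^sup>2)"
      by (rule sqrt_div) (use b N0 in simp)
    also have "8 * A * F * L\<^sup>2 / b * (N * (E * v)) / (b * N)\<^sup>2 = 8 * A * F * L\<^sup>2 * E * v / (b ^ 3 * N)"
      using b N0 by (simp add: power2_eq_square power3_eq_cube)
    also have "sqrt \<dots> \<le> sqrt (8 * A * F * L\<^sup>2 * E * v / (b ^ 3 * (p * n)))"
      using b N0 pn p n0 nonneg E0 v0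
      by (intro real_sqrt_le_mono divide_left_mono mult_left_mono mult_pos_pos mult_nonneg_nonneg) auto
    also have "\<dots> = sqrt (8 * A * F * L\<^sup>2 * E / p) * sqrt (v / (b ^ 3 * n))"
      by (simp add: real_sqrt_mult[symmetric] mult_ac)
    finally show "(\<integral>y. \<bar>S1 y\<bar> \<partial>sample_law) / (b * N)
        \<le> sqrt (8 * A * F * L\<^sup>2 * E / p) * sqrt (v / (b ^ 3 * n))" .
    have "(\<integral>y. \<bar>S2 y\<bar> \<partial>sample_law) \<le> sqrt ((N * (D * r))\<^sup>2 + n * D\<^sup>2 * V)"
      by (rule order_trans[OF S2'(2) real_sqrt_le_mono[OF ES2]])
    also have "\<dots> \<le> sqrt ((N * (D * r))\<^sup>2) + sqrt (n * D\<^sup>2 * V)"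
      by (rule sqrt_add_le_add_sqrt) (use n0 V0 in auto)
    also have "\<dots> = N * (D * r) + D * sqrt (n * V)"
      using N0 nn by (simp add: real_sqrt_mult)
    finally have "\<bar>?s\<bar> / N * (\<integral>y. \<bar>S2 y\<bar> \<partial>sample_law) \<le> \<bar>?s\<bar> / N * (N * (D * r) + D * sqrt (n * V))"
      using N0 by (intro mult_left_mono) auto
    also have "\<dots> = \<bar>?s\<bar> * (D * r) + D * (\<bar>?s\<bar> * sqrt (n * V) / N)"
      using N0 by (simp add: field_simps)
    also have "\<dots> \<le> 2 * A * B * F1 * (D * r) + D * (sqrt (16 * A * F2 * V / p) * sqrt \<psi>)"
    proof (intro add_mono mult_right_mono mult_left_mono slope_le)
      have "\<bar>?s\<bar> * sqrt (n * V) / N = sqrt (?s\<^sup>2 * (n * V) / N\<^sup>2)"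
        using N0 by (simp add: real_sqrt_divide real_sqrt_mult)
      also have "\<dots> \<le> sqrt ((16 * A * F2 * b * N * \<psi>) * (n * V) / N\<^sup>2)"
        using slope_square_le_oracle_mse[OF b(1,2) N0, of x] n0 V0
        by (intro real_sqrt_le_mono divide_right_mono mult_right_mono) (auto simp: \<psi>_def N_def)
      also have "(16 * A * F2 * b * N * \<psi>) * (n * V) / N\<^sup>2 = 16 * A * F2 * V * \<psi> * b * (n / N)"
        using N0 by (simp add: power2_eq_square)
      also have "sqrt \<dots> \<le> sqrt (16 * A * F2 * V * \<psi> * 1 * (1 / p))"
      proof (intro real_sqrt_le_mono mult_mono mult_left_mono)
        show "n / N \<le> 1 / p" using pn p N0 by (simp add: field_simps)
      qed (use b n0 N0 p nonneg V0 \<psi>0 in auto)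
      also have "\<dots> = sqrt (16 * A * F2 * V / p) * sqrt \<psi>"
        by (simp add: real_sqrt_mult[symmetric])
      finally show "\<bar>?s\<bar> * sqrt (n * V) / N \<le> sqrt (16 * A * F2 * V / p) * sqrt \<psi>" .
    qed (use nn in auto)
    finally show "\<bar>?s\<bar> / N * (\<integral>y. \<bar>S2 y\<bar> \<partial>sample_law)
        \<le> 2 * A * B * F1 * D * r + D * sqrt (16 * A * F2 * V / p) * sqrt \<psi>" by (simp add: mult.assoc)
    have "2 * A * B * F2 / N * (\<integral>y. S3 y \<partial>sample_law) \<le> 2 * A * B * F2 / N * (N * (E * v))"
      using N0 nonneg by (intro mult_left_mono ES3) auto
    also have "\<dots> = 2 * A * B * F2 * E * v" using N0 by simp
    finally show "2 * A * B * F2 / N * (\<integral>y. S3 y \<partial>sample_law) \<le> 2 * A * B * F2 * E * v" .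
  qed
  also have "\<dots> \<le> error_bound_const D p * (sqrt \<psi> + sqrt (v / (b ^ 3 * n)) + r + v)"
  proof -
    define c1 c2 c3 c4 where c: "c1 = sqrt (8 * A * F * L\<^sup>2 * E / p)" "c2 = 2 * A * B * F1 * D"
      "c3 = D * sqrt (16 * A * F2 * V / p)" "c4 = 2 * A * B * F2 * E"
    have c0: "0 \<le> c1" "0 \<le> c2" "0 \<le> c3" "0 \<le> c4"
      using nonneg nn E0 V0 p by (auto simp: c)
    have C: "error_bound_const D p = 1 + c1 + c2 + c3 + c4"
      unfolding error_bound_const_def Let_def c E_def V_def variance_errors_def by simp
    define t where "t = sqrt (v / (b ^ 3 * n))"
    have t0: "0 \<le> t" "0 \<le> sqrt \<psi>" using v0 b n0 \<psi>0 by (auto simp: t_def)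
    define k where "k = 1 + c1 + c2 + c3 + c4"
    have k: "1 + c3 \<le> k" "c1 \<le> k" "c2 \<le> k" "c4 \<le> k" using c0 by (simp_all add: k_def)
    have "(1 + c3) * sqrt \<psi> \<le> k * sqrt \<psi>" "c1 * t \<le> k * t" "c2 * r \<le> k * r" "c4 * v \<le> k * v"
      using k t0 nn v0 by (auto intro: mult_right_mono)
    then have "(1 + c3) * sqrt \<psi> + c1 * t + c2 * r + c4 * v
        \<le> k * sqrt \<psi> + k * t + k * r + k * v" by linarith
    then show ?thesis unfolding C k_def[symmetric] c[symmetric] t_def[symmetric] by (simp add: algebra_simps)
  qed
  finally show "?lhs \<le> ?rhs" by (simp only: \<psi>_def v_def n_def)
qed

end

section \<open>Local averages over the design\<close>

lemma integral_bounded_on_cball: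
  fixes G :: "'a::euclidean_space \<Rightarrow> real"
  assumes [measurable]: "G \<in> borel_measurable borel"
    and bnd: "\<And>v. \<bar>G v\<bar> \<le> C" and supp: "\<And>v. G v \<noteq> 0 \<Longrightarrow> norm (v - x) \<le> r" and r: "0 \<le> r"
  shows "integrable lborel G" and "\<bar>LINT v|lborel. G v\<bar> \<le> C * (unit_ball_vol (real DIM('a)) * r ^ DIM('a))"
proof -
  have C0: "0 \<le> C" using bnd[of 0] by linarith
  have fin: "emeasure lborel (cball x r) < \<infinity>"
    using emeasure_bounded_finite[OF bounded_cball] by (simp add: less_top)
  have iI: "integrable lborel (\<lambda>v. C * indicator (cball x r) v)"
    using fin by (intro integrable_mult_right) simp
  have le: "\<bar>G v\<bar> \<le> C * indicator (cball x r) v" for v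
    using bnd[of v] supp[of v] C0 by (cases "G v = 0") (auto simp: indicator_def dist_norm norm_minus_commute)
  show *: "integrable lborel G"
  proof (rule Bochner_Integration.integrable_bound[OF iI _ AE_I2])
    show "norm (G v) \<le> norm (C * indicator (cball x r) v :: real)" for v
      using le[of v] C0 by (simp only: real_norm_def abs_mult abs_of_nonneg abs_indicator)
  qed measurable
  have "\<bar>LINT v|lborel. G v\<bar> \<le> (LINT v|lborel. \<bar>G v\<bar>)" by (rule integral_abs_bound)
  also have "\<dots> \<le> (LINT v|lborel. C * indicator (cball x r) v)"
    by (rule integral_mono[OF integrable_abs[OF *] iI le])
  also have "\<dots> = C * measure lborel (cball x r)" by simp
  also have "measure lborel (cball x r) = unit_ball_vol (real DIM('a)) * r ^ DIM('a)"
    using content_cball[OF r, of x] by simp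
  finally show "\<bar>LINT v|lborel. G v\<bar> \<le> C * (unit_ball_vol (real DIM('a)) * r ^ DIM('a))" .
qed

text \<open>
  A design density \<open>g\<close>, a regression function \<open>m\<close> and a symmetric kernel \<open>W\<close>. All regularity is required
  only within distance \<open>\<rho>\<close> of the inner set \<open>X0\<close>, so that a window centred in \<open>X0\<close> never meets the
  boundary of the support.
\<close>

locale kernel_design =
  fixes g m W :: "real^'d \<Rightarrow> real" and X0 :: "(real^'d) set" and R Bw Lp G0 G1 \<rho> p0 :: real
  assumes g_measurable [measurable]: "g \<in> borel_measurable borel" and g_nonneg: "\<And>u. 0 \<le> g u"
    and g_prob: "prob_space (density lborel (\<lambda>u. ennreal (g u)))"
    and m_measurable [measurable]: "m \<in> borel_measurable borel"
    and W_measurable [measurable]: "W \<in> borel_measurable borel"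
    and X0_sets [measurable]: "X0 \<in> sets borel"
    and W_le: "\<And>z. \<bar>W z\<bar> \<le> Bw" and W_support: "\<And>z. W z \<noteq> 0 \<Longrightarrow> norm z \<le> R"
    and W_even: "\<And>z. W (- z) = W z" and W_mass: "(LINT z|lborel. W z) = 1"
    and g_lower: "\<And>x. x \<in> X0 \<Longrightarrow> G0 \<le> g x"
    and g_upper: "\<And>x h. x \<in> X0 \<Longrightarrow> norm h \<le> \<rho> \<Longrightarrow> g (x + h) \<le> G1"
    and g_lip: "\<And>x h. x \<in> X0 \<Longrightarrow> norm h \<le> \<rho> \<Longrightarrow> \<bar>g (x + h) - g x\<bar> \<le> Lp * norm h"
    and m_lip: "\<And>x h. x \<in> X0 \<Longrightarrow> norm h \<le> \<rho> \<Longrightarrow> \<bar>m (x + h) - m x\<bar> \<le> Lp * norm h"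
    and m_second: "\<And>x h. x \<in> X0 \<Longrightarrow> norm h \<le> \<rho> \<Longrightarrow> \<bar>m (x + h) + m (x - h) - 2 * m x\<bar> \<le> Lp * (norm h)\<^sup>2"
    and pos: "0 < R" "0 < Bw" "0 < Lp" "0 < G0" "0 < G1" "0 < \<rho>" "0 < p0"
    and p0: "p0 \<le> measure (density lborel (\<lambda>u. ennreal (g u))) X0"
begin

abbreviation design_law :: "(real^'d) measure" where
  "design_law \<equiv> density lborel (\<lambda>u. ennreal (g u))"

sublocale design: prob_space design_law by (rule g_prob)

definition ball_volume :: real where
  "ball_volume = unit_ball_vol (real CARD('d)) * R ^ CARD('d)"

lemma ball_volume_pos: "0 < ball_volume"
  using pos by (simp add: ball_volume_def)

lemma integral_design_law:
  "h \<in> borel_measurable borel \<Longrightarrow> (\<integral>u. h u \<partial>design_law) = (LINT u|lborel. g u * h u)" for h :: "real^'d \<Rightarrow> real"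
  by (subst integral_real_density) (auto simp: g_nonneg)

lemma local_integral_le:
  assumes b: "0 < b" and F [measurable]: "F \<in> borel_measurable borel"
    and C: "\<And>u. \<bar>F u\<bar> \<le> C" and supp: "\<And>u. F u \<noteq> 0 \<Longrightarrow> norm (u - x) \<le> R * b \<and> g u \<le> G1"
  shows "\<bar>\<integral>u. F u \<partial>design_law\<bar> \<le> G1 * ball_volume * C * b ^ CARD('d)"
proof -
  have "\<bar>LINT u|lborel. g u * F u\<bar> \<le> (G1 * C) * (unit_ball_vol (real DIM(real^'d)) * (R * b) ^ DIM(real^'d))"
  proof (rule integral_bounded_on_cball(2))
    have "0 \<le> C" using C[of 0] by linarith
    then show "\<bar>g u * F u\<bar> \<le> G1 * C" for u
      using C[of u] supp[of u] g_nonneg[of u] pos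
      by (cases "F u = 0") (auto simp: abs_mult intro!: mult_mono)
  qed (use supp pos b in auto)
  then show ?thesis by (simp add: integral_design_law ball_volume_def power_mult_distrib mult_ac)
qed

lemma local_upper:
  assumes "x \<in> X0" "norm (u - x) \<le> R * b" "R * b \<le> \<rho>"
  shows "g u \<le> G1"
  using g_upper[of x "u - x"] assms by simp

lemma scaled_support:
  assumes "W ((u - x) /\<^sub>R b) \<noteq> 0" "0 < b"
  shows "norm (u - x) \<le> R * b"
proof -
  have "inverse b * norm (u - x) \<le> R"
    using W_support[OF assms(1)] assms(2) unfolding norm_scaleR by simp
  then show ?thesis using assms(2) by (simp add: inverse_eq_divide pos_divide_le_eq)
qed

lemma local_mass_lower:
  assumes x: "x \<in> X0" and b: "0 < b" "R * b \<le> \<rho>" "2 * (Bw * Lp * R * ball_volume) * b \<le> G0"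
  shows "(\<integral>u. W ((u - x) /\<^sub>R b) \<partial>design_law) \<ge> G0 / 2 * b ^ CARD('d)"
proof -
  let ?k = "\<lambda>u. W ((u - x) /\<^sub>R b)"
  have kB: "\<bar>?k u\<bar> \<le> Bw" for u by (rule W_le)
  have ks: "?k u \<noteq> 0 \<Longrightarrow> norm (u - x) \<le> R * b" for u using scaled_support b by blast
  have ik: "integrable lborel ?k"
    by (rule integral_bounded_on_cball(1)[OF _ kB ks]) (use pos b in auto)
  have kI: "(LINT u|lborel. ?k u) = b ^ CARD('d)"
    using lborel_integral_affine[of b ?k x] b W_mass by simp
  have err: "\<bar>?k u * (g u - g x)\<bar> \<le> Bw * (Lp * (R * b))" for u
  proof (cases "?k u = 0")
    case False
    have "\<bar>g (x + (u - x)) - g x\<bar> \<le> Lp * norm (u - x)"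
      by (rule g_lip[OF x]) (use ks[OF False] b in linarith)
    also have "\<dots> \<le> Lp * (R * b)" using ks[OF False] pos by (intro mult_left_mono) auto
    finally have "\<bar>g u - g x\<bar> \<le> Lp * (R * b)" by simp
    then show ?thesis using kB[of u] pos b by (auto simp: abs_mult intro!: mult_mono)
  qed (use pos b in auto)
  note E = integral_bounded_on_cball[of "\<lambda>u. ?k u * (g u - g x)", OF _ err, of x "R * b"]
  have i2: "integrable lborel (\<lambda>u. ?k u * (g u - g x))"
    and e2: "\<bar>LINT u|lborel. ?k u * (g u - g x)\<bar>
        \<le> Bw * (Lp * (R * b)) * (unit_ball_vol (real CARD('d)) * (R * b) ^ CARD('d))"
    using E ks pos b by auto
  have "(\<integral>u. ?k u \<partial>design_law) = (LINT u|lborel. g u * ?k u)"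
    by (rule integral_design_law) measurable
  also have "\<dots> = (LINT u|lborel. g x * ?k u + ?k u * (g u - g x))"
    by (intro Bochner_Integration.integral_cong) (auto simp: algebra_simps)
  also have "\<dots> = g x * b ^ CARD('d) + (LINT u|lborel. ?k u * (g u - g x))"
    using ik i2 kI by simp
  finally have eq: "(\<integral>u. ?k u \<partial>design_law) = g x * b ^ CARD('d) + (LINT u|lborel. ?k u * (g u - g x))" .
  have "Bw * (Lp * (R * b)) * (unit_ball_vol (real CARD('d)) * (R * b) ^ CARD('d))
      = (Bw * Lp * R * ball_volume * b) * b ^ CARD('d)"
    by (simp add: ball_volume_def power_mult_distrib mult_ac)
  also have "\<dots> \<le> G0 / 2 * b ^ CARD('d)" using b by (intro mult_right_mono) auto
  finally have "\<bar>LINT u|lborel. ?k u * (g u - g x)\<bar> \<le> G0 / 2 * b ^ CARD('d)" using e2 by linarith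
  moreover have "G0 * b ^ CARD('d) \<le> g x * b ^ CARD('d)" using g_lower[OF x] b by (intro mult_right_mono) auto
  ultimately show ?thesis unfolding eq by (simp add: abs_le_iff)
qed

definition bias_const :: real where
  "bias_const = Bw * (Lp * R\<^sup>2 * G1 + 2 * Lp * Lp * R\<^sup>2) * ball_volume / 2"

text \<open>
  The integrand is symmetrised: averaging over \<open>z\<close> and \<open>- z\<close> replaces the increment of \<open>m\<close> by a
  second difference and by a product of increments of \<open>m\<close> and \<open>g\<close>, both of order \<open>b\<^sup>2\<close>.
\<close>

lemma local_bias_le:
  assumes x: "x \<in> X0" and b: "0 < b" "R * b \<le> \<rho>"
  shows "\<bar>\<integral>u. W ((u - x) /\<^sub>R b) * (m u - m x) \<partial>design_law\<bar> \<le> bias_const * b ^ (CARD('d) + 2)"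
proof -
  define H where "H z = W z * (m (x + b *\<^sub>R z) - m x) * g (x + b *\<^sub>R z)" for z
  have Hm [measurable]: "H \<in> borel_measurable borel" unfolding H_def[abs_def] by measurable
  have nz: "norm (b *\<^sub>R z) \<le> \<rho>" "norm (b *\<^sub>R z) \<le> R * b" if "W z \<noteq> 0" for z
    using W_support[OF that] b pos by (auto simp: mult.commute[of R] intro: order_trans[OF mult_left_mono])
  have H_le: "\<bar>H z\<bar> \<le> Bw * (Lp * (R * b)) * G1" for z
  proof (cases "W z = 0")
    case False
    have "\<bar>m (x + b *\<^sub>R z) - m x\<bar> \<le> Lp * (R * b)"
      using m_lip[OF x nz(1)[OF False]] nz(2)[OF False] pos
      by (meson mult_left_mono less_imp_le order_trans)
    then show ?thesis unfolding H_def abs_mult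
      using W_le[of z] g_nonneg[of "x + b *\<^sub>R z"] g_upper[OF x nz(1)[OF False]] pos b
      by (intro mult_mono) auto
  qed (use pos b in \<open>auto simp: H_def\<close>)
  have Hs: "H z \<noteq> 0 \<Longrightarrow> norm (z - 0) \<le> R" for z using W_support[of z] by (auto simp: H_def)
  have iH: "integrable lborel H"
    by (rule integral_bounded_on_cball(1)[OF Hm H_le Hs]) (use pos in auto)
  have iH': "integrable lborel (\<lambda>z. H (- z))"
  proof (rule integral_bounded_on_cball(1)[OF _ H_le])
    show "H (- z) \<noteq> 0 \<Longrightarrow> norm (z - 0) \<le> R" for z using Hs[of "- z"] by simp
  qed (use pos in auto)
  have sym: "\<bar>H z + H (- z)\<bar> \<le> Bw * (Lp * (R * b)\<^sup>2 * G1 + Lp * (R * b) * (2 * (Lp * (R * b))))" for z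
  proof (cases "W z = 0")
    case False
    let ?h = "b *\<^sub>R z"
    have n: "norm ?h \<le> \<rho>" "norm ?h \<le> R * b" "norm (- ?h) \<le> \<rho>" using nz[OF False] by auto
    have Lh: "Lp * norm ?h \<le> Lp * (R * b)" using n pos by (intro mult_left_mono) auto
    have "Lp * (norm ?h)\<^sup>2 \<le> Lp * (R * b)\<^sup>2" using n pos by (intro mult_left_mono power_mono) auto
    then have 1: "\<bar>m (x + ?h) + m (x - ?h) - 2 * m x\<bar> \<le> Lp * (R * b)\<^sup>2"
      using m_second[OF x n(1)] by linarith
    have 2: "\<bar>m (x - ?h) - m x\<bar> \<le> Lp * (R * b)"
      using m_lip[OF x n(3)] Lh by simp
    have 3: "\<bar>g (x - ?h) - g (x + ?h)\<bar> \<le> 2 * (Lp * (R * b))"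
    proof -
      have "\<bar>g (x + - ?h) - g x\<bar> \<le> Lp * norm (- ?h)" by (rule g_lip[OF x n(3)])
      moreover have "\<bar>g (x + ?h) - g x\<bar> \<le> Lp * norm ?h" by (rule g_lip[OF x n(1)])
      ultimately show ?thesis using Lh by (simp del: norm_scaleR)
    qed
    have "H z + H (- z) = W z * ((m (x + ?h) + m (x - ?h) - 2 * m x) * g (x + ?h)
        + (m (x - ?h) - m x) * (g (x - ?h) - g (x + ?h)))"
      by (simp add: H_def W_even algebra_simps)
    also have "\<bar>\<dots>\<bar> \<le> Bw * (Lp * (R * b)\<^sup>2 * G1 + Lp * (R * b) * (2 * (Lp * (R * b))))"
      unfolding abs_mult
    proof (intro mult_mono order_trans[OF abs_triangle_ineq] add_mono W_le)
      show "\<bar>(m (x + ?h) + m (x - ?h) - 2 * m x) * g (x + ?h)\<bar> \<le> Lp * (R * b)\<^sup>2 * G1"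
        unfolding abs_mult using 1 g_upper[OF x n(1)] g_nonneg[of "x + ?h"] pos
        by (intro mult_mono) auto
      show "\<bar>(m (x - ?h) - m x) * (g (x - ?h) - g (x + ?h))\<bar> \<le> Lp * (R * b) * (2 * (Lp * (R * b)))"
        unfolding abs_mult using 2 3 pos b by (intro mult_mono) auto
    qed (use pos in auto)
    finally show ?thesis .
  qed (use pos b in \<open>auto simp: H_def W_even\<close>)
  have "(\<integral>u. W ((u - x) /\<^sub>R b) * (m u - m x) \<partial>design_law)
      = (LINT u|lborel. g u * (W ((u - x) /\<^sub>R b) * (m u - m x)))"
    by (rule integral_design_law) measurable
  also have "\<dots> = b ^ CARD('d) * (LINT z|lborel. H z)"
    using lborel_integral_affine[of b "\<lambda>u. g u * (W ((u - x) /\<^sub>R b) * (m u - m x))" x] b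
    by (simp add: H_def mult_ac)
  also have "(LINT z|lborel. H z) = (LINT z|lborel. H z + H (- z)) / 2"
    using iH iH' lborel_integral_reflect[OF Hm] by simp
  finally have eq: "(\<integral>u. W ((u - x) /\<^sub>R b) * (m u - m x) \<partial>design_law)
      = b ^ CARD('d) * ((LINT z|lborel. H z + H (- z)) / 2)" .
  have "\<bar>LINT z|lborel. H z + H (- z)\<bar>
      \<le> Bw * (Lp * (R * b)\<^sup>2 * G1 + Lp * (R * b) * (2 * (Lp * (R * b))))
        * (unit_ball_vol (real DIM(real^'d)) * R ^ DIM(real^'d))"
  proof (rule integral_bounded_on_cball(2)[OF _ sym])
    show "H z + H (- z) \<noteq> 0 \<Longrightarrow> norm (z - 0) \<le> R" for z
      using Hs[of z] Hs[of "- z"] by (cases "H z = 0") auto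
  qed (use pos in auto)
  also have "\<dots> = 2 * (bias_const * b\<^sup>2)"
    by (simp add: bias_const_def ball_volume_def power_mult_distrib) (simp add: power2_eq_square algebra_simps)
  finally have "\<bar>(LINT z|lborel. H z + H (- z)) / 2\<bar> \<le> bias_const * b\<^sup>2" by simp
  then have "\<bar>b ^ CARD('d) * ((LINT z|lborel. H z + H (- z)) / 2)\<bar> \<le> b ^ CARD('d) * (bias_const * b\<^sup>2)"
    using b by (simp add: abs_mult)
  then show ?thesis unfolding eq power_add by (simp only: mult_ac)
qed

end

section \<open>Typical designs\<close>

context kernel_design
begin

lemma local_increment_le:
  assumes x: "x \<in> X0" and b: "0 < b" "R * b \<le> \<rho>"
  shows "\<bar>W ((u - x) /\<^sub>R b) * (m u - m x)\<bar> \<le> Bw * (Lp * (R * b))"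
proof (cases "W ((u - x) /\<^sub>R b) = 0")
  case False
  have n: "norm (u - x) \<le> R * b" by (rule scaled_support[OF False b(1)])
  have "\<bar>m (x + (u - x)) - m x\<bar> \<le> Lp * norm (u - x)" by (rule m_lip[OF x]) (use n b in linarith)
  also have "\<dots> \<le> Lp * (R * b)" using n pos by (intro mult_left_mono) auto
  finally show ?thesis unfolding abs_mult using W_le pos b by (intro mult_mono) auto
qed (use pos b in auto)

text \<open>
  The properties of the design that control the leave-one-out regression estimator: its
  denominators are bounded below, the numerators of its bias are of second order, the squares of
  its weights have small row sums and its weights have bounded column sums, and a positive
  fraction of the observations falls into \<open>X0\<close>.
\<close>

definition good_design :: "real \<Rightarrow> real \<Rightarrow> nat \<Rightarrow> real \<Rightarrow> (nat \<Rightarrow> real^'d) \<Rightarrow> bool" where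
  "good_design c C n b x \<longleftrightarrow>
    (\<forall>i\<in>{1..n}. x i \<in> X0 \<longrightarrow>
      c * (n * b ^ CARD('d)) \<le> (\<Sum>j\<in>{1..n}-{i}. W ((x j - x i) /\<^sub>R b)) \<and>
      \<bar>\<Sum>j\<in>{1..n}-{i}. W ((x j - x i) /\<^sub>R b) * (m (x j) - m (x i))\<bar> \<le> C * (n * b ^ (CARD('d) + 2)) \<and>
      (\<Sum>j\<in>{1..n}-{i}. (W ((x j - x i) /\<^sub>R b))\<^sup>2) \<le> C * (n * b ^ CARD('d))) \<and>
    (\<forall>k\<in>{1..n}. (\<Sum>j\<in>{1..n}-{k}. indicator X0 (x j) * \<bar>W ((x j - x k) /\<^sub>R b)\<bar>) \<le> C * (n * b ^ CARD('d))) \<and>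
    p0 / 2 * n \<le> card {i \<in> {1..n}. x i \<in> X0}"

text \<open>
  Each property is an instance of the exponential bound. The most demanding one is the bias: its
  summands are of size \<open>b\<close> and have to be controlled to within \<open>n * b ^ (d + 2)\<close>, which yields the exponent
  \<open>n * b ^ (d + 2)\<close>. The factor 5 counts the events that involve a union over the sample.
\<close>

lemma good_design_probability:
  obtains c C \<kappa> b' where "0 < c" "0 < C" "0 < \<kappa>" "0 < b'" "b' \<le> 1"
    "\<And>n b. 2 \<le> n \<Longrightarrow> 0 < b \<Longrightarrow> b \<le> b' \<Longrightarrow>
      \<exists>Bad\<in>sets (\<Pi>\<^sub>M i\<in>{1..n}. design_law).
        measure (\<Pi>\<^sub>M i\<in>{1..n}. design_law) Bad
          \<le> 5 * (n * exp (- \<kappa> * (n * b ^ (CARD('d) + 2)))) + exp (- \<kappa> * n) \<and>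
        (\<forall>x\<in>space (\<Pi>\<^sub>M i\<in>{1..n}. design_law) - Bad. good_design c C n b x)"
proof -
  define \<gamma> where "\<gamma> = G1 * ball_volume"
  define H where "H = Bw * (Lp * R)"
  have \<gamma>: "0 < \<gamma>" using pos ball_volume_pos by (simp add: \<gamma>_def)
  have H: "0 < H" using pos by (simp add: H_def)
  have bc: "0 < bias_const" unfolding bias_const_def using pos ball_volume_pos
    by (intro divide_pos_pos mult_pos_pos add_pos_pos) auto
  define k1 where "k1 = tail_rate Bw (\<gamma> * Bw\<^sup>2) (G0 / 8)"
  define k2 where "k2 = tail_rate H (\<gamma> * H\<^sup>2) 1"
  define k4 where "k4 = tail_rate (Bw\<^sup>2) (\<gamma> * (Bw\<^sup>2)\<^sup>2) 1"
  define k5 where "k5 = tail_rate Bw (\<gamma> * Bw\<^sup>2) 1"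
  define k6 where "k6 = tail_rate 1 1 (p0 / 2)"
  note kdefs = k1_def k2_def k4_def k5_def k6_def
  define \<kappa> where "\<kappa> = min k1 (min k2 (min k4 (min k5 k6)))"
  have \<kappa>: "0 < \<kappa>" unfolding \<kappa>_def kdefs using pos \<gamma> H by (simp add: tail_rate_pos)
  have \<kappa>_le: "\<kappa> \<le> k1" "\<kappa> \<le> k2" "\<kappa> \<le> k4" "\<kappa> \<le> k5" "\<kappa> \<le> k6" by (auto simp: \<kappa>_def)
  define C where "C = bias_const + 1 + \<gamma> * Bw\<^sup>2 + \<gamma> * Bw"
  have C: "0 < C" using bc \<gamma> pos by (simp add: C_def add_pos_pos)
  define b' where "b' = min 1 (min (\<rho> / R) (G0 / (2 * (Bw * Lp * R * ball_volume))))"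
  have b': "0 < b'" "b' \<le> 1" using pos ball_volume_pos by (auto simp: b'_def)
  show ?thesis
  proof (rule that[of "G0 / 8" C \<kappa> b'])
    fix n :: nat and b :: real assume n: "2 \<le> n" and b: "0 < b" and bb: "b \<le> b'"
    have b1: "b \<le> 1" using bb b' by linarith
    have "b \<le> \<rho> / R" using bb by (simp add: b'_def)
    then have Rb: "R * b \<le> \<rho>" using pos by (simp add: field_simps)
    have "b \<le> G0 / (2 * (Bw * Lp * R * ball_volume))" using bb by (simp add: b'_def)
    then have Gb: "2 * (Bw * Lp * R * ball_volume) * b \<le> G0"
      using pos ball_volume_pos by (simp add: field_simps)
    interpret iid_sample design_law "{1..n}" by unfold_locales auto
    let ?a = "b ^ CARD('d)" and ?a2 = "b ^ (CARD('d) + 2)"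
    have a0: "0 \<le> ?a" "0 \<le> ?a2" using b by auto
    have a_le: "?a2 \<le> ?a" using b b1 by (intro power_decreasing) auto
    let ?w = "\<lambda>z u. W ((u - z) /\<^sub>R b)"
    have card: "card {1..n} = n" by simp
    have w2: "(?w z u)\<^sup>2 \<le> Bw\<^sup>2" for z u
    proof -
      have "\<bar>?w z u\<bar> \<le> \<bar>Bw\<bar>" using W_le[of "(u - z) /\<^sub>R b"] by linarith
      then show ?thesis by (simp only: abs_le_square_iff)
    qed
    have wsupp: "norm (u - z) \<le> R * b \<and> g u \<le> G1" if "z \<in> X0" "?w z u \<noteq> 0" for z u
      using scaled_support[OF that(2) b] local_upper[OF that(1) _ Rb] by blast
    have g_X0: "g u \<le> G1" if "u \<in> X0" for u using g_upper[OF that, of 0] pos by simp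
    have msq: "(\<integral>u. F u \<partial>design_law) \<le> \<gamma> * D * ?a"
      if "F \<in> borel_measurable borel" "\<And>u. \<bar>F u\<bar> \<le> D" "\<And>u. F u \<noteq> 0 \<Longrightarrow> norm (u - z) \<le> R * b \<and> g u \<le> G1"
      for F D z
      using local_integral_le[OF b that(1), of D z] that(2,3) by (simp add: \<gamma>_def abs_le_iff)
    \<comment> \<open>The event of too small denominators. Below, \<open>n - 1 \<ge> n / 2\<close> leaves \<open>G0 / 4\<close> of the mean mass, and half of
      that remains after a deviation of \<open>G0 / 8\<close>.\<close>
    define E1 where "E1 = {y \<in> space sample_law. \<exists>i\<in>{1..n}. y i \<in> X0 \<and>
      (\<Sum>k\<in>{1..n}-{i}. - ?w (y i) (y k)) \<ge> (real (card {1..n}) - 1) * (- (G0 / 2 * ?a)) + G0 / 8 * (card {1..n} * ?a)}"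
    have E1: "E1 \<in> sets sample_law" "measure sample_law E1 \<le> card {1..n} * exp (- k1 * (card {1..n} * ?a))"
    proof -
      have s: "(\<integral>u. (- ?w z u)\<^sup>2 \<partial>design_law) \<le> \<gamma> * Bw\<^sup>2 * ?a" if "z \<in> X0" for z
        by (rule msq[of _ _ z]) (use w2 wsupp[OF that] in auto)
      have mean: "(\<integral>u. - ?w z u \<partial>design_law) \<le> - (G0 / 2 * ?a)" if "z \<in> X0" for z
        using local_mass_lower[OF that b Rb Gb] by simp
      note * = uniform_local_sum_tail_rate[where h="\<lambda>z u. - ?w z u" and A=X0 and B=Bw
          and s="\<gamma> * Bw\<^sup>2" and a="?a" and m="- (G0 / 2 * ?a)" and t="G0 / 8"]
      show "E1 \<in> sets sample_law" "measure sample_law E1 \<le> card {1..n} * exp (- k1 * (card {1..n} * ?a))"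
        unfolding E1_def k1_def by (rule *; use s mean W_le pos \<gamma> a0 in simp)+
    qed
    \<comment> \<open>The events of too large bias numerators, with \<open>\<sigma> = 1\<close> and \<open>\<sigma> = - 1\<close> for the two signs. The bound \<open>H * b\<close> of
      a summand is squared in the variance, hence the window size \<open>b ^ (d + 2)\<close>.\<close>
    have F: "{y \<in> space sample_law. \<exists>i\<in>{1..n}. y i \<in> X0 \<and> (\<Sum>k\<in>{1..n}-{i}. \<sigma> * (?w (y i) (y k) * (m (y k) - m (y i))))
        \<ge> (real (card {1..n}) - 1) * (bias_const * ?a2) + 1 * (card {1..n} * ?a2)} \<in> sets sample_law" (is ?A)
      "measure sample_law {y \<in> space sample_law. \<exists>i\<in>{1..n}. y i \<in> X0 \<and> (\<Sum>k\<in>{1..n}-{i}. \<sigma> * (?w (y i) (y k) * (m (y k) - m (y i))))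
        \<ge> (real (card {1..n}) - 1) * (bias_const * ?a2) + 1 * (card {1..n} * ?a2)}
        \<le> card {1..n} * exp (- k2 * (card {1..n} * ?a2))" (is ?B) if \<sigma>: "\<bar>\<sigma>\<bar> = 1" for \<sigma>
    proof -
      let ?h = "\<lambda>z u. \<sigma> * (?w z u * (m u - m z))"
      have \<sigma>2: "\<sigma>\<^sup>2 = 1" using \<sigma> by (metis one_power2 power2_abs)
      have hb: "\<bar>?h z u\<bar> \<le> H * b" if "z \<in> X0" for z u
        using local_increment_le[OF that b Rb, of u] \<sigma> by (simp add: abs_mult H_def mult.assoc)
      have hB: "\<bar>?h z u\<bar> \<le> H" if "z \<in> X0" for z u
        using hb[OF that, of u] mult_left_mono[OF b1, of H] H by linarith
      have s: "(\<integral>u. (?h z u)\<^sup>2 \<partial>design_law) \<le> \<gamma> * H\<^sup>2 * ?a2" if z: "z \<in> X0" for z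
      proof -
        have h2: "\<bar>(?h z u)\<^sup>2\<bar> \<le> (H * b)\<^sup>2" for u
        proof -
          have "\<bar>?h z u\<bar> \<le> \<bar>H * b\<bar>" using hb[OF z, of u] by linarith
          then have "(?h z u)\<^sup>2 \<le> (H * b)\<^sup>2" by (simp only: abs_le_square_iff)
          then show ?thesis by simp
        qed
        have "(\<integral>u. (?h z u)\<^sup>2 \<partial>design_law) \<le> \<gamma> * (H * b)\<^sup>2 * ?a"
          by (rule msq[of _ _ z, OF _ h2]) (use wsupp[OF z] in auto)
        then show ?thesis by (simp only: power_mult_distrib power_add mult_ac)
      qed
      have mean: "(\<integral>u. ?h z u \<partial>design_law) \<le> bias_const * ?a2" if "z \<in> X0" for z
        using local_bias_le[OF that b Rb] \<sigma> by (auto simp: abs_if split: if_splits)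
      note * = uniform_local_sum_tail_rate[where h="?h" and A=X0 and B=H
          and s="\<gamma> * H\<^sup>2" and a="?a2" and m="bias_const * ?a2" and t=1]
      show ?A ?B unfolding k2_def by (rule *; use s mean hB H \<gamma> a0 in simp)+
    qed
    define E2 where "E2 = {y \<in> space sample_law. \<exists>i\<in>{1..n}. y i \<in> X0 \<and> (\<Sum>k\<in>{1..n}-{i}. 1 * (?w (y i) (y k) * (m (y k) - m (y i))))
        \<ge> (real (card {1..n}) - 1) * (bias_const * ?a2) + 1 * (card {1..n} * ?a2)}"
    define E3 where "E3 = {y \<in> space sample_law. \<exists>i\<in>{1..n}. y i \<in> X0 \<and> (\<Sum>k\<in>{1..n}-{i}. -1 * (?w (y i) (y k) * (m (y k) - m (y i))))
        \<ge> (real (card {1..n}) - 1) * (bias_const * ?a2) + 1 * (card {1..n} * ?a2)}"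
    have E2: "E2 \<in> sets sample_law" "measure sample_law E2 \<le> card {1..n} * exp (- k2 * (card {1..n} * ?a2))"
      unfolding E2_def by (rule F; simp)+
    have E3: "E3 \<in> sets sample_law" "measure sample_law E3 \<le> card {1..n} * exp (- k2 * (card {1..n} * ?a2))"
      unfolding E3_def by (rule F; simp)+
    define E4 where "E4 = {y \<in> space sample_law. \<exists>i\<in>{1..n}. y i \<in> X0 \<and> (\<Sum>k\<in>{1..n}-{i}. (?w (y i) (y k))\<^sup>2)
        \<ge> (real (card {1..n}) - 1) * (\<gamma> * Bw\<^sup>2 * ?a) + 1 * (card {1..n} * ?a)}"
    have E4: "E4 \<in> sets sample_law" "measure sample_law E4 \<le> card {1..n} * exp (- k4 * (card {1..n} * ?a))"
    proof -
      have s: "(\<integral>u. ((?w z u)\<^sup>2)\<^sup>2 \<partial>design_law) \<le> \<gamma> * (Bw\<^sup>2)\<^sup>2 * ?a" if "z \<in> X0" for z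
      proof (rule msq[of _ _ z])
        show "\<bar>((?w z u)\<^sup>2)\<^sup>2\<bar> \<le> (Bw\<^sup>2)\<^sup>2" for u
          using power_mono[OF w2[of u z] zero_le_power2, of 2] by simp
      qed (use wsupp[OF that] in auto)
      have mean: "(\<integral>u. (?w z u)\<^sup>2 \<partial>design_law) \<le> \<gamma> * Bw\<^sup>2 * ?a" if "z \<in> X0" for z
        by (rule msq[of _ _ z]) (use w2 wsupp[OF that] in auto)
      note * = uniform_local_sum_tail_rate[where h="\<lambda>z u. (?w z u)\<^sup>2" and A=X0 and B="Bw\<^sup>2"
          and s="\<gamma> * (Bw\<^sup>2)\<^sup>2" and a="?a" and m="\<gamma> * Bw\<^sup>2 * ?a" and t=1]
      show "E4 \<in> sets sample_law" "measure sample_law E4 \<le> card {1..n} * exp (- k4 * (card {1..n} * ?a))"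
        unfolding E4_def k4_def by (rule *; use s mean w2 pos \<gamma> a0 in simp)+
    qed
    \<comment> \<open>The centre may lie anywhere, but only points of \<open>X0\<close> contribute, and
      there the density is bounded.\<close>
    define E5 where "E5 = {y \<in> space sample_law. \<exists>i\<in>{1..n}. y i \<in> UNIV \<and> (\<Sum>k\<in>{1..n}-{i}. indicator X0 (y k) * \<bar>?w (y i) (y k)\<bar>)
        \<ge> (real (card {1..n}) - 1) * (\<gamma> * Bw * ?a) + 1 * (card {1..n} * ?a)}"
    have E5: "E5 \<in> sets sample_law" "measure sample_law E5 \<le> card {1..n} * exp (- k5 * (card {1..n} * ?a))"
    proof -
      let ?h = "\<lambda>z u. indicator X0 u * \<bar>?w z u\<bar>"
      have hB: "\<bar>?h z u\<bar> \<le> Bw" for z u using W_le pos by (auto simp: indicator_def)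
      have h2: "\<bar>(?h z u)\<^sup>2\<bar> \<le> Bw\<^sup>2" for z u using w2 by (auto simp: indicator_def)
      have supp: "norm (u - z) \<le> R * b \<and> g u \<le> G1" if "?h z u \<noteq> 0" for z u
        using that scaled_support[OF _ b] g_X0[of u] by (auto simp: indicator_def split: if_splits)
      have s: "(\<integral>u. (?h z u)\<^sup>2 \<partial>design_law) \<le> \<gamma> * Bw\<^sup>2 * ?a" for z
        by (rule msq[of _ _ z, OF _ h2]) (measurable, use supp in auto)
      have mean: "(\<integral>u. ?h z u \<partial>design_law) \<le> \<gamma> * Bw * ?a" for z
        by (rule msq[of _ _ z, OF _ hB supp]) measurable
      note * = uniform_local_sum_tail_rate[where h="?h" and A=UNIV and B=Bw
          and s="\<gamma> * Bw\<^sup>2" and a="?a" and m="\<gamma> * Bw * ?a" and t=1]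
      show "E5 \<in> sets sample_law" "measure sample_law E5 \<le> card {1..n} * exp (- k5 * (card {1..n} * ?a))"
        unfolding E5_def k5_def by (rule *; use s mean hB pos \<gamma> a0 in simp)+
    qed
    let ?p = "measure design_law X0"
    define E6 where "E6 = {y \<in> space sample_law. (\<Sum>k\<in>{1..n}. - indicator X0 (y k) - (\<integral>u. - indicator X0 u \<partial>design_law)) \<ge> p0 / 2 * (1 * real n)}"
    have E6: "E6 \<in> sets sample_law" "measure sample_law E6 \<le> exp (- k6 * n)"
    proof -
      let ?lam = "min (1 / 1) (p0 / 2 / (2 * 1)) :: real"
      have p2: "0 < p0 / 2" using pos by simp
      note rate = exponent_le_tail_rate[OF zero_less_one zero_less_one p2, of "real n", OF of_nat_0_le_iff]
      have "?lam > 0" "?lam * 1 \<le> 1" by (rule rate)+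
      have e: "- ?lam * (p0 / 2 * real n) + ?lam\<^sup>2 * (real n * 1) \<le> - tail_rate 1 1 (p0 / 2) * real n"
        by (rule rate)
      have "(\<integral>u. (- indicator X0 u :: real)\<^sup>2 \<partial>design_law) \<le> (1::real)"
      proof -
        have "(\<integral>u. (- indicator X0 u :: real)\<^sup>2 \<partial>design_law) = (\<integral>u. indicator X0 u \<partial>design_law)"
          by (intro Bochner_Integration.integral_cong) (auto simp: indicator_def)
        also have "\<dots> = ?p" by simp
        finally show ?thesis by simp
      qed
      then have "measure sample_law E6 \<le> exp (- ?lam * (p0 / 2 * (1 * real n)) + ?lam\<^sup>2 * card {1..n} * 1)"
        unfolding E6_def using \<open>?lam > 0\<close> \<open>?lam * 1 \<le> 1\<close>
        by (intro exponential_tail_bound[where B=1]) (auto simp: indicator_def)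
      also have "\<dots> \<le> exp (- k6 * n)" using e by (simp add: k6_def)
      finally show "measure sample_law E6 \<le> exp (- k6 * n)" .
      show "E6 \<in> sets sample_law" unfolding E6_def by measurable
    qed
    let ?q = "exp (- \<kappa> * (n * ?a2))"
    have q: "card {1..n} * exp (- k * (card {1..n} * a)) \<le> n * ?q" if "\<kappa> \<le> k" "?a2 \<le> a" for k a :: real
    proof -
      have "\<kappa> * (n * ?a2) \<le> k * (n * a)"
        using that \<kappa> a0 by (intro mult_mono mult_left_mono) auto
      then show ?thesis by (simp add: mult_left_mono)
    qed
    let ?Bad = "E1 \<union> E2 \<union> E3 \<union> E4 \<union> E5 \<union> E6"
    have Bad: "?Bad \<in> sets sample_law" using E1 E2 E3 E4 E5 E6 by auto
    have "measure sample_law ?Bad \<le> measure sample_law E1 + measure sample_law E2 + measure sample_law E3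
        + measure sample_law E4 + measure sample_law E5 + measure sample_law E6"
      using E1(1) E2(1) E3(1) E4(1) E5(1) E6(1)
      by (intro order_trans[OF measure_Un_le] add_mono order_refl) auto
    also have "\<dots> \<le> n * ?q + n * ?q + n * ?q + n * ?q + n * ?q + exp (- \<kappa> * n)"
    proof (intro add_mono)
      show "measure sample_law E1 \<le> n * ?q" by (rule order_trans[OF E1(2) q[OF \<kappa>_le(1) a_le]])
      show "measure sample_law E2 \<le> n * ?q" by (rule order_trans[OF E2(2) q[OF \<kappa>_le(2) order_refl]])
      show "measure sample_law E3 \<le> n * ?q" by (rule order_trans[OF E3(2) q[OF \<kappa>_le(2) order_refl]])
      show "measure sample_law E4 \<le> n * ?q" by (rule order_trans[OF E4(2) q[OF \<kappa>_le(3) a_le]])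
      show "measure sample_law E5 \<le> n * ?q" by (rule order_trans[OF E5(2) q[OF \<kappa>_le(4) a_le]])
      show "measure sample_law E6 \<le> exp (- \<kappa> * n)"
        by (rule order_trans[OF E6(2)]) (use \<kappa>_le(5) in \<open>simp add: mult_right_mono\<close>)
    qed
    finally have P: "measure sample_law ?Bad \<le> 5 * (n * ?q) + exp (- \<kappa> * n)" by simp
    have good: "good_design (G0 / 8) C n b x" if x: "x \<in> space sample_law - ?Bad" for x
    proof -
      have xs: "x \<in> space sample_law" and nE: "x \<notin> E1" "x \<notin> E2" "x \<notin> E3" "x \<notin> E4" "x \<notin> E5" "x \<notin> E6"
        using x by auto
      have C_ge: "(real n - 1) * (k * a) + 1 * (n * a) \<le> C * (n * a)" if "0 \<le> a" "0 \<le> k" "k + 1 \<le> C" for k a :: real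
      proof -
        have "(real n - 1) * (k * a) \<le> n * (k * a)" using that by (intro mult_right_mono) auto
        moreover have "(k + 1) * (n * a) \<le> C * (n * a)" using that by (intro mult_right_mono) auto
        ultimately show ?thesis by (simp add: algebra_simps)
      qed
      have Cs: "bias_const + 1 \<le> C" "\<gamma> * Bw\<^sup>2 + 1 \<le> C" "\<gamma> * Bw + 1 \<le> C"
        using bc \<gamma> pos by (auto simp: C_def)
      have 1: "G0 / 8 * (n * ?a) \<le> (\<Sum>j\<in>{1..n}-{i}. ?w (x i) (x j))" if "i \<in> {1..n}" "x i \<in> X0" for i
      proof -
        have "(\<Sum>k\<in>{1..n}-{i}. - ?w (x i) (x k)) < (real n - 1) * (- (G0 / 2 * ?a)) + G0 / 8 * (n * ?a)"
          using nE(1) xs that unfolding E1_def by (auto simp: not_le)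
        moreover have "(real n / 2) * (G0 / 2 * ?a) \<le> (real n - 1) * (G0 / 2 * ?a)"
          using n pos a0 by (intro mult_right_mono) auto
        ultimately show ?thesis by (simp add: sum_negf algebra_simps)
      qed
      have 2: "\<bar>\<Sum>j\<in>{1..n}-{i}. ?w (x i) (x j) * (m (x j) - m (x i))\<bar> \<le> C * (n * ?a2)"
        if "i \<in> {1..n}" "x i \<in> X0" for i
      proof -
        have "(\<Sum>k\<in>{1..n}-{i}. 1 * (?w (x i) (x k) * (m (x k) - m (x i)))) < (real n - 1) * (bias_const * ?a2) + 1 * (n * ?a2)"
          using nE(2) xs that unfolding E2_def by (auto simp: not_le)
        moreover have "(\<Sum>k\<in>{1..n}-{i}. -1 * (?w (x i) (x k) * (m (x k) - m (x i)))) < (real n - 1) * (bias_const * ?a2) + 1 * (n * ?a2)"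
          using nE(3) xs that unfolding E3_def by (auto simp: not_le)
        ultimately show ?thesis using C_ge[OF a0(2) less_imp_le[OF bc] Cs(1)] by (simp add: sum_negf abs_le_iff)
      qed
      have 3: "(\<Sum>j\<in>{1..n}-{i}. (?w (x i) (x j))\<^sup>2) \<le> C * (n * ?a)" if "i \<in> {1..n}" "x i \<in> X0" for i
      proof -
        have "(\<Sum>k\<in>{1..n}-{i}. (?w (x i) (x k))\<^sup>2) < (real n - 1) * (\<gamma> * Bw\<^sup>2 * ?a) + 1 * (n * ?a)"
          using nE(4) xs that unfolding E4_def by (auto simp: not_le)
        then show ?thesis using C_ge[OF a0(1) _ Cs(2)] \<gamma> by (simp add: mult.assoc)
      qed
      have 4: "(\<Sum>j\<in>{1..n}-{k}. indicator X0 (x j) * \<bar>?w (x k) (x j)\<bar>) \<le> C * (n * ?a)" if "k \<in> {1..n}" for k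
      proof -
        have "(\<Sum>j\<in>{1..n}-{k}. indicator X0 (x j) * \<bar>?w (x k) (x j)\<bar>) < (real n - 1) * (\<gamma> * Bw * ?a) + 1 * (n * ?a)"
          using nE(5) xs that unfolding E5_def by (auto simp: not_le)
        then show ?thesis using C_ge[OF a0(1) _ Cs(3)] \<gamma> pos by (simp add: mult.assoc)
      qed
      have 5: "p0 / 2 * n \<le> card {i \<in> {1..n}. x i \<in> X0}"
      proof -
        have s: "(\<Sum>k\<in>{1..n}. indicator X0 (x k)) = real (card {i \<in> {1..n}. x i \<in> X0})"
          by (simp add: indicator_def sum.If_cases Int_def)
        have "(\<Sum>k\<in>{1..n}. - indicator X0 (x k) - (\<integral>u. - indicator X0 u \<partial>design_law)) < p0 / 2 * (1 * real n)"
          using nE(6) xs unfolding E6_def by (auto simp: not_le)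
        also have "(\<Sum>k\<in>{1..n}. - indicator X0 (x k) - (\<integral>u. - indicator X0 u \<partial>design_law))
            = n * ?p - (\<Sum>k\<in>{1..n}. indicator X0 (x k))"
          by (simp add: sum_subtractf sum.distrib sum_negf del: One_nat_def)
        finally have "n * ?p - real (card {i \<in> {1..n}. x i \<in> X0}) < p0 / 2 * n"
          unfolding s by (simp del: One_nat_def)
        moreover have "n * p0 \<le> n * ?p" using p0 by (intro mult_left_mono) auto
        ultimately show ?thesis by (simp add: algebra_simps)
      qed
      show ?thesis unfolding good_design_def using 1 2 3 4 5 by blast
    qed
    show "\<exists>Bad\<in>sets sample_law. measure sample_law Bad \<le> 5 * (n * ?q) + exp (- \<kappa> * n) \<and>
        (\<forall>x\<in>space sample_law - Bad. good_design (G0 / 8) C n b x)"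
      using Bad P good by blast
  qed (use pos C \<kappa> b' in auto)
qed

end

section \<open>The two-step estimator on a typical design\<close>

lemma sum_indicator_mult:
  fixes k :: "'i \<Rightarrow> real"
  assumes fin: "finite A"
  shows "(\<Sum>i\<in>A. indicator S (x i) * k i) = (\<Sum>i\<in>{i\<in>A. x i \<in> S}. k i)"
proof -
  have "(\<Sum>i\<in>{i\<in>A. x i \<in> S}. k i) = (\<Sum>i\<in>A. if x i \<in> S then k i else 0)"
    by (rule sum.inter_filter[OF fin])
  also have "\<dots> = (\<Sum>i\<in>A. indicator S (x i) * k i)"
    by (rule sum.cong) (auto simp: indicator_def)
  finally show ?thesis ..
qed

lemma sum_indicator_card:
  "finite A \<Longrightarrow> (\<Sum>i\<in>A. indicator S (x i)) = real (card {i\<in>A. x i \<in> S})"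
  using sum_indicator_mult[of A S x "\<lambda>_. 1"] by simp

locale two_step_model =
  reg: kernel_regression f f' f'' K A B L F F1 F2 +
  des: kernel_design g m W X0 R Bw Lp G0 G1 \<rho> p0
  for f f' f'' K :: "real \<Rightarrow> real" and A B L F F1 F2 :: real
    and g m W :: "real^'d \<Rightarrow> real" and X0 :: "(real^'d) set" and R Bw Lp G0 G1 \<rho> p0 :: real
begin

definition selected :: "nat \<Rightarrow> (nat \<Rightarrow> real^'d) \<Rightarrow> nat set" where
  "selected n x = {i\<in>{1..n}. x i \<in> X0}"

text \<open>
  The estimators are evaluated on the product space of designs and errors, in which the responses
  are \<open>m (x i) + y i\<close>. There, conditioning on the design means fixing the first component.
\<close>

definition feasible :: "nat \<Rightarrow> real \<Rightarrow> real \<Rightarrow> real \<Rightarrow> (nat \<Rightarrow> real^'d) \<Rightarrow> (nat \<Rightarrow> real) \<Rightarrow> real" where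
  "feasible n b0 b1 e x y =
    f_feasible W K b0 b1 X0 (\<lambda>i p. fst p i) (\<lambda>i p. m (fst p i) + snd p i) n e (x, y)"

definition unfeasible :: "nat \<Rightarrow> real \<Rightarrow> real \<Rightarrow> (nat \<Rightarrow> real^'d) \<Rightarrow> (nat \<Rightarrow> real) \<Rightarrow> real" where
  "unfeasible n b1 e x y =
    f_unfeasible K b1 X0 m (\<lambda>i p. fst p i) (\<lambda>i p. m (fst p i) + snd p i) n e (x, y)"

lemma unfeasible_eq: "unfeasible n b1 e x y = reg.oracle_density b1 e (selected n x) y"
  by (simp add: unfeasible_def f_unfeasible_def kernel_density_def reg_error_def
      reg.oracle_density_def selected_def sum_indicator_mult sum_indicator_card)

definition denom :: "nat \<Rightarrow> real \<Rightarrow> (nat \<Rightarrow> real^'d) \<Rightarrow> nat \<Rightarrow> real" where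
  "denom n b0 x i = (\<Sum>j\<in>{1..n}-{i}. W ((x j - x i) /\<^sub>R b0))"

definition weight :: "nat \<Rightarrow> real \<Rightarrow> (nat \<Rightarrow> real^'d) \<Rightarrow> nat \<Rightarrow> nat \<Rightarrow> real" where
  "weight n b0 x i k = (if k = i then 0 else W ((x k - x i) /\<^sub>R b0) / denom n b0 x i)"

definition bias :: "nat \<Rightarrow> real \<Rightarrow> (nat \<Rightarrow> real^'d) \<Rightarrow> nat \<Rightarrow> real" where
  "bias n b0 x i = (\<Sum>j\<in>{1..n}-{i}. W ((x j - x i) /\<^sub>R b0) * (m (x j) - m (x i))) / denom n b0 x i"

lemma feasible_eq:
  assumes D: "\<And>i. i \<in> selected n x \<Longrightarrow> denom n b0 x i \<noteq> 0"
  shows "feasible n b0 b1 e x y = reg.residual_density b1 e (selected n x)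
    (\<lambda>i. bias n b0 x i + (\<Sum>k\<in>{1..n}. weight n b0 x i k * y k)) y"
proof -
  have "m_loo W b0 (\<lambda>i p. fst p i) (\<lambda>i p. m (fst p i) + snd p i) n i (x, y)
      = m (x i) + (bias n b0 x i + (\<Sum>k\<in>{1..n}. weight n b0 x i k * y k))"
    if i: "i \<in> selected n x" for i
  proof -
    let ?D = "denom n b0 x i" and ?w = "\<lambda>j. W ((x j - x i) /\<^sub>R b0)"
    have "(\<Sum>k\<in>{1..n}. weight n b0 x i k * y k) = (\<Sum>k\<in>{1..n}-{i}. weight n b0 x i k * y k)"
      by (rule sum.mono_neutral_right) (auto simp: weight_def)
    also have "\<dots> = (\<Sum>k\<in>{1..n}-{i}. ?w k * y k) / ?D"
      by (simp add: weight_def sum_divide_distrib)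
    finally have s: "(\<Sum>k\<in>{1..n}. weight n b0 x i k * y k) = (\<Sum>k\<in>{1..n}-{i}. ?w k * y k) / ?D" .
    have "(\<Sum>j\<in>{1..n}-{i}. (m (x j) + y j) * ?w j)
        = (\<Sum>j\<in>{1..n}-{i}. m (x i) * ?w j + ?w j * (m (x j) - m (x i)) + ?w j * y j)"
      by (intro sum.cong) (auto simp: algebra_simps)
    also have "\<dots> = m (x i) * ?D + (\<Sum>j\<in>{1..n}-{i}. ?w j * (m (x j) - m (x i))) + (\<Sum>k\<in>{1..n}-{i}. ?w k * y k)"
      unfolding sum.distrib by (simp only: denom_def sum_distrib_left)
    finally have num: "(\<Sum>j\<in>{1..n}-{i}. (m (x j) + y j) * ?w j)
        = m (x i) * ?D + (\<Sum>j\<in>{1..n}-{i}. ?w j * (m (x j) - m (x i))) + (\<Sum>k\<in>{1..n}-{i}. ?w k * y k)" .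
    have "m_loo W b0 (\<lambda>i p. fst p i) (\<lambda>i p. m (fst p i) + snd p i) n i (x, y)
        = (\<Sum>j\<in>{1..n}-{i}. (m (x j) + y j) * ?w j) / ?D"
      by (simp only: m_loo_def fst_conv snd_conv denom_def)
    then show ?thesis unfolding num bias_def s using D[OF i] by (simp add: add_divide_distrib)
  qed
  then have "(\<Sum>i\<in>selected n x. K ((m (x i) + y i - m_loo W b0 (\<lambda>i p. fst p i) (\<lambda>i p. m (fst p i) + snd p i) n i (x, y) - e) / b1))
     = (\<Sum>i\<in>selected n x. K ((y i - (bias n b0 x i + (\<Sum>k\<in>{1..n}. weight n b0 x i k * y k)) - e) / b1))"
    by (intro sum.cong refl) simp
  then show ?thesis
    by (simp add: feasible_def f_feasible_def kernel_density_def est_error_def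
      reg.residual_density_def sum_indicator_mult sum_indicator_card selected_def
      del: One_nat_def)
qed

abbreviation error_sample :: "nat \<Rightarrow> (nat \<Rightarrow> real) measure" where
  "error_sample n \<equiv> \<Pi>\<^sub>M i\<in>{1..n}. reg.error_law"

definition cond_mse :: "nat \<Rightarrow> real \<Rightarrow> real \<Rightarrow> (nat \<Rightarrow> real^'d) \<Rightarrow> real" where
  "cond_mse n b1 e x = (\<integral>y. (unfeasible n b1 e x y - f e)\<^sup>2 \<partial>error_sample n)"

lemma cond_mse_eq:
  "selected n x \<noteq> {} \<Longrightarrow> 0 < b1 \<Longrightarrow> cond_mse n b1 e x = reg.oracle_mse b1 e (card (selected n x))"
  unfolding cond_mse_def unfeasible_eq
  by (rule reg.oracle_mse_eq(1)) (auto simp: selected_def)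

text \<open>
  The variance contribution \<open>q / (n * h1 ^ 3)\<close>, with \<open>q = 1 / (n * h0 ^ d)\<close>, is exactly
  \<open>h0 ^ d / h1 ^ 3 * q\<^sup>2\<close> and hence part of the second summand of the rate; the other contributions
  are dominated by \<open>h0 ^ 4\<close>, since \<open>n * h0 ^ (d + 2) \<ge> 1\<close> means that \<open>q \<le> h0\<^sup>2\<close>.
\<close>

lemma rate_terms_le:
  assumes h: "0 < h0" "h0 \<le> 1" "0 < h1" and n: "0 < n"
    and nh0: "1 \<le> real n * h0 ^ (d + 2)" and nh1: "1 \<le> real n * h1 ^ 3" and \<psi>: "0 \<le> \<psi>"
  shows "sqrt \<psi> + sqrt (((h0\<^sup>2)\<^sup>2 + 1 / (n * h0 ^ d)) / (h1 ^ 3 * n)) + h0\<^sup>2 + ((h0\<^sup>2)\<^sup>2 + 1 / (n * h0 ^ d))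
    \<le> 5 * sqrt (\<psi> + R_rate d n h0 h1)"
proof -
  define q where "q = 1 / (real n * h0 ^ d)"
  have nr: "0 < real n" using n by simp
  have q0: "0 < q" using h nr by (simp add: q_def)
  have h04: "(h0\<^sup>2)\<^sup>2 = h0 ^ 4" by (simp add: power_mult[symmetric])
  have "(sqrt (h0 ^ d / h1 ^ 3))\<^sup>2 * q\<^sup>2 \<le> (1 / sqrt (n * h1 ^ 5) + sqrt (h0 ^ d / h1 ^ 3))\<^sup>2 * (h0 ^ 4 + q)\<^sup>2"
    using h q0 by (intro mult_mono power_mono) auto
  moreover have "0 \<le> (1 / h1 + sqrt (h0 ^ d / h1 ^ 7))\<^sup>2 * (h0 ^ 4 + q) ^ 3" using h q0 by auto
  moreover have "(sqrt (h0 ^ d / h1 ^ 3))\<^sup>2 = h0 ^ d / h1 ^ 3" using h by simp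
  ultimately have R: "h0 ^ 4 + h0 ^ d / h1 ^ 3 * q\<^sup>2 \<le> R_rate d n h0 h1"
    unfolding R_rate_def q_def[symmetric] by (simp add: mult.commute)
  have pos2: "0 \<le> h0 ^ d / h1 ^ 3 * q\<^sup>2" using h by simp
  have R4: "h0 ^ 4 \<le> R_rate d n h0 h1" using R pos2 by linarith
  let ?s = "sqrt (\<psi> + R_rate d n h0 h1)"
  have 1: "sqrt \<psi> \<le> ?s" using R4 h by (intro real_sqrt_le_mono) (simp add: order_trans[OF _ R4])
  have 2: "sqrt ((h0 ^ 4 + q) / (h1 ^ 3 * n)) \<le> ?s"
  proof (intro real_sqrt_le_mono)
    have "(h0 ^ 4 + q) / (h1 ^ 3 * n) = h0 ^ 4 / (n * h1 ^ 3) + h0 ^ d / h1 ^ 3 * q\<^sup>2"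
      using h nr by (simp add: q_def power2_eq_square field_simps)
    moreover have "h0 ^ 4 / (n * h1 ^ 3) \<le> h0 ^ 4 / 1"
      using nh1 h by (intro divide_left_mono) auto
    ultimately show "(h0 ^ 4 + q) / (h1 ^ 3 * n) \<le> \<psi> + R_rate d n h0 h1"
      using R \<psi> by linarith
  qed
  have 3: "h0\<^sup>2 \<le> ?s"
    using R4 \<psi> by (intro real_le_rsqrt) (simp add: h04)
  have 4: "h0 ^ 4 \<le> h0\<^sup>2" using h by (intro power_decreasing) auto
  have "1 \<le> h0\<^sup>2 * (n * h0 ^ d)" using nh0 by (simp only: power_add mult_ac)
  then have 5: "q \<le> h0\<^sup>2" using h nr by (simp add: q_def pos_divide_le_eq)
  show ?thesis unfolding h04 q_def[symmetric] using 1 2 3 4 5 by linarith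
qed

lemma selected_good_design:
  assumes good: "des.good_design c C n b0 x"
  shows "p0 / 2 * n \<le> card (selected n x)" and "0 < n \<Longrightarrow> selected n x \<noteq> {}"
proof -
  show card: "p0 / 2 * n \<le> card (selected n x)" using good by (simp add: des.good_design_def selected_def)
  assume n: "0 < n"
  show "selected n x \<noteq> {}"
  proof
    assume "selected n x = {}"
    then have "p0 / 2 * n \<le> 0" using card by simp
    moreover have "0 < p0 / 2 * n" using des.pos n by simp
    ultimately show False by linarith
  qed
qed

text \<open>
  On a good design the leave-one-out weights satisfy the hypotheses of the fixed-design bound with
  \<open>r = b0\<^sup>2\<close> and \<open>q = 1 / (n * b0 ^ d)\<close>. The evenness of the kernel turns column sums of weights into
  local sums centred at the other observation.
\<close>

lemma feasible_error_good_design: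
  assumes c: "0 < c" "0 < C" and good: "des.good_design c C n b0 x" and n: "0 < n"
    and b0: "0 < b0" "b0 \<le> 1" and b1: "0 < b1" "4 * A * F * b1 \<le> 1" "b1 \<le> 1"
    and nb0: "1 \<le> real n * b0 ^ (CARD('d) + 2)" and nb1: "1 \<le> real n * b1 ^ 3"
  shows "(\<integral>y. \<bar>feasible n b0 b1 e x y - f e\<bar> \<partial>error_sample n)
      \<le> reg.error_bound_const (C / c + C / c\<^sup>2) (p0 / 2)
          * (5 * sqrt (cond_mse n b1 e x + R_rate CARD('d) n b0 b1))"
    and "integrable (error_sample n) (\<lambda>y. \<bar>feasible n b0 b1 e x y - f e\<bar>)"
proof -
  let ?J = "selected n x" and ?D = "C / c + C / c\<^sup>2" and ?q = "1 / (n * b0 ^ CARD('d))"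
  let ?a = "n * b0 ^ CARD('d)"
  have nr: "0 < real n" using n by simp
  have a: "0 < ?a" using nr b0 by simp
  have D: "0 \<le> ?D" "C / c \<le> ?D" "C / c\<^sup>2 \<le> ?D" using c by auto
  note card = selected_good_design(1)[OF good] and ne = selected_good_design(2)[OF good n]
  have J: "i \<in> {1..n}" "x i \<in> X0" if "i \<in> ?J" for i using that by (auto simp: selected_def)
  have dl: "c * ?a \<le> denom n b0 x i" if "i \<in> ?J" for i
    using good J[OF that] by (simp add: des.good_design_def denom_def)
  have ca: "0 < c * ?a" using c a by simp
  have dp: "0 < denom n b0 x i" if "i \<in> ?J" for i using dl[OF that] ca by linarith
  have bias_le: "\<bar>bias n b0 x i\<bar> \<le> ?D * b0\<^sup>2" if i: "i \<in> ?J" for i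
  proof -
    have "\<bar>\<Sum>j\<in>{1..n}-{i}. W ((x j - x i) /\<^sub>R b0) * (m (x j) - m (x i))\<bar> \<le> C * (n * b0 ^ (CARD('d) + 2))"
      using good J[OF i] by (simp add: des.good_design_def)
    then have "\<bar>bias n b0 x i\<bar> \<le> C * (n * b0 ^ (CARD('d) + 2)) / (c * ?a)"
      unfolding bias_def abs_divide using dl[OF i] dp[OF i] ca by (intro frac_le) auto
    also have "\<dots> = C / c * b0\<^sup>2" using a nr b0 by (simp add: power_add power2_eq_square)
    also have "\<dots> \<le> ?D * b0\<^sup>2" using D by (intro mult_right_mono) auto
    finally show ?thesis .
  qed
  have rows: "(\<Sum>k\<in>{1..n}. (weight n b0 x i k)\<^sup>2) \<le> ?D * ?q" if i: "i \<in> ?J" for i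
  proof -
    have "(\<Sum>k\<in>{1..n}. (weight n b0 x i k)\<^sup>2) = (\<Sum>k\<in>{1..n}-{i}. (weight n b0 x i k)\<^sup>2)"
      by (rule sum.mono_neutral_right) (auto simp: weight_def)
    also have "\<dots> = (\<Sum>k\<in>{1..n}-{i}. (W ((x k - x i) /\<^sub>R b0))\<^sup>2) / (denom n b0 x i)\<^sup>2"
      by (simp add: weight_def sum_divide_distrib power_divide)
    also have "\<dots> \<le> C * ?a / (c * ?a)\<^sup>2"
    proof (rule frac_le)
      show "(\<Sum>k\<in>{1..n}-{i}. (W ((x k - x i) /\<^sub>R b0))\<^sup>2) \<le> C * ?a"
        using good J[OF i] unfolding des.good_design_def by blast
      show "(c * ?a)\<^sup>2 \<le> (denom n b0 x i)\<^sup>2"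
        using dl[OF i] ca by (intro power_mono) auto
      show "0 \<le> C * ?a" using c a by auto
      show "0 < (c * ?a)\<^sup>2" using ca by (rule zero_less_power)
    qed
    also have "\<dots> = C / c\<^sup>2 * ?q" using a c nr b0 by (simp add: power2_eq_square field_simps)
    also have "\<dots> \<le> ?D * ?q" using D a by (intro mult_right_mono) auto
    finally show ?thesis .
  qed
  have columns: "(\<Sum>i\<in>?J. \<bar>weight n b0 x i k\<bar>) \<le> ?D" if k: "k \<in> {1..n}" for k
  proof -
    let ?w = "\<lambda>j. \<bar>W ((x j - x k) /\<^sub>R b0)\<bar>"
    have fin: "finite ?J" by (simp add: selected_def)
    have "(\<Sum>i\<in>?J. \<bar>weight n b0 x i k\<bar>) = (\<Sum>i\<in>?J-{k}. \<bar>weight n b0 x i k\<bar>)"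
      using fin by (intro sum.mono_neutral_right) (auto simp: weight_def)
    also have "\<dots> \<le> (\<Sum>i\<in>?J-{k}. ?w i / (c * ?a))"
    proof (rule sum_mono)
      fix i assume i: "i \<in> ?J - {k}"
      have "W ((x k - x i) /\<^sub>R b0) = W ((x i - x k) /\<^sub>R b0)"
        using des.W_even[of "(x i - x k) /\<^sub>R b0"] by (simp add: scaleR_minus_right[symmetric] del: scaleR_minus_right)
      then show "\<bar>weight n b0 x i k\<bar> \<le> ?w i / (c * ?a)"
        using i dl[of i] dp[of i] ca by (auto simp: weight_def abs_divide intro!: divide_left_mono)
    qed
    also have "\<dots> = (\<Sum>i\<in>?J-{k}. ?w i) / (c * ?a)" by (simp add: sum_divide_distrib)
    also have "(\<Sum>i\<in>?J-{k}. ?w i) = (\<Sum>j\<in>{1..n}-{k}. indicator X0 (x j) * ?w j)"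
      by (subst sum_indicator_mult) (auto simp: selected_def intro!: sum.cong)
    also have "\<dots> / (c * ?a) \<le> C * ?a / (c * ?a)"
      using good k ca by (intro divide_right_mono) (auto simp: des.good_design_def)
    also have "\<dots> = C / c" using a nr b0 by simp
    finally show ?thesis using D by linarith
  qed
  have feas: "feasible n b0 b1 e x y = reg.residual_density b1 e ?J
      (\<lambda>i. bias n b0 x i + (\<Sum>k\<in>{1..n}. weight n b0 x i k * y k)) y" for y
    by (rule feasible_eq) (use dp in fastforce)
  have J_sub: "?J \<subseteq> {1..n}" by (auto simp: selected_def)
  have pp: "0 < p0 / 2" "p0 / 2 * real (card {1..n}) \<le> real (card ?J)" using des.pos card by simp_all
  have b02: "0 \<le> b0\<^sup>2" "0 \<le> ?q" using a by auto
  have w0: "weight n b0 x i i = 0" for i by (simp add: weight_def)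
  note err = reg.residual_density_error[OF _ J_sub ne b1 w0 bias_le rows columns pp D(1) b02, where x=e]
  show "integrable (error_sample n) (\<lambda>y. \<bar>feasible n b0 b1 e x y - f e\<bar>)"
    unfolding feas by (rule err(2)) simp
  have "(\<integral>y. \<bar>feasible n b0 b1 e x y - f e\<bar> \<partial>error_sample n)
      \<le> reg.error_bound_const ?D (p0 / 2) * (sqrt (cond_mse n b1 e x)
        + sqrt (((b0\<^sup>2)\<^sup>2 + ?q) / (b1 ^ 3 * n)) + b0\<^sup>2 + ((b0\<^sup>2)\<^sup>2 + ?q))"
    unfolding feas cond_mse_eq[OF ne b1(1)] using err(1) by simp
  also have "\<dots> \<le> reg.error_bound_const ?D (p0 / 2) * (5 * sqrt (cond_mse n b1 e x + R_rate CARD('d) n b0 b1))"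
  proof (rule mult_left_mono[OF rate_terms_le])
    show "0 \<le> cond_mse n b1 e x" unfolding cond_mse_def by simp
    show "0 \<le> reg.error_bound_const ?D (p0 / 2)" by (rule reg.error_bound_const_nonneg) (use D pp in auto)
  qed (use b0 b1 n nb0 nb1 in auto)
  finally show "(\<integral>y. \<bar>feasible n b0 b1 e x y - f e\<bar> \<partial>error_sample n)
      \<le> reg.error_bound_const ?D (p0 / 2) * (5 * sqrt (cond_mse n b1 e x + R_rate CARD('d) n b0 b1))" .
qed

lemma cond_mse_le:
  assumes card: "p0 / 2 * n \<le> card (selected n x)" and ne: "selected n x \<noteq> {}" and b1: "0 < b1" and n: "0 < n"
  shows "cond_mse n b1 e x
    \<le> ((2 * A * B * (F2 * A\<^sup>2))\<^sup>2 + 4 * A * B * (B * F) / p0) * (b1 ^ 4 + 1 / (n * b1))"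
proof -
  let ?k1 = "(2 * A * B * (F2 * A\<^sup>2))\<^sup>2" and ?k2 = "4 * A * B * (B * F) / p0"
  have N: "0 < real (card (selected n x))" using ne by (simp add: card_gt_0_iff selected_def)
  have k: "0 \<le> ?k1" "0 \<le> ?k2" using reg.constants_nonneg reg.pos des.pos by auto
  have "cond_mse n b1 e x \<le> ?k1 * b1 ^ 4 + 2 * A * B * (B * F) / (b1 * card (selected n x))"
    unfolding cond_mse_eq[OF ne b1] by (rule reg.oracle_mse_le[OF b1 N])
  also have "2 * A * B * (B * F) / (b1 * card (selected n x)) \<le> 2 * A * B * (B * F) / (b1 * (p0 / 2 * n))"
    using card N b1 n reg.constants_nonneg reg.pos des.pos by (intro divide_left_mono mult_left_mono mult_pos_pos) auto
  also have "\<dots> = ?k2 * (1 / (n * b1))" using des.pos b1 n by (simp add: field_simps)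
  also have "?k1 * b1 ^ 4 + ?k2 * (1 / (n * b1)) \<le> (?k1 + ?k2) * (b1 ^ 4 + 1 / (n * b1))"
  proof -
    have gen: "k1 * p + k2 * q \<le> (k1 + k2) * (p + q)" if "0 \<le> k1" "0 \<le> k2" "0 \<le> p" "0 \<le> q" for k1 k2 p q :: real
      using that by (simp add: algebra_simps)
    show ?thesis by (rule gen) (use k b1 in auto)
  qed
  finally show ?thesis by simp
qed

end

section \<open>Independent pairs and conditioning on the design\<close>

context prob_space
begin

text \<open>
  Independence of the pairs from each other and of the two components within each pair makes the vector of
  all first components independent of the vector of all second components. It suffices to verify
  this on boxes, which form intersection-stable generators.
\<close>

lemma law_of_independent_pairs:
  fixes U :: "'i \<Rightarrow> 'a \<Rightarrow> 'b" and V :: "'i \<Rightarrow> 'a \<Rightarrow> 'c"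
  assumes indep: "indep_vars (\<lambda>_. S \<Otimes>\<^sub>M T) (\<lambda>i \<omega>. (U i \<omega>, V i \<omega>)) I" and I: "finite I" "I \<noteq> {}"
    and pair: "\<And>i A B. i \<in> I \<Longrightarrow> A \<in> sets S \<Longrightarrow> B \<in> sets T \<Longrightarrow>
      prob {\<omega> \<in> space M. U i \<omega> \<in> A \<and> V i \<omega> \<in> B} = prob {\<omega> \<in> space M. U i \<omega> \<in> A} * prob {\<omega> \<in> space M. V i \<omega> \<in> B}"
    and law: "\<And>i. i \<in> I \<Longrightarrow> distr M S (U i) = P" "\<And>i. i \<in> I \<Longrightarrow> distr M T (V i) = Q"
  shows "distr M (PiM I (\<lambda>_. S) \<Otimes>\<^sub>M PiM I (\<lambda>_. T)) (\<lambda>\<omega>. (\<lambda>i\<in>I. U i \<omega>, \<lambda>i\<in>I. V i \<omega>))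
    = PiM I (\<lambda>_. P) \<Otimes>\<^sub>M PiM I (\<lambda>_. Q)"
proof -
  let ?S = "PiM I (\<lambda>_. S)" and ?T = "PiM I (\<lambda>_. T)"
  let ?x = "\<lambda>\<omega>. \<lambda>i\<in>I. U i \<omega>" and ?y = "\<lambda>\<omega>. \<lambda>i\<in>I. V i \<omega>"
  have UV: "(\<lambda>\<omega>. (U i \<omega>, V i \<omega>)) \<in> measurable M (S \<Otimes>\<^sub>M T)" if "i \<in> I" for i
    using indep that by (auto simp: indep_vars_def)
  have U: "U i \<in> measurable M S" and V: "V i \<in> measurable M T" if "i \<in> I" for i
    using measurable_compose[OF UV[OF that] measurable_fst] measurable_compose[OF UV[OF that] measurable_snd] by simp_all
  have x: "?x \<in> measurable M ?S" and y: "?y \<in> measurable M ?T"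
    using U V by (auto intro!: measurable_restrict)
  have iU: "indep_vars (\<lambda>_. S) U I" and iV: "indep_vars (\<lambda>_. T) V I"
    using indep_vars_compose2[OF indep, of "\<lambda>_. fst" "\<lambda>_. S"] indep_vars_compose2[OF indep, of "\<lambda>_. snd" "\<lambda>_. T"] by simp_all
  have dx: "distr M ?S ?x = PiM I (\<lambda>_. P)"
    using indep_vars_iff_distr_eq_PiM'[where M'="\<lambda>_. S" and X=U, OF I(2)] U iU law(1) by (simp cong: PiM_cong)
  have dy: "distr M ?T ?y = PiM I (\<lambda>_. Q)"
    using indep_vars_iff_distr_eq_PiM'[where M'="\<lambda>_. T" and X=V, OF I(2)] V iV law(2) by (simp cong: PiM_cong)
  define GS where "GS = {?x -` (Pi\<^sub>E I A) \<inter> space M | A. \<forall>i\<in>I. A i \<in> sets S}"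
  define GT where "GT = {?y -` (Pi\<^sub>E I B) \<inter> space M | B. \<forall>i\<in>I. B i \<in> sets T}"
  have vx: "?x -` (Pi\<^sub>E I A) \<inter> space M = {\<omega> \<in> space M. \<forall>i\<in>I. U i \<omega> \<in> A i}" for A by (auto simp: PiE_iff)
  have vy: "?y -` (Pi\<^sub>E I B) \<inter> space M = {\<omega> \<in> space M. \<forall>i\<in>I. V i \<omega> \<in> B i}" for B by (auto simp: PiE_iff)
  have box: "prob {\<omega> \<in> space M. \<forall>i\<in>I. U i \<omega> \<in> A i \<and> V i \<omega> \<in> B i}
      = (\<Prod>i\<in>I. prob {\<omega> \<in> space M. U i \<omega> \<in> A i} * prob {\<omega> \<in> space M. V i \<omega> \<in> B i})"
    if A: "\<forall>i\<in>I. A i \<in> sets S" and B: "\<forall>i\<in>I. B i \<in> sets T" for A B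
  proof -
    have "prob (\<Inter>i\<in>I. (\<lambda>\<omega>. (U i \<omega>, V i \<omega>)) -` (A i \<times> B i) \<inter> space M)
        = (\<Prod>i\<in>I. prob ((\<lambda>\<omega>. (U i \<omega>, V i \<omega>)) -` (A i \<times> B i) \<inter> space M))"
      using A B by (intro indep_varsD_finite[OF indep I(2,1)]) auto
    also have "(\<Inter>i\<in>I. (\<lambda>\<omega>. (U i \<omega>, V i \<omega>)) -` (A i \<times> B i) \<inter> space M) = {\<omega> \<in> space M. \<forall>i\<in>I. U i \<omega> \<in> A i \<and> V i \<omega> \<in> B i}"
      using I by auto
    also have "(\<Prod>i\<in>I. prob ((\<lambda>\<omega>. (U i \<omega>, V i \<omega>)) -` (A i \<times> B i) \<inter> space M))
        = (\<Prod>i\<in>I. prob {\<omega> \<in> space M. U i \<omega> \<in> A i} * prob {\<omega> \<in> space M. V i \<omega> \<in> B i})"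
    proof (rule prod.cong[OF refl])
      fix i assume i: "i \<in> I"
      have "(\<lambda>\<omega>. (U i \<omega>, V i \<omega>)) -` (A i \<times> B i) \<inter> space M = {\<omega> \<in> space M. U i \<omega> \<in> A i \<and> V i \<omega> \<in> B i}" by auto
      then show "prob ((\<lambda>\<omega>. (U i \<omega>, V i \<omega>)) -` (A i \<times> B i) \<inter> space M)
          = prob {\<omega> \<in> space M. U i \<omega> \<in> A i} * prob {\<omega> \<in> space M. V i \<omega> \<in> B i}"
        using pair[OF i] A B i by simp
    qed
    finally show ?thesis .
  qed
  have sp: "{\<omega> \<in> space M. V i \<omega> \<in> space T} = space M" "{\<omega> \<in> space M. U i \<omega> \<in> space S} = space M" if "i \<in> I" for i
    using measurable_space[OF U[OF that]] measurable_space[OF V[OF that]] by auto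
  have boxU: "prob {\<omega> \<in> space M. \<forall>i\<in>I. U i \<omega> \<in> A i} = (\<Prod>i\<in>I. prob {\<omega> \<in> space M. U i \<omega> \<in> A i})"
    if A: "\<forall>i\<in>I. A i \<in> sets S" for A
  proof -
    have "{\<omega> \<in> space M. \<forall>i\<in>I. U i \<omega> \<in> A i} = {\<omega> \<in> space M. \<forall>i\<in>I. U i \<omega> \<in> A i \<and> V i \<omega> \<in> space T}"
      using sp(1) by blast
    then show ?thesis using box[OF A, of "\<lambda>_. space T"] sp(1) by (simp add: prob_space)
  qed
  have boxV: "prob {\<omega> \<in> space M. \<forall>i\<in>I. V i \<omega> \<in> B i} = (\<Prod>i\<in>I. prob {\<omega> \<in> space M. V i \<omega> \<in> B i})"
    if B: "\<forall>i\<in>I. B i \<in> sets T" for B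
  proof -
    have "{\<omega> \<in> space M. \<forall>i\<in>I. V i \<omega> \<in> B i} = {\<omega> \<in> space M. \<forall>i\<in>I. U i \<omega> \<in> space S \<and> V i \<omega> \<in> B i}"
      using sp(2) by blast
    then show ?thesis using box[of "\<lambda>_. space S", OF _ B] sp(2) by (simp add: prob_space)
  qed
  have GS_ev: "GS \<subseteq> events" and GT_ev: "GT \<subseteq> events"
    using I x y by (auto simp: GS_def GT_def intro!: measurable_sets[OF x] measurable_sets[OF y] sets_PiM_I_finite)
  have "indep_set GS GT"
    unfolding indep_sets2_eq
  proof (intro conjI ballI GS_ev GT_ev)
    fix a b assume "a \<in> GS" "b \<in> GT"
    then obtain A B where A: "\<forall>i\<in>I. A i \<in> sets S" "a = {\<omega> \<in> space M. \<forall>i\<in>I. U i \<omega> \<in> A i}"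
      and B: "\<forall>i\<in>I. B i \<in> sets T" "b = {\<omega> \<in> space M. \<forall>i\<in>I. V i \<omega> \<in> B i}"
      unfolding GS_def GT_def vx vy by blast
    have "a \<inter> b = {\<omega> \<in> space M. \<forall>i\<in>I. U i \<omega> \<in> A i \<and> V i \<omega> \<in> B i}" unfolding A(2) B(2) by auto
    then show "prob (a \<inter> b) = prob a * prob b"
      using box[OF A(1) B(1)] boxU[OF A(1)] boxV[OF B(1)] by (simp add: A(2) B(2) prod.distrib)
  qed
  moreover have "Int_stable GS"
  proof (rule Int_stableI)
    fix a b assume "a \<in> GS" "b \<in> GS"
    then obtain A A' where A: "\<forall>i\<in>I. A i \<in> sets S" "a = ?x -` (Pi\<^sub>E I A) \<inter> space M"
      and A': "\<forall>i\<in>I. A' i \<in> sets S" "b = ?x -` (Pi\<^sub>E I A') \<inter> space M" unfolding GS_def by blast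
    have "a \<inter> b = ?x -` (Pi\<^sub>E I (\<lambda>i. A i \<inter> A' i)) \<inter> space M" unfolding A(2) A'(2) by (auto simp: PiE_iff)
    then show "a \<inter> b \<in> GS" unfolding GS_def using A(1) A'(1) by blast
  qed
  moreover have "Int_stable GT"
  proof (rule Int_stableI)
    fix a b assume "a \<in> GT" "b \<in> GT"
    then obtain A A' where A: "\<forall>i\<in>I. A i \<in> sets T" "a = ?y -` (Pi\<^sub>E I A) \<inter> space M"
      and A': "\<forall>i\<in>I. A' i \<in> sets T" "b = ?y -` (Pi\<^sub>E I A') \<inter> space M" unfolding GT_def by blast
    have "a \<inter> b = ?y -` (Pi\<^sub>E I (\<lambda>i. A i \<inter> A' i)) \<inter> space M" unfolding A(2) A'(2) by (auto simp: PiE_iff)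
    then show "a \<inter> b \<in> GT" unfolding GT_def using A(1) A'(1) by blast
  qed
  ultimately have ind: "indep_set (sigma_sets (space M) GS) (sigma_sets (space M) GT)"
    by (rule indep_set_sigma_sets)
  have gen: "z -` A \<inter> space M \<in> sigma_sets (space M) {z -` (Pi\<^sub>E I B) \<inter> space M | B. \<forall>i\<in>I. B i \<in> sets N}"
    if z: "z \<in> measurable M (PiM I (\<lambda>_. N))" and A: "A \<in> sets (PiM I (\<lambda>_. N))" for z :: "'a \<Rightarrow> 'i \<Rightarrow> 'd" and A N
  proof -
    have "{z -` A \<inter> space M | A. A \<in> sets (PiM I (\<lambda>_. N))}
        = sigma_sets (space M) {z -` A \<inter> space M | A. A \<in> prod_algebra I (\<lambda>_. N)}"
      unfolding sets_PiM using measurable_space[OF z] by (intro sigma_sets_vimage_commute) (auto simp: space_PiM)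
    moreover have "{z -` A \<inter> space M | A. A \<in> prod_algebra I (\<lambda>_. N)}
        = {z -` (Pi\<^sub>E I B) \<inter> space M | B. \<forall>i\<in>I. B i \<in> sets N}"
      unfolding prod_algebra_eq_finite[OF I(1)] by (auto simp: Pi_iff)
    ultimately have eq: "{z -` A \<inter> space M | A. A \<in> sets (PiM I (\<lambda>_. N))}
        = sigma_sets (space M) {z -` (Pi\<^sub>E I B) \<inter> space M | B. \<forall>i\<in>I. B i \<in> sets N}"
      by (simp only:)
    show ?thesis unfolding eq[symmetric] using A by (intro CollectI exI[of _ A]) simp
  qed
  interpret P: prob_space "PiM I (\<lambda>_. P)" unfolding dx[symmetric] by (rule prob_space_distr[OF x])
  interpret Q: prob_space "PiM I (\<lambda>_. Q)" unfolding dy[symmetric] by (rule prob_space_distr[OF y])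
  have sets_P: "sets (PiM I (\<lambda>_. P)) = sets ?S" unfolding dx[symmetric] by simp
  have sets_Q: "sets (PiM I (\<lambda>_. Q)) = sets ?T" unfolding dy[symmetric] by simp
  have xy: "(\<lambda>\<omega>. (?x \<omega>, ?y \<omega>)) \<in> measurable M (?S \<Otimes>\<^sub>M ?T)" using x y by (rule measurable_Pair)
  show ?thesis
  proof (rule pair_measure_eqI[symmetric])
    show "sigma_finite_measure (PiM I (\<lambda>_. P))" "sigma_finite_measure (PiM I (\<lambda>_. Q))" by unfold_locales
    show "sets (PiM I (\<lambda>_. P) \<Otimes>\<^sub>M PiM I (\<lambda>_. Q)) = sets (distr M (?S \<Otimes>\<^sub>M ?T) (\<lambda>\<omega>. (?x \<omega>, ?y \<omega>)))"
      using sets_pair_measure_cong[OF sets_P sets_Q] by simp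
    fix A B assume A: "A \<in> sets (PiM I (\<lambda>_. P))" and B: "B \<in> sets (PiM I (\<lambda>_. Q))"
    have A': "A \<in> sets ?S" and B': "B \<in> sets ?T" using A B sets_P sets_Q by auto
    have "prob (?x -` A \<inter> space M \<inter> (?y -` B \<inter> space M)) = prob (?x -` A \<inter> space M) * prob (?y -` B \<inter> space M)"
      by (rule indep_setD[OF ind]) (use gen[OF x A'] gen[OF y B'] in \<open>auto simp: GS_def GT_def\<close>)
    moreover have "(\<lambda>\<omega>. (?x \<omega>, ?y \<omega>)) -` (A \<times> B) \<inter> space M = ?x -` A \<inter> space M \<inter> (?y -` B \<inter> space M)" by auto
    ultimately show "emeasure (PiM I (\<lambda>_. P)) A * emeasure (PiM I (\<lambda>_. Q)) B
        = emeasure (distr M (?S \<Otimes>\<^sub>M ?T) (\<lambda>\<omega>. (?x \<omega>, ?y \<omega>))) (A \<times> B)"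
      unfolding dx[symmetric] dy[symmetric] using A' B' x y xy
      by (simp add: emeasure_distr emeasure_eq_measure ennreal_mult)
  qed
qed

text \<open>
  Conditioning on one of two independent variables amounts to integrating out the other one.
\<close>

lemma real_cond_exp_product_law:
  fixes \<phi> :: "'b \<times> 'c \<Rightarrow> real"
  assumes x: "x \<in> measurable M S" and y: "y \<in> measurable M T"
    and law: "distr M (S \<Otimes>\<^sub>M T) (\<lambda>\<omega>. (x \<omega>, y \<omega>)) = P \<Otimes>\<^sub>M Q"
    and P: "prob_space P" "sets P = sets S" and Q: "prob_space Q" "sets Q = sets T"
    and \<phi>: "\<phi> \<in> borel_measurable (S \<Otimes>\<^sub>M T)" and bnd: "\<And>p. \<bar>\<phi> p\<bar> \<le> b"
  shows "AE \<omega> in M. real_cond_exp M (vimage_algebra (space M) x S) (\<lambda>\<omega>. \<phi> (x \<omega>, y \<omega>)) \<omega>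
    = (\<integral>v. \<phi> (x \<omega>, v) \<partial>Q)"
proof -
  let ?F = "vimage_algebra (space M) x S"
  let ?\<psi> = "\<lambda>u. \<integral>v. \<phi> (u, v) \<partial>Q"
  interpret P: prob_space P by fact
  interpret Q: prob_space Q by fact
  interpret PQ: pair_prob_space P Q ..
  have xsp: "x \<in> space M \<rightarrow> space S" using measurable_space[OF x] by auto
  have sub: "subalgebra M ?F"
    unfolding subalgebra_def using measurable_sets[OF x] by (auto simp: sets_vimage_algebra2[OF xsp])
  interpret finite_measure_subalgebra M ?F by unfold_locales (rule sub)
  have sPQ: "sets (P \<Otimes>\<^sub>M Q) = sets (S \<Otimes>\<^sub>M T)" by (rule sets_pair_measure_cong[OF P(2) Q(2)])
  have \<phi>': "\<phi> \<in> borel_measurable (P \<Otimes>\<^sub>M Q)" using \<phi> measurable_cong_sets[OF sPQ refl] by blast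
  have \<psi>_P: "?\<psi> \<in> borel_measurable P"
    by (rule Q.borel_measurable_lebesgue_integral) (use \<phi>' in simp)
  then have \<psi>: "?\<psi> \<in> borel_measurable S" using measurable_cong_sets[OF P(2) refl] by blast
  have xy: "(\<lambda>\<omega>. (x \<omega>, y \<omega>)) \<in> measurable M (S \<Otimes>\<^sub>M T)" using x y by (rule measurable_Pair)
  have int\<phi>: "integrable (P \<Otimes>\<^sub>M Q) \<phi>"
    by (rule PQ.integrable_const_bound[where B=b]) (use bnd \<phi>' in auto)
  have \<psi>b: "\<bar>?\<psi> u\<bar> \<le> b" for u
  proof (cases "integrable Q (\<lambda>v. \<phi> (u, v))")
    case True
    have "\<bar>?\<psi> u\<bar> \<le> (\<integral>v. \<bar>\<phi> (u, v)\<bar> \<partial>Q)" by (rule integral_abs_bound)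
    also have "\<dots> \<le> (\<integral>v. b \<partial>Q)" by (intro integral_mono) (use True bnd in auto)
    finally show ?thesis by (simp add: Q.prob_space)
  next
    case False
    then show ?thesis using bnd[of undefined] by (simp add: not_integrable_integral_eq)
  qed
  show ?thesis
  proof (rule real_cond_exp_charact)
    show "(\<lambda>\<omega>. ?\<psi> (x \<omega>)) \<in> borel_measurable ?F"
      by (rule measurable_compose[OF measurable_vimage_algebra1[OF xsp] \<psi>])
    show "integrable M (\<lambda>\<omega>. \<phi> (x \<omega>, y \<omega>))"
      by (rule integrable_const_bound[where B=b]) (use bnd measurable_compose[OF xy \<phi>] in auto)
    show "integrable M (\<lambda>\<omega>. ?\<psi> (x \<omega>))"
      by (rule integrable_const_bound[where B=b]) (use \<psi>b measurable_compose[OF x \<psi>] in auto)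
    fix A assume "A \<in> sets ?F"
    then obtain B where B: "B \<in> sets S" "A = x -` B \<inter> space M" by (auto simp: sets_vimage_algebra2[OF xsp])
    have BP: "B \<in> sets P" using B P by simp
    have m1: "(\<lambda>p. indicator B (fst p) * \<phi> p) \<in> borel_measurable (S \<Otimes>\<^sub>M T)"
      using \<phi> B(1) by measurable
    have m2: "(\<lambda>p. indicator B (fst p) * ?\<psi> (fst p)) \<in> borel_measurable (S \<Otimes>\<^sub>M T)"
      using measurable_compose[OF measurable_fst \<psi>, of T] B(1) by measurable
    have i1: "integrable (P \<Otimes>\<^sub>M Q) (\<lambda>p. indicator B (fst p) * \<phi> p)"
      by (rule Bochner_Integration.integrable_bound[OF int\<phi>])
         (use m1 measurable_cong_sets[OF sPQ refl] in \<open>auto simp: indicator_def\<close>)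
    have i2: "integrable (P \<Otimes>\<^sub>M Q) (\<lambda>p. indicator B (fst p) * ?\<psi> (fst p))"
    proof (rule PQ.integrable_const_bound[where B=b])
      have "0 \<le> b" using bnd[of undefined] by linarith
      then show "AE p in P \<Otimes>\<^sub>M Q. norm (indicator B (fst p) * ?\<psi> (fst p)) \<le> b"
        using \<psi>b by (auto simp: indicator_def)
      show "(\<lambda>p. indicator B (fst p) * ?\<psi> (fst p)) \<in> borel_measurable (P \<Otimes>\<^sub>M Q)"
        using m2 measurable_cong_sets[OF sPQ refl] by blast
    qed
    have "(\<integral>\<omega>\<in>A. \<phi> (x \<omega>, y \<omega>) \<partial>M) = (\<integral>\<omega>. indicator B (x \<omega>) * \<phi> (x \<omega>, y \<omega>) \<partial>M)"
      unfolding set_lebesgue_integral_def B(2)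
      by (intro Bochner_Integration.integral_cong) (auto simp: indicator_def)
    also have "\<dots> = (\<integral>p. indicator B (fst p) * \<phi> p \<partial>distr M (S \<Otimes>\<^sub>M T) (\<lambda>\<omega>. (x \<omega>, y \<omega>)))"
      by (subst integral_distr[OF xy m1]) simp
    also have "\<dots> = (\<integral>u. (\<integral>v. indicator B u * \<phi> (u, v) \<partial>Q) \<partial>P)"
      unfolding law using PQ.integral_fst'[OF i1] by simp
    also have "\<dots> = (\<integral>u. (\<integral>v. indicator B u * ?\<psi> u \<partial>Q) \<partial>P)"
      by (simp add: Q.prob_space)
    also have "\<dots> = (\<integral>p. indicator B (fst p) * ?\<psi> (fst p) \<partial>distr M (S \<Otimes>\<^sub>M T) (\<lambda>\<omega>. (x \<omega>, y \<omega>)))"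
      unfolding law using PQ.integral_fst'[OF i2] by simp
    also have "\<dots> = (\<integral>\<omega>. indicator B (x \<omega>) * ?\<psi> (x \<omega>) \<partial>M)"
      by (subst integral_distr[OF xy m2]) simp
    also have "\<dots> = (\<integral>\<omega>\<in>A. ?\<psi> (x \<omega>) \<partial>M)"
      unfolding set_lebesgue_integral_def B(2)
      by (intro Bochner_Integration.integral_cong) (auto simp: indicator_def)
    finally show "(\<integral>\<omega>\<in>A. \<phi> (x \<omega>, y \<omega>) \<partial>M) = (\<integral>\<omega>\<in>A. ?\<psi> (x \<omega>) \<partial>M)" .
  qed
qed

lemma prob_le_of_product_law:
  assumes xy: "(\<lambda>\<omega>. (x \<omega>, y \<omega>)) \<in> measurable M (S \<Otimes>\<^sub>M T)"
    and law: "distr M (S \<Otimes>\<^sub>M T) (\<lambda>\<omega>. (x \<omega>, y \<omega>)) = P \<Otimes>\<^sub>M Q"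
    and P: "prob_space P" and Q: "prob_space Q"
    and E: "E \<in> sets (P \<Otimes>\<^sub>M Q)" and Bad: "Bad \<in> sets P" and \<eta>: "0 \<le> \<eta>"
    and good: "\<And>u. u \<in> space P - Bad \<Longrightarrow> measure Q (Pair u -` E) \<le> \<eta>"
  shows "prob {\<omega> \<in> space M. (x \<omega>, y \<omega>) \<in> E} \<le> measure P Bad + \<eta>"
proof -
  interpret P: prob_space P by fact
  interpret Q: prob_space Q by fact
  interpret PQ: pair_prob_space P Q ..
  have sPQ: "sets (P \<Otimes>\<^sub>M Q) = sets (S \<Otimes>\<^sub>M T)" unfolding law[symmetric] by simp
  have "emeasure M {\<omega> \<in> space M. (x \<omega>, y \<omega>) \<in> E} = emeasure M ((\<lambda>\<omega>. (x \<omega>, y \<omega>)) -` E \<inter> space M)"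
    by (rule arg_cong[where f="emeasure M"]) auto
  also have "\<dots> = emeasure (P \<Otimes>\<^sub>M Q) E"
    unfolding law[symmetric] using E sPQ by (subst emeasure_distr[OF xy]) auto
  also have "\<dots> = (\<integral>\<^sup>+u. emeasure Q (Pair u -` E) \<partial>P)"
    by (rule Q.emeasure_pair_measure_alt[OF E])
  also have "\<dots> \<le> (\<integral>\<^sup>+u. indicator Bad u + ennreal \<eta> \<partial>P)"
  proof (rule nn_integral_mono)
    fix u assume u: "u \<in> space P"
    show "emeasure Q (Pair u -` E) \<le> indicator Bad u + ennreal \<eta>"
    proof (cases "u \<in> Bad")
      case True
      have "emeasure Q (Pair u -` E) \<le> 1" by (rule Q.emeasure_le_1)
      then show ?thesis using True by (simp add: add_increasing2)
    next
      case False
      then show ?thesis using good[of u] u \<eta> by (simp add: Q.emeasure_eq_measure ennreal_leI)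
    qed
  qed
  also have "\<dots> = emeasure P Bad + ennreal \<eta>"
    using Bad by (subst nn_integral_add) (auto simp: P.emeasure_space_1)
  finally show ?thesis
    using \<eta> by (simp add: emeasure_eq_measure P.emeasure_eq_measure ennreal_plus[symmetric] del: ennreal_plus)
qed

end

section \<open>Rates in probability\<close>

text \<open>
  The connection between the product space and the probability space of the observations is
  the joint law of the design and the errors.
\<close>

locale two_step_sample = two_step_model f f' f'' K A B L F F1 F2 g m W X0 R Bw Lp G0 G1 \<rho> p0 +
  prob_space M
  for f f' f'' K :: "real \<Rightarrow> real" and A B L F F1 F2 :: real
    and g m W :: "real^'d \<Rightarrow> real" and X0 :: "(real^'d) set" and R Bw Lp G0 G1 \<rho> p0 :: real
    and M :: "'a measure" +
  fixes X :: "nat \<Rightarrow> 'a \<Rightarrow> real^'d" and Y :: "nat \<Rightarrow> 'a \<Rightarrow> real"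
  assumes X_measurable [measurable]: "\<And>i. X i \<in> borel_measurable M"
    and Y_measurable [measurable]: "\<And>i. Y i \<in> borel_measurable M"
    and sample_law: "\<And>n. 0 < n \<Longrightarrow>
      distr M ((\<Pi>\<^sub>M i\<in>{1..n}. borel) \<Otimes>\<^sub>M (\<Pi>\<^sub>M i\<in>{1..n}. borel))
        (\<lambda>\<omega>. (\<lambda>i\<in>{1..n}. X i \<omega>, \<lambda>i\<in>{1..n}. reg_error m X Y i \<omega>))
      = (\<Pi>\<^sub>M i\<in>{1..n}. des.design_law) \<Otimes>\<^sub>M (\<Pi>\<^sub>M i\<in>{1..n}. reg.error_law)"
begin

abbreviation designs :: "nat \<Rightarrow> 'a \<Rightarrow> nat \<Rightarrow> real^'d" where
  "designs n \<omega> \<equiv> \<lambda>i\<in>{1..n}. X i \<omega>"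

abbreviation errors :: "nat \<Rightarrow> 'a \<Rightarrow> nat \<Rightarrow> real" where
  "errors n \<omega> \<equiv> \<lambda>i\<in>{1..n}. reg_error m X Y i \<omega>"

abbreviation design_sample :: "nat \<Rightarrow> (nat \<Rightarrow> real^'d) measure" where
  "design_sample n \<equiv> \<Pi>\<^sub>M i\<in>{1..n}. des.design_law"

abbreviation borel_prod2 :: "nat \<Rightarrow> ((nat \<Rightarrow> real^'d) \<times> (nat \<Rightarrow> real)) measure" where
  "borel_prod2 n \<equiv> (\<Pi>\<^sub>M i\<in>{1..n}. borel) \<Otimes>\<^sub>M (\<Pi>\<^sub>M i\<in>{1..n}. borel)"

lemma f_feasible_eq: "f_feasible W K b0 b1 X0 X Y n e \<omega> = feasible n b0 b1 e (designs n \<omega>) (errors n \<omega>)"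
proof -
  have "m_loo W b0 (\<lambda>i p. fst p i) (\<lambda>i p. m (fst p i) + snd p i) n i (designs n \<omega>, errors n \<omega>)
      = m_loo W b0 X Y n i \<omega>" if "i \<in> {1..n}" for i
    unfolding m_loo_def using that
    by (intro arg_cong2[where f="(/)"] sum.cong) (auto simp: reg_error_def)
  then show ?thesis
    unfolding feasible_def f_feasible_def kernel_density_def est_error_def
    by (intro arg_cong2[where f="(/)"] arg_cong2[where f="(*)"] sum.cong refl) (auto simp: reg_error_def)
qed

lemma f_unfeasible_eq: "f_unfeasible K b1 X0 m X Y n e \<omega> = unfeasible n b1 e (designs n \<omega>) (errors n \<omega>)"
  unfolding unfeasible_def f_unfeasible_def kernel_density_def
  by (intro arg_cong2[where f="(/)"] arg_cong2[where f="(*)"] sum.cong refl) (auto simp: reg_error_def)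

lemma designs_measurable: "designs n \<in> measurable M (\<Pi>\<^sub>M i\<in>{1..n}. borel)"
  by (intro measurable_restrict X_measurable)

lemma reg_error_measurable: "reg_error m X Y i \<in> borel_measurable M"
  unfolding reg_error_def[abs_def] by measurable

lemma errors_measurable: "errors n \<in> measurable M (\<Pi>\<^sub>M i\<in>{1..n}. borel)"
  by (intro measurable_restrict reg_error_measurable)

lemma components_measurable:
  assumes "i \<in> {1..n}"
  shows "(\<lambda>p. fst p i) \<in> borel_measurable (borel_prod2 n)" "(\<lambda>p. snd p i) \<in> borel_measurable (borel_prod2 n)"
  by (rule measurable_compose[OF measurable_fst measurable_component_singleton[OF assms]],
      rule measurable_compose[OF measurable_snd measurable_component_singleton[OF assms]])

lemma feasible_measurable: "(\<lambda>p. feasible n b0 b1 e (fst p) (snd p)) \<in> borel_measurable (borel_prod2 n)"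
proof -
  have loo: "(\<lambda>p. m_loo W b0 (\<lambda>i p. fst p i) (\<lambda>i p. m (fst p i) + snd p i) n i p) \<in> borel_measurable (borel_prod2 n)"
    if i: "i \<in> {1..n}" for i
    unfolding m_loo_def
  proof (intro borel_measurable_divide borel_measurable_sum)
    fix j assume "j \<in> {1..n} - {i}"
    then have j: "j \<in> {1..n}" by simp
    note [measurable] = components_measurable[OF i] components_measurable[OF j]
    show "(\<lambda>p. (m (fst p j) + snd p j) * W ((fst p j - fst p i) /\<^sub>R b0)) \<in> borel_measurable (borel_prod2 n)"
      by measurable
    show "(\<lambda>p. W ((fst p j - fst p i) /\<^sub>R b0)) \<in> borel_measurable (borel_prod2 n)"
      by measurable
  qed
  show ?thesis
    unfolding feasible_def f_feasible_def kernel_density_def est_error_def prod.collapse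
  proof (intro borel_measurable_divide borel_measurable_sum borel_measurable_times borel_measurable_const)
    fix i assume i: "i \<in> {1..n}"
    note [measurable] = components_measurable[OF i] loo[OF i]
    show "(\<lambda>p. indicator X0 (fst p i)) \<in> borel_measurable (borel_prod2 n)" by measurable
    show "(\<lambda>p. indicator X0 (fst p i)) \<in> borel_measurable (borel_prod2 n)" by measurable
    show "(\<lambda>p. K ((m (fst p i) + snd p i
        - m_loo W b0 (\<lambda>i p. fst p i) (\<lambda>i p. m (fst p i) + snd p i) n i p - e) / b1)) \<in> borel_measurable (borel_prod2 n)"
      by measurable
  qed
qed

lemma unfeasible_measurable: "(\<lambda>p. unfeasible n b1 e (fst p) (snd p)) \<in> borel_measurable (borel_prod2 n)"
  unfolding unfeasible_def f_unfeasible_def kernel_density_def reg_error_def prod.collapse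
proof (intro borel_measurable_divide borel_measurable_sum borel_measurable_times borel_measurable_const)
  fix i assume i: "i \<in> {1..n}"
  note [measurable] = components_measurable[OF i]
  show "(\<lambda>p. indicator X0 (fst p i)) \<in> borel_measurable (borel_prod2 n)" by measurable
  show "(\<lambda>p. indicator X0 (fst p i)) \<in> borel_measurable (borel_prod2 n)" by measurable
  show "(\<lambda>p. K ((m (fst p i) + snd p i - m (fst p i) - e) / b1)) \<in> borel_measurable (borel_prod2 n)"
    by measurable
qed

lemma unfeasible_le:
  assumes b1: "0 < b1"
  shows "\<bar>unfeasible n b1 e x y\<bar> \<le> B / b1"
proof (cases "selected n x = {}")
  case True
  then show ?thesis using b1 reg.constants_nonneg by (simp add: unfeasible_eq reg.oracle_density_def)
next
  case False
  let ?N = "real (card (selected n x))"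
  have N: "0 < ?N" using False by (simp add: card_gt_0_iff selected_def)
  have "\<bar>\<Sum>i\<in>selected n x. K ((y i - e) / b1)\<bar> \<le> (\<Sum>i\<in>selected n x. B)"
    by (rule order_trans[OF sum_abs sum_mono[OF reg.K_le]])
  then have "\<bar>\<Sum>i\<in>selected n x. K ((y i - e) / b1)\<bar> / (b1 * ?N) \<le> ?N * B / (b1 * ?N)"
    using b1 N by (intro divide_right_mono) auto
  also have "\<dots> = B / b1" using N by simp
  finally show ?thesis using b1 N by (simp add: unfeasible_eq reg.oracle_density_def abs_divide abs_mult)
qed

lemma prob_space_samples: "prob_space (design_sample n)" "prob_space (error_sample n)"
  by (auto intro!: prob_space_PiM des.design.prob_space_axioms reg.error.prob_space_axioms)

lemma sets_samples: "sets (design_sample n) = sets (\<Pi>\<^sub>M i\<in>{1..n}. borel)"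
    "sets (error_sample n) = sets (\<Pi>\<^sub>M i\<in>{1..n}. borel)"
  by (auto intro!: sets_PiM_cong)

lemma AMSE_eq:
  assumes n: "0 < n" and b1: "0 < b1"
  shows "AE \<omega> in M. AMSE M K b1 X0 m X Y f n e \<omega> = cond_mse n b1 e (designs n \<omega>)"
proof -
  let ?\<phi> = "\<lambda>p. (unfeasible n b1 e (fst p) (snd p) - f e)\<^sup>2"
  have \<phi>: "?\<phi> \<in> borel_measurable (borel_prod2 n)"
    using unfeasible_measurable by (intro borel_measurable_power borel_measurable_diff) auto
  have bnd: "\<bar>?\<phi> p\<bar> \<le> (B / b1 + \<bar>f e\<bar>)\<^sup>2" for p
  proof -
    have "\<bar>unfeasible n b1 e (fst p) (snd p) - f e\<bar> \<le> \<bar>B / b1 + \<bar>f e\<bar>\<bar>"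
      using unfeasible_le[OF b1, of n e "fst p" "snd p"] by linarith
    then have "?\<phi> p \<le> (B / b1 + \<bar>f e\<bar>)\<^sup>2" by (simp only: abs_le_square_iff)
    then show ?thesis by simp
  qed
  have "AE \<omega> in M. real_cond_exp M (vimage_algebra (space M) (designs n) (\<Pi>\<^sub>M i\<in>{1..n}. borel))
      (\<lambda>\<omega>. ?\<phi> (designs n \<omega>, errors n \<omega>)) \<omega> = (\<integral>v. ?\<phi> (designs n \<omega>, v) \<partial>error_sample n)"
    by (rule real_cond_exp_product_law[OF designs_measurable errors_measurable sample_law[OF n]
          prob_space_samples(1) sets_samples(1) prob_space_samples(2) sets_samples(2) \<phi> bnd])
  then show ?thesis by (simp add: AMSE_def cond_exp_n_def cond_mse_def f_unfeasible_eq)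
qed

lemma AMSE_measurable: "AMSE M K b1 X0 m X Y f n e \<in> borel_measurable M"
  unfolding AMSE_def cond_exp_n_def by (rule borel_measurable_cond_exp2)

lemma f_feasible_measurable: "f_feasible W K b0 b1 X0 X Y n e \<in> borel_measurable M"
proof -
  have "(\<lambda>\<omega>. (designs n \<omega>, errors n \<omega>)) \<in> measurable M (borel_prod2 n)"
    by (rule measurable_Pair[OF designs_measurable errors_measurable])
  from measurable_compose[OF this feasible_measurable] show ?thesis
    by (simp add: f_feasible_eq[abs_def])
qed

lemma cond_mse_measurable: "cond_mse n b1 e \<in> borel_measurable (design_sample n)"
proof -
  interpret E: prob_space "error_sample n" by (rule prob_space_samples)
  have "(\<lambda>p. (unfeasible n b1 e (fst p) (snd p) - f e)\<^sup>2) \<in> borel_measurable (borel_prod2 n)"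
    using unfeasible_measurable by (intro borel_measurable_power borel_measurable_diff) auto
  then have "(\<lambda>p. (unfeasible n b1 e (fst p) (snd p) - f e)\<^sup>2) \<in> borel_measurable (design_sample n \<Otimes>\<^sub>M error_sample n)"
    using measurable_cong_sets[OF sets_pair_measure_cong[OF sets_samples] refl] by blast
  then show ?thesis unfolding cond_mse_def[abs_def]
    by (intro E.borel_measurable_lebesgue_integral) (simp add: split_beta')
qed

lemma prob_le_of_samples:
  assumes n: "0 < n" and Bad: "Bad \<in> sets (design_sample n)" and \<eta>: "0 \<le> \<eta>"
    and E: "{p \<in> space (design_sample n \<Otimes>\<^sub>M error_sample n). H (fst p) (snd p)}
        \<in> sets (design_sample n \<Otimes>\<^sub>M error_sample n)"
    and good: "\<And>x. x \<in> space (design_sample n) - Bad \<Longrightarrow>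
        measure (error_sample n) {y \<in> space (error_sample n). H x y} \<le> \<eta>"
  shows "prob {\<omega> \<in> space M. H (designs n \<omega>) (errors n \<omega>)} \<le> measure (design_sample n) Bad + \<eta>"
proof -
  let ?E = "{p \<in> space (design_sample n \<Otimes>\<^sub>M error_sample n). H (fst p) (snd p)}"
  have xy: "(\<lambda>\<omega>. (designs n \<omega>, errors n \<omega>)) \<in> measurable M (borel_prod2 n)"
    by (rule measurable_Pair[OF designs_measurable errors_measurable])
  have sp: "space (design_sample n \<Otimes>\<^sub>M error_sample n) = space (borel_prod2 n)"
    by (rule sets_eq_imp_space_eq[OF sets_pair_measure_cong[OF sets_samples]])
  have "prob {\<omega> \<in> space M. (designs n \<omega>, errors n \<omega>) \<in> ?E} \<le> measure (design_sample n) Bad + \<eta>"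
  proof (rule prob_le_of_product_law[OF xy sample_law[OF n] prob_space_samples E Bad \<eta>])
    fix x assume x: "x \<in> space (design_sample n) - Bad"
    then have "Pair x -` ?E = {y \<in> space (error_sample n). H x y}"
      by (auto simp: space_pair_measure)
    then show "measure (error_sample n) (Pair x -` ?E) \<le> \<eta>" using good[OF x] by simp
  qed
  also have "{\<omega> \<in> space M. (designs n \<omega>, errors n \<omega>) \<in> ?E} = {\<omega> \<in> space M. H (designs n \<omega>) (errors n \<omega>)}"
    using measurable_space[OF xy] unfolding sp by auto
  finally show ?thesis .
qed

text \<open>
  The first bandwidth condition makes \<open>n * b0 ^ (d + 2)\<close> exceed every multiple of \<open>ln n\<close>, so that
  the union bound over \<open>n\<close> points still tends to 0. The second one implies \<open>n * b1 ^ 3 \<ge> 1\<close>: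
  otherwise \<open>n ^ (d + 8) * b1 ^ (7 * d + 28)\<close>, which equals
  \<open>(n * b1 ^ 3) ^ (d + 8) * b1 ^ (4 * d + 4)\<close>, would be less than 1.
\<close>

lemma bandwidth_eventually:
  fixes b0 b1 :: "nat \<Rightarrow> real" and \<delta> \<kappa> b' b'' :: real
  assumes b0: "\<And>n. 0 < b0 n" "b0 \<longlonglongrightarrow> 0" and b1: "\<And>n. 0 < b1 n" "b1 \<longlonglongrightarrow> 0"
    and A9: "filterlim (\<lambda>n. n * b0 n ^ max (d + 2) (2 * d) / ln n) at_top sequentially"
    and A10: "filterlim (\<lambda>n. real n ^ (d + 8) * b1 n ^ (7 * (d + 4))) at_top sequentially"
    and pos: "0 < \<delta>" "0 < \<kappa>" "0 < b'" "0 < b''"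
  shows "\<forall>\<^sub>F n in sequentially. 2 \<le> n \<and> b0 n \<le> b' \<and> b0 n \<le> 1 \<and> b1 n \<le> b'' \<and> b1 n \<le> 1 \<and>
    1 \<le> real n * b0 n ^ (d + 2) \<and> 1 \<le> real n * b1 n ^ 3 \<and>
    5 * (n * exp (- \<kappa> * (n * b0 n ^ (d + 2)))) + exp (- \<kappa> * n) \<le> \<delta>"
proof -
  have e1: "\<forall>\<^sub>F n in sequentially. b0 n < min b' 1" "\<forall>\<^sub>F n in sequentially. b1 n < min b'' 1"
    using order_tendstoD(2)[OF b0(2), of "min b' 1"] order_tendstoD(2)[OF b1(2), of "min b'' 1"] pos
    by (simp_all only: min_less_iff_conj zero_less_one simp_thms)
  have e2: "\<forall>\<^sub>F n in sequentially. max 1 (2 / \<kappa>) \<le> n * b0 n ^ max (d + 2) (2 * d) / ln n"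
    using A9 unfolding filterlim_at_top by blast
  have e3: "\<forall>\<^sub>F n in sequentially. 1 \<le> real n ^ (d + 8) * b1 n ^ (7 * (d + 4))"
    using A10 unfolding filterlim_at_top by blast
  have t1: "(\<lambda>n. 5 * (1 / real n) + exp (- \<kappa> * real n)) \<longlonglongrightarrow> 5 * 0 + 0"
  proof (intro tendsto_add tendsto_mult tendsto_const lim_1_over_n)
    have "filterlim (\<lambda>n. - \<kappa> * real n) at_bot sequentially"
      using pos by (intro filterlim_tendsto_neg_mult_at_bot[OF tendsto_const] filterlim_real_sequentially) auto
    then show "(\<lambda>n. exp (- \<kappa> * real n)) \<longlonglongrightarrow> 0" by (rule filterlim_compose[OF exp_at_bot])
  qed
  have e4: "\<forall>\<^sub>F n in sequentially. 5 * (1 / real n) + exp (- \<kappa> * real n) < \<delta>"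
    using order_tendstoD(2)[OF t1, of \<delta>] pos by simp
  show ?thesis
    using e1 e2 e3 e4 eventually_ge_at_top[of "3::nat"]
  proof eventually_elim
    case (elim n)
    have n: "3 \<le> n" and nr: "0 < real n" using elim by auto
    have ln1: "1 \<le> ln (real n)"
    proof -
      have "exp 1 \<le> real n" using exp_le n by linarith
      then show ?thesis using nr ln_ge_iff by blast
    qed
    have "max 1 (2 / \<kappa>) * ln (real n) \<le> n * b0 n ^ max (d + 2) (2 * d)"
    proof -
      have "0 < ln (real n)" using ln1 by linarith
      then show ?thesis using elim(3) by (simp only: pos_le_divide_eq)
    qed
    also have "\<dots> \<le> n * b0 n ^ (d + 2)"
      using elim(1) b0(1)[of n] by (intro mult_left_mono power_decreasing) auto
    finally have big: "max 1 (2 / \<kappa>) * ln (real n) \<le> n * b0 n ^ (d + 2)" .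
    have m1: "1 * ln (real n) \<le> max 1 (2 / \<kappa>) * ln (real n)"
      and m2: "2 / \<kappa> * ln (real n) \<le> max 1 (2 / \<kappa>) * ln (real n)"
      using ln1 by (intro mult_right_mono; simp)+
    have b0n: "1 \<le> n * b0 n ^ (d + 2)" using m1 big ln1 by linarith
    have "2 / \<kappa> * ln (real n) \<le> n * b0 n ^ (d + 2)" using m2 big by linarith
    then have "\<kappa> * (2 / \<kappa> * ln (real n)) \<le> \<kappa> * (n * b0 n ^ (d + 2))"
      using pos by (intro mult_left_mono) auto
    then have k: "2 * ln (real n) \<le> \<kappa> * (n * b0 n ^ (d + 2))" using pos by simp
    have "n * exp (- \<kappa> * (n * b0 n ^ (d + 2))) \<le> n * exp (- (2 * ln (real n)))"
      using k by (intro mult_left_mono) auto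
    also have "exp (- (2 * ln (real n))) = 1 / (real n)\<^sup>2"
    proof -
      have "exp (2 * ln (real n)) = (exp (ln (real n)))\<^sup>2"
        by (simp add: exp_double power2_eq_square)
      then show ?thesis using nr by (simp add: exp_minus inverse_eq_divide)
    qed
    also have "n * (1 / (real n)\<^sup>2) = 1 / real n" using nr by (simp add: power2_eq_square)
    finally have tail: "n * exp (- \<kappa> * (n * b0 n ^ (d + 2))) \<le> 1 / real n" .
    have b1n: "1 \<le> real n * b1 n ^ 3"
    proof (rule ccontr)
      assume "\<not> 1 \<le> real n * b1 n ^ 3"
      then have lt: "real n * b1 n ^ 3 < 1" by simp
      have p: "0 \<le> real n * b1 n ^ 3" using b1(1)[of n] by simp
      have "real n ^ (d + 8) * b1 n ^ (7 * (d + 4)) = (real n * b1 n ^ 3) ^ (d + 8) * b1 n ^ (4 * d + 4)"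
        by (simp add: power_mult_distrib power_mult[symmetric] power_add[symmetric])
      also have "\<dots> \<le> (real n * b1 n ^ 3) ^ (d + 8) * 1"
        using elim(2) b1(1)[of n] p by (intro mult_left_mono power_le_one) auto
      also have "\<dots> < 1" using lt p power_less_one_iff[of "real n * b1 n ^ 3" "d + 8"] by simp
      finally show False using elim(4) by simp
    qed
    show ?case using elim n b0n b1n tail by auto
  qed
qed

text \<open>
  Outside a set of designs of vanishing probability, the conditional mean-square error is bounded
  deterministically, and the mean absolute error of the feasible estimator given the design is at
  most a constant times the rate; Markov's inequality for the errors then gives the second claim.
\<close>

lemma rates_in_probability:
  fixes b0 b1 :: "nat \<Rightarrow> real" and e :: real
  assumes "\<And>n. 0 < b0 n" "b0 \<longlonglongrightarrow> 0" and "\<And>n. 0 < b1 n" "b1 \<longlonglongrightarrow> 0"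
    and "filterlim (\<lambda>n. n * b0 n ^ max (CARD('d) + 2) (2 * CARD('d)) / ln n) at_top sequentially"
    and "filterlim (\<lambda>n. real n ^ (CARD('d) + 8) * b1 n ^ (7 * (CARD('d) + 4))) at_top sequentially"
  shows "big_O_prob M (\<lambda>n \<omega>. AMSE M K (b1 n) X0 m X Y f n e \<omega>) (\<lambda>n \<omega>. b1 n ^ 4 + 1 / (n * b1 n))"
    and "big_O_prob M
      (\<lambda>n \<omega>. f_feasible W K (b0 n) (b1 n) X0 X Y n e \<omega> - f e)
      (\<lambda>n \<omega>. sqrt (AMSE M K (b1 n) X0 m X Y f n e \<omega> + R_rate CARD('d) n (b0 n) (b1 n)))"
proof -
  obtain c C \<kappa> b' where c: "0 < c" "0 < C" "0 < \<kappa>" "0 < b'"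
    and good: "\<And>n b. 2 \<le> n \<Longrightarrow> 0 < b \<Longrightarrow> b \<le> b' \<Longrightarrow>
      \<exists>Bad\<in>sets (design_sample n).
        measure (design_sample n) Bad \<le> 5 * (n * exp (- \<kappa> * (n * b ^ (CARD('d) + 2)))) + exp (- \<kappa> * n) \<and>
        (\<forall>x\<in>space (design_sample n) - Bad. des.good_design c C n b x)"
    using des.good_design_probability by metis
  \<comment> \<open>For bandwidths up to this size the kernel variance is at least half of its second moment.\<close>
  define b'' where "b'' = 1 / (4 * A * F + 1)"
  have AF: "0 \<le> 4 * A * F" using reg.constants_nonneg reg.pos by auto
  have b'': "0 < b''" using AF by (simp add: b''_def)
  have b''_le: "4 * A * F * b \<le> 1" if "0 < b" "b \<le> b''" for b
  proof -
    have "b * (4 * A * F + 1) \<le> 1" using that AF by (simp add: b''_def pos_le_divide_eq)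
    then show ?thesis using that by (simp add: algebra_simps)
  qed
  define C1 where "C1 = reg.error_bound_const (C / c + C / c\<^sup>2) (p0 / 2) * 5 + 1"
  have C1: "0 < C1" unfolding C1_def
    using reg.error_bound_const_nonneg[of "C / c + C / c\<^sup>2" "p0 / 2"] c des.pos
    by (intro add_nonneg_pos) auto
  define C2 where "C2 = (2 * A * B * (F2 * A\<^sup>2))\<^sup>2 + 4 * A * B * (B * F) / p0 + 1"
  have C2: "0 < C2" unfolding C2_def using reg.constants_nonneg reg.pos des.pos by (intro add_nonneg_pos) auto
  note ev = bandwidth_eventually[OF assms _ c(3,4) b'']
  show "big_O_prob M (\<lambda>n \<omega>. AMSE M K (b1 n) X0 m X Y f n e \<omega>) (\<lambda>n \<omega>. b1 n ^ 4 + 1 / (n * b1 n))"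
    unfolding big_O_prob_def
  proof (intro allI impI exI[of _ C2] conjI C2)
    fix \<delta> :: real assume \<delta>: "0 < \<delta>"
    show "\<forall>\<^sub>F n in sequentially.
        {\<omega> \<in> space M. \<bar>AMSE M K (b1 n) X0 m X Y f n e \<omega>\<bar> > C2 * \<bar>b1 n ^ 4 + 1 / (n * b1 n)\<bar>} \<in> sets M \<and>
        measure M {\<omega> \<in> space M. \<bar>AMSE M K (b1 n) X0 m X Y f n e \<omega>\<bar> > C2 * \<bar>b1 n ^ 4 + 1 / (n * b1 n)\<bar>} \<le> \<delta>"
      using ev[OF \<delta>]
    proof eventually_elim
      case (elim n)
      note [measurable] = AMSE_measurable[of "b1 n" n e] cond_mse_measurable[of n "b1 n" e]
      have n: "0 < n" and n2: "2 \<le> n" using elim by auto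
      have b1: "0 < b1 n" by (rule assms(3))
      let ?r = "b1 n ^ 4 + 1 / (n * b1 n)"
      have r: "0 < ?r" using b1 n by (intro add_pos_pos) auto
      let ?S = "{\<omega> \<in> space M. \<bar>AMSE M K (b1 n) X0 m X Y f n e \<omega>\<bar> > C2 * \<bar>?r\<bar>}"
      let ?T = "{\<omega> \<in> space M. \<bar>cond_mse n (b1 n) e (designs n \<omega>)\<bar> > C2 * \<bar>?r\<bar>}"
      have S: "?S \<in> sets M" by measurable
      have m_cond: "(\<lambda>\<omega>. cond_mse n (b1 n) e (designs n \<omega>)) \<in> borel_measurable M"
        using measurable_compose[OF designs_measurable] cond_mse_measurable measurable_cong_sets[OF sets_samples(1) refl] by blast
      have T: "?T \<in> sets M" using m_cond by measurable
      have ST: "measure M ?S = measure M ?T"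
      proof (rule finite_measure_eq_AE[OF _ S T])
        show "AE \<omega> in M. \<omega> \<in> ?S \<longleftrightarrow> \<omega> \<in> ?T"
          using AMSE_eq[OF n b1, of e] by (rule AE_mp) (rule AE_I2, simp)
      qed
      obtain Bad where Bad: "Bad \<in> sets (design_sample n)"
        "measure (design_sample n) Bad \<le> 5 * (n * exp (- \<kappa> * (n * b0 n ^ (CARD('d) + 2)))) + exp (- \<kappa> * n)"
        "\<And>x. x \<in> space (design_sample n) - Bad \<Longrightarrow> des.good_design c C n (b0 n) x"
        using good[OF n2 assms(1)[of n]] elim by blast
      have "measure M ?T \<le> measure (design_sample n) Bad + 0"
      proof (rule prob_le_of_samples[OF n Bad(1)])
        show "{p \<in> space (design_sample n \<Otimes>\<^sub>M error_sample n). C2 * \<bar>?r\<bar> < \<bar>cond_mse n (b1 n) e (fst p)\<bar>}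
            \<in> sets (design_sample n \<Otimes>\<^sub>M error_sample n)" by measurable
        fix x assume x: "x \<in> space (design_sample n) - Bad"
        note sel = selected_good_design(1)[OF Bad(3)[OF x]] selected_good_design(2)[OF Bad(3)[OF x] n]
        have "cond_mse n (b1 n) e x \<le> (C2 - 1) * ?r"
          unfolding C2_def using cond_mse_le[OF sel b1 n, of e] by simp
        also have "\<dots> \<le> C2 * \<bar>?r\<bar>" using r by (simp add: left_diff_distrib)
        finally have le: "cond_mse n (b1 n) e x \<le> C2 * \<bar>?r\<bar>" .
        have "0 \<le> cond_mse n (b1 n) e x" unfolding cond_mse_def by simp
        then have "{y \<in> space (error_sample n). C2 * \<bar>?r\<bar> < \<bar>cond_mse n (b1 n) e x\<bar>} = {}" using le by auto
        then show "measure (error_sample n) {y \<in> space (error_sample n). C2 * \<bar>?r\<bar> < \<bar>cond_mse n (b1 n) e x\<bar>} \<le> 0"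
          by (metis measure_empty order_refl)
      qed simp
      then show ?case using S ST Bad(2) elim by auto
    qed
  qed
  show "big_O_prob M
      (\<lambda>n \<omega>. f_feasible W K (b0 n) (b1 n) X0 X Y n e \<omega> - f e)
      (\<lambda>n \<omega>. sqrt (AMSE M K (b1 n) X0 m X Y f n e \<omega> + R_rate CARD('d) n (b0 n) (b1 n)))"
    unfolding big_O_prob_def
  proof (intro allI impI)
    fix \<delta> :: real assume \<delta>: "0 < \<delta>"
    \<comment> \<open>Chosen so that Markov's inequality yields the probability \<open>C1 / Cd = \<delta> / 2\<close>.\<close>
    define Cd where "Cd = 2 * C1 / \<delta>"
    have Cd: "0 < Cd" using C1 \<delta> by (simp add: Cd_def)
    have \<delta>2: "0 < \<delta> / 2" using \<delta> by simp
    let ?Z = "\<lambda>n \<omega>. \<bar>f_feasible W K (b0 n) (b1 n) X0 X Y n e \<omega> - f e\<bar>"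
    let ?a = "\<lambda>n \<omega>. \<bar>sqrt (AMSE M K (b1 n) X0 m X Y f n e \<omega> + R_rate CARD('d) n (b0 n) (b1 n))\<bar>"
    have "\<forall>\<^sub>F n in sequentially. {\<omega> \<in> space M. ?Z n \<omega> > Cd * ?a n \<omega>} \<in> sets M \<and>
        measure M {\<omega> \<in> space M. ?Z n \<omega> > Cd * ?a n \<omega>} \<le> \<delta>"
      using ev[OF \<delta>2]
    proof eventually_elim
      case (elim n)
      note [measurable] = AMSE_measurable[of "b1 n" n e] cond_mse_measurable[of n "b1 n" e]
        f_feasible_measurable[of "b0 n" "b1 n" n e]
      have n: "0 < n" and n2: "2 \<le> n" using elim by auto
      have b1: "0 < b1 n" and b0: "0 < b0 n" by (rule assms(3), rule assms(1))
      let ?R = "R_rate CARD('d) n (b0 n) (b1 n)"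
      let ?q = "\<lambda>x. \<bar>sqrt (cond_mse n (b1 n) e x + ?R)\<bar>"
      let ?H = "\<lambda>x y. Cd * ?q x < \<bar>feasible n (b0 n) (b1 n) e x y - f e\<bar>"
      have R: "0 < ?R" unfolding R_rate_def using b0 b1
        by (intro add_pos_nonneg mult_nonneg_nonneg) auto
      let ?S = "{\<omega> \<in> space M. ?Z n \<omega> > Cd * ?a n \<omega>}"
      let ?T = "{\<omega> \<in> space M. ?H (designs n \<omega>) (errors n \<omega>)}"
      have S: "?S \<in> sets M" by measurable
      have m_cond [measurable]: "(\<lambda>\<omega>. cond_mse n (b1 n) e (designs n \<omega>)) \<in> borel_measurable M"
        using measurable_compose[OF designs_measurable] cond_mse_measurable measurable_cong_sets[OF sets_samples(1) refl] by blast
      have T: "?T \<in> sets M" unfolding f_feasible_eq[symmetric] by measurable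
      have ST: "measure M ?S = measure M ?T"
      proof (rule finite_measure_eq_AE[OF _ S T])
        show "AE \<omega> in M. \<omega> \<in> ?S \<longleftrightarrow> \<omega> \<in> ?T"
          using AMSE_eq[OF n b1, of e] by (rule AE_mp) (rule AE_I2, simp add: f_feasible_eq)
      qed
      obtain Bad where Bad: "Bad \<in> sets (design_sample n)"
        "measure (design_sample n) Bad \<le> 5 * (n * exp (- \<kappa> * (n * b0 n ^ (CARD('d) + 2)))) + exp (- \<kappa> * n)"
        "\<And>x. x \<in> space (design_sample n) - Bad \<Longrightarrow> des.good_design c C n (b0 n) x"
        using good[OF n2 assms(1)[of n]] elim by blast
      have "measure M ?T \<le> measure (design_sample n) Bad + \<delta> / 2"
      proof (rule prob_le_of_samples[OF n Bad(1)])
        have [measurable]: "(\<lambda>p. feasible n (b0 n) (b1 n) e (fst p) (snd p)) \<in> borel_measurable (design_sample n \<Otimes>\<^sub>M error_sample n)"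
          using feasible_measurable measurable_cong_sets[OF sets_pair_measure_cong[OF sets_samples] refl] by blast
        show "{p \<in> space (design_sample n \<Otimes>\<^sub>M error_sample n). ?H (fst p) (snd p)}
            \<in> sets (design_sample n \<Otimes>\<^sub>M error_sample n)" by measurable
        fix x assume x: "x \<in> space (design_sample n) - Bad"
        note fg = feasible_error_good_design[OF c(1,2) Bad(3)[OF x] n b0 _ b1 b''_le[OF b1], where e=e]
        let ?h = "\<lambda>y. \<bar>feasible n (b0 n) (b1 n) e x y - f e\<bar>"
        have i: "integrable (error_sample n) ?h" using fg(2) elim by auto
        have 0: "0 \<le> cond_mse n (b1 n) e x" unfolding cond_mse_def by simp
        then have s: "0 < sqrt (cond_mse n (b1 n) e x + ?R)" using R by simp
        have I: "(\<integral>y. ?h y \<partial>error_sample n) \<le> C1 * sqrt (cond_mse n (b1 n) e x + ?R)"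
        proof -
          have "(\<integral>y. ?h y \<partial>error_sample n) \<le> (C1 - 1) * sqrt (cond_mse n (b1 n) e x + ?R)"
            unfolding C1_def using fg(1) elim by (simp add: mult.assoc)
          also have "\<dots> \<le> C1 * sqrt (cond_mse n (b1 n) e x + ?R)"
            using s by (intro mult_right_mono) auto
          finally show ?thesis .
        qed
        let ?t = "Cd * sqrt (cond_mse n (b1 n) e x + ?R)"
        have t: "0 < ?t" using Cd s by simp
        interpret E: prob_space "error_sample n" by (rule prob_space_samples)
        have "measure (error_sample n) {y \<in> space (error_sample n). ?H x y}
            \<le> measure (error_sample n) {y \<in> space (error_sample n). ?t \<le> ?h y}"
          using i s by (intro E.finite_measure_mono) auto
        also have "\<dots> \<le> (\<integral>y. ?h y \<partial>error_sample n) / ?t"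
          by (rule integral_Markov_inequality_measure[OF i, where A="{}"]) (use t in auto)
        also have "\<dots> \<le> C1 * sqrt (cond_mse n (b1 n) e x + ?R) / ?t"
          using I t by (intro divide_right_mono) auto
        also have "\<dots> = \<delta> / 2" using s C1 \<delta> by (simp add: Cd_def)
        finally show "measure (error_sample n) {y \<in> space (error_sample n). ?H x y} \<le> \<delta> / 2" .
      qed (use \<delta> in simp)
      then show ?case using S ST Bad(2) elim by auto
    qed
    then show "\<exists>C>0. \<forall>\<^sub>F n in sequentially. {\<omega> \<in> space M. ?Z n \<omega> > C * ?a n \<omega>} \<in> sets M \<and>
        measure M {\<omega> \<in> space M. ?Z n \<omega> > C * ?a n \<omega>} \<le> \<delta>"
      using Cd by blast
  qed
qed

end

section \<open>Constants supplied by the regularity assumptions\<close>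

lemma Ck_real_has_derivative:
  assumes "Ck_real k u" "j < k"
  shows "((deriv ^^ j) u has_real_derivative (deriv ^^ Suc j) u x) (at x)"
proof -
  have "(deriv ^^ j) u differentiable (at x)"
    using assms by (auto simp: Ck_real_def differentiable_on_def)
  then show ?thesis by (simp add: DERIV_deriv_iff_real_differentiable)
qed

lemma compact_support_bound:
  fixes u :: "'b::euclidean_space \<Rightarrow> real"
  assumes cont: "continuous_on UNIV u" and S: "compact S" "\<And>z. u z \<noteq> 0 \<Longrightarrow> z \<in> S"
  obtains C where "0 < C" "\<And>z. \<bar>u z\<bar> \<le> C"
proof -
  have "bounded (u ` S)"
    by (rule compact_imp_bounded[OF compact_continuous_image[OF continuous_on_subset[OF cont] S(1)]]) simp
  then obtain C where C: "0 < C" "\<And>z. z \<in> S \<Longrightarrow> \<bar>u z\<bar> \<le> C" by (auto simp: bounded_pos)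
  have "\<bar>u z\<bar> \<le> C" for z using C S(2)[of z] by (cases "u z = 0") auto
  then show ?thesis using that C(1) by blast
qed

text \<open>
  The derivative is bounded on a compact interval slightly larger than the support. Clamping the
  arguments to that interval does not change the values of \<open>K\<close>, which extends the Lipschitz bound
  to the whole line.
\<close>

lemma compactly_supported_C1_lipschitz:
  fixes K :: "real \<Rightarrow> real"
  assumes supp: "compact (closure {v. K v \<noteq> 0})" and C: "Ck_real k K" "2 \<le> k"
  obtains A B L where "0 < A" "0 < L" "\<And>v. A < \<bar>v\<bar> \<Longrightarrow> K v = 0" "\<And>v. \<bar>K v\<bar> \<le> B"
    "\<And>v v'. \<bar>K v - K v'\<bar> \<le> L * \<bar>v - v'\<bar>"
proof -
  obtain A where A: "0 < A" "\<And>v. v \<in> closure {v. K v \<noteq> 0} \<Longrightarrow> norm v \<le> A"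
    using compact_imp_bounded[OF supp] by (auto simp: bounded_pos)
  have Kz: "K v = 0" if "A < \<bar>v\<bar>" for v
    using A(2)[of v] closure_subset[of "{v. K v \<noteq> 0}"] that by (auto simp: not_le)
  have d0: "(K has_real_derivative deriv K v) (at v)" for v
    using Ck_real_has_derivative[OF C(1), of 0 v] C(2) by simp
  have d1: "(deriv K has_real_derivative deriv (deriv K) v) (at v)" for v
    using Ck_real_has_derivative[OF C(1), of 1 v] C(2) by simp
  have contK: "continuous_on UNIV K" and contK': "continuous_on UNIV (deriv K)"
    using DERIV_continuous_on[of UNIV K "deriv K"] DERIV_continuous_on[of UNIV "deriv K" "deriv (deriv K)"] d0 d1
    by simp_all
  have sub: "v \<in> closure {v. K v \<noteq> 0}" if "K v \<noteq> 0" for v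
    using that closure_subset[of "{v. K v \<noteq> 0}"] by blast
  obtain B where "0 < B" and B: "\<And>v. \<bar>K v\<bar> \<le> B"
    by (rule compact_support_bound[OF contK supp sub]) auto
  define A' where "A' = A + 1"
  have "bounded (deriv K ` {-A'..A'})"
    by (rule compact_imp_bounded[OF compact_continuous_image[OF continuous_on_subset[OF contK']]]) auto
  then obtain L where L: "0 < L" "\<And>v. v \<in> {-A'..A'} \<Longrightarrow> \<bar>deriv K v\<bar> \<le> L" by (auto simp: bounded_pos)
  have loc: "\<bar>K v - K v'\<bar> \<le> L * \<bar>v - v'\<bar>" if "v \<in> {-A'..A'}" "v' \<in> {-A'..A'}" for v v'
    using field_differentiable_bound[of "{-A'..A'}" K "deriv K" L v v'] that L(2) d0
    by (auto intro: has_field_derivative_at_within)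
  define cl where "cl v = max (- A') (min A' v)" for v
  have cl: "cl v \<in> {-A'..A'}" for v using A(1) by (auto simp: cl_def A'_def)
  have Kcl: "K (cl v) = K v" for v
  proof (cases "\<bar>v\<bar> \<le> A'")
    case True
    then have "cl v = v" by (auto simp: cl_def)
    then show ?thesis by simp
  next
    case False
    then have "A < \<bar>cl v\<bar>" "A < \<bar>v\<bar>" using A(1) by (auto simp: cl_def A'_def)
    then show ?thesis using Kz by simp
  qed
  have "\<bar>K v - K v'\<bar> \<le> L * \<bar>v - v'\<bar>" for v v'
  proof -
    have "\<bar>K v - K v'\<bar> \<le> L * \<bar>cl v - cl v'\<bar>" using loc[OF cl cl, of v v'] by (simp add: Kcl)
    also have "\<dots> \<le> L * \<bar>v - v'\<bar>" using L(1) by (intro mult_left_mono) (auto simp: cl_def)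
    finally show ?thesis .
  qed
  then show ?thesis using that A(1) L(1) Kz B by blast
qed

text \<open>
  The compact set \<open>X0\<close> keeps a positive distance from the boundary of \<open>S\<close>, so the same constants
  serve all of its points.
\<close>

lemma C2_over_inner_constants:
  fixes g m :: "real^'d \<Rightarrow> real"
  assumes S: "compact S" and X0: "closed X0" "X0 \<subseteq> interior S" "X0 \<noteq> {}"
    and g: "C2_over S g" "\<forall>x\<in>X0. 0 < g x" and m: "C2_over S m"
  obtains Lp G0 G1 \<rho> where "0 < Lp" "0 < G0" "0 < G1" "0 < \<rho>"
    "\<And>x. x \<in> X0 \<Longrightarrow> G0 \<le> g x"
    "\<And>x h. x \<in> X0 \<Longrightarrow> norm h \<le> \<rho> \<Longrightarrow> g (x + h) \<le> G1"
    "\<And>x h. x \<in> X0 \<Longrightarrow> norm h \<le> \<rho> \<Longrightarrow> \<bar>g (x + h) - g x\<bar> \<le> Lp * norm h"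
    "\<And>x h. x \<in> X0 \<Longrightarrow> norm h \<le> \<rho> \<Longrightarrow> \<bar>m (x + h) - m x\<bar> \<le> Lp * norm h"
    "\<And>x h. x \<in> X0 \<Longrightarrow> norm h \<le> \<rho> \<Longrightarrow> \<bar>m (x + h) + m (x - h) - 2 * m x\<bar> \<le> Lp * (norm h)\<^sup>2"
proof -
  have X0S: "X0 \<subseteq> S" using X0(2) interior_subset by blast
  have X0c: "compact X0" using compact_Int_closed[OF S X0(1)] X0S by (simp add: Int_absorb1)
  obtain \<rho> where \<rho>: "0 < \<rho>" "(\<Union>x\<in>X0. cball x \<rho>) \<subseteq> interior S"
    using compact_subset_open_imp_cball_epsilon_subset[OF X0c open_interior X0(2)] by blast
  have sub: "cball x (norm h) \<subseteq> interior S" if "x \<in> X0" "norm h \<le> \<rho>" for x h :: "real^'d"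
    using that \<rho>(2) by fastforce
  have gc: "continuous_on S g" using g(1) unfolding C2_over_def by blast
  obtain Lg where Lg: "0 \<le> Lg" "\<And>x h. cball x (norm h) \<subseteq> interior S \<Longrightarrow> \<bar>g (x + h) - g x\<bar> \<le> Lg * norm h"
    using C2_over_increments[OF g(1) S] by metis
  obtain Lm where Lm: "0 \<le> Lm" "\<And>x h. cball x (norm h) \<subseteq> interior S \<Longrightarrow> \<bar>m (x + h) - m x\<bar> \<le> Lm * norm h"
    "\<And>x h. cball x (norm h) \<subseteq> interior S \<Longrightarrow> \<bar>m (x + h) + m (x - h) - 2 * m x\<bar> \<le> Lm * (norm h)\<^sup>2"
    using C2_over_increments[OF m S] by metis
  have "bounded (g ` S)" by (rule compact_imp_bounded[OF compact_continuous_image[OF gc S]])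
  then obtain G1 where G1: "0 < G1" "\<And>x. x \<in> S \<Longrightarrow> \<bar>g x\<bar> \<le> G1" by (auto simp: bounded_pos)
  obtain x0 where x0: "x0 \<in> X0" "\<And>x. x \<in> X0 \<Longrightarrow> g x0 \<le> g x"
    using continuous_attains_inf[OF X0c X0(3) continuous_on_subset[OF gc X0S]] by blast
  define Lp where "Lp = Lg + Lm + 1"
  have Lp: "0 < Lp" "Lg \<le> Lp" "Lm \<le> Lp" using Lg(1) Lm(1) by (auto simp: Lp_def)
  show ?thesis
  proof (rule that[OF Lp(1) bspec[OF g(2) x0(1)] G1(1) \<rho>(1) x0(2)])
    fix x h :: "real^'d" assume xh: "x \<in> X0" "norm h \<le> \<rho>"
    note s = sub[OF xh]
    have "x + h \<in> S" using s interior_subset by (force simp: dist_norm)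
    then show "g (x + h) \<le> G1" using G1(2)[of "x + h"] by linarith
    show "\<bar>g (x + h) - g x\<bar> \<le> Lp * norm h"
      using Lg(2)[OF s] mult_right_mono[OF Lp(2) norm_ge_zero[of h]] by linarith
    show "\<bar>m (x + h) - m x\<bar> \<le> Lp * norm h"
      using Lm(2)[OF s] mult_right_mono[OF Lp(3) norm_ge_zero[of h]] by linarith
    show "\<bar>m (x + h) + m (x - h) - 2 * m x\<bar> \<le> Lp * (norm h)\<^sup>2"
      using Lm(3)[OF s] mult_right_mono[OF Lp(3) zero_le_power2[of "norm h"]] by linarith
  qed
qed

lemma (in prob_space) iid_regression_sample_law:
  fixes X :: "nat \<Rightarrow> 'a \<Rightarrow> real^'d" and Y :: "nat \<Rightarrow> 'a \<Rightarrow> real"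
  assumes indep: "indep_vars (\<lambda>_. borel) (\<lambda>i \<omega>. (X i \<omega>, Y i \<omega>)) UNIV"
    and ident: "\<And>i. distr M borel (\<lambda>\<omega>. (X i \<omega>, Y i \<omega>)) = distr M borel (\<lambda>\<omega>. (X 0 \<omega>, Y 0 \<omega>))"
    and m [measurable]: "m \<in> borel_measurable borel"
    and err: "\<And>i. indep_rv M (X i) (reg_error m X Y i)"
    and P: "distr M borel (X 0) = P" and Q: "distr M borel (reg_error m X Y 0) = Q"
  shows "X i \<in> borel_measurable M" "Y i \<in> borel_measurable M"
    and "0 < n \<Longrightarrow> distr M ((\<Pi>\<^sub>M i\<in>{1..n}. borel) \<Otimes>\<^sub>M (\<Pi>\<^sub>M i\<in>{1..n}. borel))
        (\<lambda>\<omega>. (\<lambda>i\<in>{1..n}. X i \<omega>, \<lambda>i\<in>{1..n}. reg_error m X Y i \<omega>))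
      = (\<Pi>\<^sub>M i\<in>{1..n}. P) \<Otimes>\<^sub>M (\<Pi>\<^sub>M i\<in>{1..n}. Q)"
proof -
  have XY: "(\<lambda>\<omega>. (X i \<omega>, Y i \<omega>)) \<in> borel_measurable M" for i
    using indep unfolding indep_vars_def by auto
  have f: "fst \<in> borel_measurable (borel :: ((real^'d) \<times> real) measure)"
    and s: "snd \<in> borel_measurable (borel :: ((real^'d) \<times> real) measure)"
    and r: "(\<lambda>p. snd p - m (fst p)) \<in> borel_measurable (borel :: ((real^'d) \<times> real) measure)"
    unfolding borel_prod[symmetric] by measurable
  have X: "X i \<in> borel_measurable M" and Y: "Y i \<in> borel_measurable M" for i
    using measurable_compose[OF XY f] measurable_compose[OF XY s] by simp_all
  then show "X i \<in> borel_measurable M" "Y i \<in> borel_measurable M" by auto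
  let ?\<epsilon> = "reg_error m X Y"
  have \<epsilon>: "?\<epsilon> i \<in> borel_measurable M" for i using X Y m unfolding reg_error_def[abs_def] by measurable
  have lawX: "distr M borel (X i) = P" for i
  proof -
    have e: "distr M borel (X i) = distr (distr M borel (\<lambda>\<omega>. (X i \<omega>, Y i \<omega>))) borel fst" for i
      by (simp add: distr_distr[OF f XY] comp_def)
    show ?thesis unfolding P[symmetric] e[of i] e[of 0] ident[of i] ..
  qed
  have lawE: "distr M borel (?\<epsilon> i) = Q" for i
  proof -
    have e: "distr M borel (?\<epsilon> i) = distr (distr M borel (\<lambda>\<omega>. (X i \<omega>, Y i \<omega>))) borel (\<lambda>p. snd p - m (fst p))" for i
      by (simp add: distr_distr[OF r XY] comp_def reg_error_def[abs_def])
    show ?thesis unfolding Q[symmetric] e[of i] e[of 0] ident[of i] ..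
  qed
  show "distr M ((\<Pi>\<^sub>M i\<in>{1..n}. borel) \<Otimes>\<^sub>M (\<Pi>\<^sub>M i\<in>{1..n}. borel))
        (\<lambda>\<omega>. (\<lambda>i\<in>{1..n}. X i \<omega>, \<lambda>i\<in>{1..n}. ?\<epsilon> i \<omega>))
      = (\<Pi>\<^sub>M i\<in>{1..n}. P) \<Otimes>\<^sub>M (\<Pi>\<^sub>M i\<in>{1..n}. Q)" if n: "0 < n"
  proof (rule law_of_independent_pairs)
    have "indep_vars (\<lambda>_. borel \<Otimes>\<^sub>M borel) (\<lambda>i \<omega>. (\<lambda>p. (fst p, snd p - m (fst p))) (X i \<omega>, Y i \<omega>)) UNIV"
      by (rule indep_vars_compose2[OF indep]) (intro measurable_Pair f r)
    then have "indep_vars (\<lambda>_. borel \<Otimes>\<^sub>M borel) (\<lambda>i \<omega>. (X i \<omega>, ?\<epsilon> i \<omega>)) UNIV"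
      by (simp add: reg_error_def)
    then show "indep_vars (\<lambda>_. borel \<Otimes>\<^sub>M borel) (\<lambda>i \<omega>. (X i \<omega>, ?\<epsilon> i \<omega>)) {1..n}"
      by (rule indep_vars_subset) simp
    fix i :: nat and A :: "(real^'d) set" and B :: "real set" assume A: "A \<in> sets borel" and B: "B \<in> sets borel"
    have "indep_set {X i -` A \<inter> space M | A. A \<in> sets borel} {?\<epsilon> i -` B \<inter> space M | B. B \<in> sets borel}"
      using err[of i] unfolding indep_rv_def by blast
    then have "prob ((X i -` A \<inter> space M) \<inter> (?\<epsilon> i -` B \<inter> space M))
        = prob (X i -` A \<inter> space M) * prob (?\<epsilon> i -` B \<inter> space M)"
      by (rule indep_setD) (use A B in auto)
    moreover have "X i -` A \<inter> space M \<inter> (?\<epsilon> i -` B \<inter> space M) = {\<omega> \<in> space M. X i \<omega> \<in> A \<and> ?\<epsilon> i \<omega> \<in> B}"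
      "X i -` A \<inter> space M = {\<omega> \<in> space M. X i \<omega> \<in> A}" "?\<epsilon> i -` B \<inter> space M = {\<omega> \<in> space M. ?\<epsilon> i \<omega> \<in> B}" by auto
    ultimately show "prob {\<omega> \<in> space M. X i \<omega> \<in> A \<and> ?\<epsilon> i \<omega> \<in> B}
        = prob {\<omega> \<in> space M. X i \<omega> \<in> A} * prob {\<omega> \<in> space M. ?\<epsilon> i \<omega> \<in> B}" by simp
  qed (use n lawX lawE in auto)
qed

theorem theorem4p1:
  fixes M :: "'a measure"
    and X :: "nat \<Rightarrow> 'a \<Rightarrow> real^'d" and Y :: "nat \<Rightarrow> 'a \<Rightarrow> real"
    and m g :: "real^'d \<Rightarrow> real" and f :: "real \<Rightarrow> real"
    and XX X0 :: "(real^'d) set"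
    and K0 :: "real^'d \<Rightarrow> real" and K1 :: "real \<Rightarrow> real"
    and b0 b1 :: "nat \<Rightarrow> real"
    and e :: real
  assumes "prob_space M"
    \<comment> \<open>(X 0, Y 0) is the generic pair (X, Y); the sample is (X 1, Y 1), (X 2, Y 2), ...\<close>
    and iid_indep: "prob_space.indep_vars M (\<lambda>_. borel) (\<lambda>i \<omega>. (X i \<omega>, Y i \<omega>)) UNIV"
    and iid_ident: "\<And>i. distr M borel (\<lambda>\<omega>. (X i \<omega>, Y i \<omega>)) = distr M borel (\<lambda>\<omega>. (X 0 \<omega>, Y 0 \<omega>))"
    and regression: "regression_function M (X 0) (Y 0) m"
    and density_X: "distributed M lborel (X 0) (\<lambda>x. ennreal (g x))" "\<And>x. g x \<ge> 0"
    and density_err: "distributed M lborel (reg_error m X Y 0) (\<lambda>u. ennreal (f u))" "\<And>u. f u \<ge> 0"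
    and A1: "XX = rv_support M (X 0)" "compact XX"
      "closed X0" "X0 \<subseteq> interior XX" "interior X0 \<noteq> {}"
    and A2: "\<And>x. x \<in> X0 \<Longrightarrow> g x > 0" "C2_over XX g"
    and A3: "C2_over XX m"
    and A4: "\<And>i. prob_space.expectation M (reg_error m X Y i) = 0"
      "\<And>i. integrable M (\<lambda>\<omega>. reg_error m X Y i \<omega> ^ 6)"
      "\<And>i. indep_rv M (X i) (reg_error m X Y i)"
    and A5: "Ck_real 2 f" "bounded (range ((deriv ^^ 2) f))"
      "\<And>p k. p \<in> {0, 1, 2::nat} \<Longrightarrow> k \<in> {0, 1, 2::nat} \<Longrightarrow>
        bounded (range ((deriv ^^ k) (\<lambda>u. u ^ p * f u)))"
    and A7: "\<And>z. K0 (- z) = K0 z" "continuous_on UNIV K0"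
      "closure {z. K0 z \<noteq> 0} \<subseteq> cbox (\<chi> i. - 1 / 2) (\<chi> i. 1 / 2)"
      "(LINT z|lborel. K0 z) = 1"
    and A8: "compact (closure {v. K1 v \<noteq> 0})" "Ck_real 3 K1"
      "(LINT v|lborel. K1 v) = 1" "(LINT v|lborel. v * K1 v) = 0"
    and A9: "\<And>n. b0 n > 0" "decseq b0" "b0 \<longlonglongrightarrow> 0"
      "filterlim (\<lambda>n. n * b0 n ^ max (CARD('d) + 2) (2 * CARD('d)) / ln n) at_top sequentially"
      "filterlim (\<lambda>n. ln (1 / b0 n) / ln (ln n)) at_top sequentially"
    and A10: "\<And>n. b1 n > 0" "decseq b1" "b1 \<longlonglongrightarrow> 0"
      "filterlim (\<lambda>n. real n ^ (CARD('d) + 8) * b1 n ^ (7 * (CARD('d) + 4))) at_top sequentially"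
  shows "big_O_prob M
      (\<lambda>n \<omega>. f_feasible K0 K1 (b0 n) (b1 n) X0 X Y n e \<omega> - f e)
      (\<lambda>n \<omega>. sqrt (AMSE M K1 (b1 n) X0 m X Y f n e \<omega> + R_rate CARD('d) n (b0 n) (b1 n)))
    \<and> big_O_prob M
      (\<lambda>n \<omega>. AMSE M K1 (b1 n) X0 m X Y f n e \<omega>)
      (\<lambda>n \<omega>. b1 n ^ 4 + 1 / (n * b1 n))"
proof -
  interpret M: prob_space M by fact
  let ?\<epsilon> = "reg_error m X Y"
  have m_meas: "m \<in> borel_measurable borel" using regression by (simp add: regression_function_def)
  have lawX: "distr M borel (X 0) = density lborel (\<lambda>x. ennreal (g x))"
    using distributed_distr_eq_density[OF density_X(1)] by (simp add: distr_cong[OF refl sets_lborel refl])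
  have law\<epsilon>: "distr M borel (?\<epsilon> 0) = density lborel (\<lambda>u. ennreal (f u))"
    using distributed_distr_eq_density[OF density_err(1)] by (simp add: distr_cong[OF refl sets_lborel refl])
  note sample = M.iid_regression_sample_law[OF iid_indep iid_ident m_meas A4(3) lawX law\<epsilon>]
  have \<epsilon>_meas: "?\<epsilon> 0 \<in> borel_measurable M"
    using sample(1,2) m_meas unfolding reg_error_def[abs_def] by measurable

  obtain A B L where K1: "0 < A" "0 < L" "\<And>v. A < \<bar>v\<bar> \<Longrightarrow> K1 v = 0" "\<And>v. \<bar>K1 v\<bar> \<le> B"
    "\<And>v v'. \<bar>K1 v - K1 v'\<bar> \<le> L * \<bar>v - v'\<bar>"
    by (rule compactly_supported_C1_lipschitz[OF A8(1,2)]) auto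
  obtain F where F: "\<And>u. \<bar>f u\<bar> \<le> F" using A5(3)[of 0 0] by (auto simp: bounded_iff)
  obtain F1 where F1: "\<And>u. \<bar>deriv f u\<bar> \<le> F1" using A5(3)[of 0 1] by (auto simp: bounded_iff)
  obtain F2 where F2: "0 < F2" "\<And>u. \<bar>deriv (deriv f) u\<bar> \<le> F2"
    using A5(2) by (auto simp: bounded_pos numeral_2_eq_2)
  have f_deriv: "(f has_real_derivative deriv f u) (at u)"
    and f'_deriv: "(deriv f has_real_derivative deriv (deriv f) u) (at u)" for u
    using Ck_real_has_derivative[OF A5(1), of 0 u] Ck_real_has_derivative[OF A5(1), of 1 u] by simp_all
  have f_prob: "prob_space (density lborel (\<lambda>u. ennreal (f u)))"
    unfolding law\<epsilon>[symmetric] by (rule M.prob_space_distr[OF \<epsilon>_meas])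
  have id_meas: "(\<lambda>u::real. u) \<in> borel_measurable borel" by simp
  have mean: "(\<integral>u. u \<partial>density lborel (\<lambda>u. ennreal (f u))) = 0"
    unfolding law\<epsilon>[symmetric] by (subst integral_distr[OF \<epsilon>_meas id_meas]) (rule A4(1))
  \<comment> \<open>Second moments exist because \<open>t\<^sup>2 \<le> 1 + t ^ 6\<close>.\<close>
  have sq: "integrable (density lborel (\<lambda>u. ennreal (f u))) (\<lambda>u. u\<^sup>2)"
    unfolding law\<epsilon>[symmetric]
  proof (subst integrable_distr_eq[OF \<epsilon>_meas])
    have "integrable M (\<lambda>\<omega>. 1 + ?\<epsilon> 0 \<omega> ^ 6)" using A4(2) by simp
    then show "integrable M (\<lambda>\<omega>. (?\<epsilon> 0 \<omega>)\<^sup>2)"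
    proof (rule Bochner_Integration.integrable_bound)
      have "t \<le> 1 + t ^ 3" if "0 \<le> t" for t :: real
      proof (cases "t \<le> 1")
        case True
        then show ?thesis using that by (simp add: add_increasing2)
      next
        case False
        then have "t ^ 1 \<le> t ^ 3" by (intro power_increasing) auto
        then show ?thesis by simp
      qed
      from this[of "(?\<epsilon> 0 \<omega>)\<^sup>2" for \<omega>] have "(?\<epsilon> 0 \<omega>)\<^sup>2 \<le> 1 + ?\<epsilon> 0 \<omega> ^ 6" for \<omega>
        by (simp add: power_mult[symmetric])
      then show "AE \<omega> in M. norm ((?\<epsilon> 0 \<omega>)\<^sup>2) \<le> norm (1 + ?\<epsilon> 0 \<omega> ^ 6)"
        by (auto intro!: AE_I2 intro: order_trans[OF _ abs_ge_self])
    qed (use \<epsilon>_meas in measurable)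
  qed simp

  have X0_ne: "X0 \<noteq> {}" using A1(5) interior_subset by blast
  have g_pos: "\<forall>x\<in>X0. 0 < g x" using A2(1) by blast
  obtain Lp G0 G1 \<rho> where D: "0 < Lp" "0 < G0" "0 < G1" "0 < \<rho>"
    "\<And>x. x \<in> X0 \<Longrightarrow> G0 \<le> g x"
    "\<And>x h. x \<in> X0 \<Longrightarrow> norm h \<le> \<rho> \<Longrightarrow> g (x + h) \<le> G1"
    "\<And>x h. x \<in> X0 \<Longrightarrow> norm h \<le> \<rho> \<Longrightarrow> \<bar>g (x + h) - g x\<bar> \<le> Lp * norm h"
    "\<And>x h. x \<in> X0 \<Longrightarrow> norm h \<le> \<rho> \<Longrightarrow> \<bar>m (x + h) - m x\<bar> \<le> Lp * norm h"
    "\<And>x h. x \<in> X0 \<Longrightarrow> norm h \<le> \<rho> \<Longrightarrow> \<bar>m (x + h) + m (x - h) - 2 * m x\<bar> \<le> Lp * (norm h)\<^sup>2"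
    by (fact C2_over_inner_constants[OF A1(2-4) X0_ne A2(2) g_pos A3])
  let ?box = "cbox (\<chi> i. - 1 / 2) (\<chi> i. 1 / 2) :: (real^'d) set"
  have K0_box: "z \<in> ?box" if "K0 z \<noteq> 0" for z
    using A7(3) closure_subset[of "{z. K0 z \<noteq> 0}"] that by blast
  obtain R where R: "0 < R" "\<And>z. z \<in> ?box \<Longrightarrow> norm z \<le> R"
    using compact_imp_bounded[OF compact_cbox, of "(\<chi> i. - 1 / 2) :: real^'d" "\<chi> i. 1 / 2"]
    unfolding bounded_pos by blast
  obtain Bw where Bw: "0 < Bw" "\<And>z. \<bar>K0 z\<bar> \<le> Bw"
    by (rule compact_support_bound[OF A7(2) compact_cbox K0_box]) auto
  define p0 where "p0 = measure (density lborel (\<lambda>x. ennreal (g x))) X0"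
  have X0_sets: "X0 \<in> sets borel" using A1(3) by simp
  \<comment> \<open>\<open>X0\<close> contains a ball around a point of the support of the design.\<close>
  have p0: "0 < p0"
  proof -
    obtain x where x: "x \<in> interior X0" using A1(5) by blast
    then obtain r where r: "0 < r" "ball x r \<subseteq> X0" by (meson mem_interior)
    have "x \<in> rv_support M (X 0)" using x A1(1,4) interior_subset by blast
    then have "0 < measure M {\<omega> \<in> space M. X 0 \<omega> \<in> ball x r}" using r(1) by (simp add: rv_support_def)
    also have "\<dots> \<le> measure M (X 0 -` X0 \<inter> space M)"
      using r(2) measurable_sets[OF sample(1) X0_sets] by (intro M.finite_measure_mono) auto
    also have "\<dots> = p0"
      unfolding p0_def lawX[symmetric] by (rule measure_distr[OF sample(1) X0_sets, symmetric])
    finally show ?thesis .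
  qed
  have g_meas: "g \<in> borel_measurable borel"
    using distributed_real_measurable[OF _ density_X(1)] density_X(2) by simp
  have K0_meas: "K0 \<in> borel_measurable borel" using A7(2) by (rule borel_measurable_continuous_onI)
  have g_prob: "prob_space (density lborel (\<lambda>x. ennreal (g x)))"
    unfolding lawX[symmetric] by (rule M.prob_space_distr[OF sample(1)])
  have fF: "f u \<le> F" for u using F[of u] by linarith

  have K0_norm: "norm z \<le> R" if "K0 z \<noteq> 0" for z using R(2) K0_box[OF that] by blast
  have "kernel_smoothing f (deriv f) (deriv (deriv f)) K1 A B L F F1 F2"
    by (rule kernel_smoothing.intro[OF density_err(2) fF f_deriv F1 f'_deriv F2(2) f_prob
          K1(3-5) A8(3,4) K1(1,2) F2(1)])
  then have reg: "kernel_regression f (deriv f) (deriv (deriv f)) K1 A B L F F1 F2"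
    by (rule kernel_regression.intro) (rule kernel_regression_axioms.intro[OF mean sq])
  have des: "kernel_design g m K0 X0 R Bw Lp G0 G1 \<rho> p0"
    by (rule kernel_design.intro[OF g_meas density_X(2) g_prob m_meas K0_meas X0_sets Bw(2) K0_norm
          A7(1,4) D(5-9) R(1) Bw(1) D(1-4) p0 order_eq_refl[OF p0_def]])
  interpret two_step_sample f "deriv f" "deriv (deriv f)" K1 A B L F F1 F2 g m K0 X0 R Bw Lp G0 G1 \<rho> p0 M X Y
    by (rule two_step_sample.intro[OF two_step_model.intro[OF reg des] M.prob_space_axioms
          two_step_sample_axioms.intro[OF sample]])
  note rate = rates_in_probability[OF A9(1,3) A10(1,3) A9(4) A10(4), of e]
  show ?thesis using rate by blast
qed

end
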